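(* Let $n\ge 2$ and $t\ge 1$ be integers, let $J\subset\{1,\dots,n\}$ be nonempty, let $r_k>0$ $(k\in J)$, let $\mathcal{X}(A_n,J)=\bigcup_{k\in J} r_k v_k^{A_n}$, and consider weight functions on it taking a constant value $w_k>0$ on $r_kv_k^{A_n}$ for each $k\in J$. Then $\mathcal{X}(A_n,J)$ is not a tight Euclidean $t$-design except for the following sets (up to multiplying all radii by a common positive constant and all weights by a common positive constant), which are tight Euclidean $t$-designs with the indicated weights: On one sphere: (a) $t=2$, any $n$, $J=\{1\}$, $r_1=1$, $w_1=1$; (b) $t=2$, any $n$, $J=\{n\}$, $r_n=1$, $w_n=1$; (c) $t=3$, $n=3$, $J=\{2\}$, $r_2=1$, $w_2=1$; (d) $t=5$, $n=2$, $J=\{1,2\}$, $r_1=r_2=1$, $w_1=w_2=1$; (e) $t=5$, $n=7$, $J=\{2,6\}$, $r_2=r_6=1$, $w_2=w_6=1$. On two spheres: (f) $t=4$, $n=2$, $J=\{1,2\}$, $r_1=1$, $r_2\neq 1$, $w_1=1$, $w_2=\frac{1}{r_2^3}$; (g) $t=4$, $n=4$, $J=\{1,3\}$, $r_1=1$, $r_3=\frac{1}{\sqrt6}$, $w_1=1$, $w_3=27$; (h) $t=4$, $n=4$, $J=\{2,4\}$, $r_4=1$, $r_2=\frac{1}{\sqrt6}$, $w_4=1$, $w_2=27$; (i) $t=4$, $n=5$, $J=\{1,4\}$, $r_1=1$, $r_4=\sqrt{8/5}$, $w_1=1$, $w_4=\frac12$; (j) $t=4$, $n=5$, $J=\{2,5\}$,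 $r_5=1$, $r_2=\sqrt{8/5}$, $w_5=1$, $w_2=\frac12$; (k) $t=4$, $n=6$, $J=\{1,5\}$, $r_1=1$, $r_5=\sqrt{15}$, $w_1=1$, $w_5=\frac1{81}$; (l) $t=4$, $n=6$, $J=\{2,6\}$, $r_6=1$, $r_2=\sqrt{15}$, $w_6=1$, $w_2=\frac1{81}$; (m) $t=5$, $n=3$, $J=\{1,2,3\}$, $r_1=r_3=1$, $r_2\ne1$, $w_1=w_3=1$, $w_2=\frac{9}{8r_2^4}$; (n) $t=5$, $n=5$, $J=\{1,3,5\}$, $r_1=r_5=1$, $r_3\ne 1$, $w_1=w_5=1$, $w_3=\frac{27}{25 r_3^4}$.
   Context: The group $A_n$: with $e_1,\dots,e_n$ the standard basis of $\mathbb{R}^n$, $A_n\subset O(\mathbb{R}^n)$ is the finite group generated by the reflections in the hyperplanes orthogonal to the fundamental roots $\alpha_i=e_i-e_{i+1}$ $(1\le i\le n-1)$ and $\alpha_n=(a,\dots,a,b)$, where $a=(-1+\sqrt{n+1})/n$, $b=(n-1+\sqrt{n+1})/n$. The corner vectors are the unit vectors $v_k=(c_k,\dots,c_k,d_k,\dots,d_k)$ $(1\le k\le n)$, with first $k$ coordinates $c_k$ and last $n-k$ coordinates $d_k$, where $$c_k=\frac{n+1-k+\sqrt{n+1}}{\sqrt{k(n+1-k)(n+2+2\sqrt{n+1})}},\qquad d_k=\frac{-k}{\sqrt{k(n+1-k)(n+2+2\sqrt{n+1})}};$$ they satisfy $v_i\perp\alpha_j$ if and only if $i\ne j$. $v_k^{A_n}$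 denotes the $A_n$-orbit of $v_k$. Euclidean design: let $X\subset\mathbb{R}^n$ be a finite set, let $\rho_1,\dots,\rho_p$ be the distinct norms of the vectors of $X$, let $S_i$ be the sphere of radius $\rho_i$ centered at the origin, $S=\bigcup_{i=1}^p S_i$, and $X_i=X\cap S_i$. Then $X$ is a Euclidean $t$-design (supported by $S$) if there is a weight function $w:X\to(0,\infty)$ such that $$\sum_{i=1}^p \Big(\sum_{x\in X_i} w(x)\Big)\frac{1}{|S_i|}\int_{S_i} f\,d\sigma_i=\sum_{x\in X} w(x)f(x)$$ for every polynomial $f$ of degree at most $t$, where $\sigma_i$ is the surface measure on $S_i$ and $|S_i|=\sigma_i(S_i)$ (if $S_i=\{0\}$, the average is read as $f(0)$). Tightness: let $\mathcal{P}_l(S)$ be the space of restrictions to $S$ of real polynomials of degree at most $l$, and $\mathcal{P}_l^*(S)$ the space of restrictions to $S$ of elements of $\bigoplus_{i=0}^{\lfloor l/2\rfloor}\mathrm{Hom}_{l-2i}(\mathbb{R}^n)$, where $\mathrm{Hom}_m(\mathbb{R}^n)$ is the space of real homogeneous polynomials of degree $m$. A Euclidean $2e$-design $X$ supported by $S$ satisfies $|X|\ge\dim\mathcal{P}_e(S)$. A Euclidean $(2e-1)$-design $X$ supported by $S$ satisfies $|X|\ge 2\dim\mathcal{P}^*_{e-1}(S)-1$ if $e$ is odd and $0\in X$, and $|X|\ge 2\dim\mathcal{P}^*_{e-1}(S)$ otherwise. A Euclidean $t$-design is tight if equality holds in the corresponding bound.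
   Formalization: In case (m) (t=5, n=3, J={1,2,3}) the weight is w_2 = 8/(9 r_2^4) instead of the printed w_2 = 9/(8 r_2^4); with the printed value the set is not a Euclidean 4-design, so the claim as printed is false. *)

theory Defs
  imports
    "HOL-Analysis.Analysis"
    "HOL-Algebra.Generated_Groups"
    "HOL-Library.Function_Algebras"
begin

section \<open>Real polynomial functions and their restrictions\<close>

text \<open>
  Over the infinite field of reals a polynomial is determined by its polynomial function, so
  polynomials are represented as functions. Function spaces are not an instance of
  the class \<open>real_vector\<close>; the following interpretation provides \<open>funs.span\<close> and \<open>funs.dim\<close>.
\<close>

global_interpretation funs: vector_space "\<lambda>(c::real) (f::'a \<Rightarrow> real) x. c * f x"
  by unfold_locales (auto simp: fun_eq_iff algebra_simps)

definition monomial_fun :: "('n \<Rightarrow> nat) \<Rightarrow> real ^ 'n::finite \<Rightarrow> real" where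
  "monomial_fun m = (\<lambda>x. \<Prod>i\<in>UNIV. (x $ i) ^ m i)"

definition Hom_poly :: "nat \<Rightarrow> (real ^ 'n::finite \<Rightarrow> real) set" where
  "Hom_poly l = funs.span {monomial_fun m |m. sum m UNIV = l}"

definition Poly_le :: "nat \<Rightarrow> (real ^ 'n::finite \<Rightarrow> real) set" where
  "Poly_le l = funs.span {monomial_fun m |m. sum m UNIV \<le> l}"

text \<open>
  Real functions on \<open>S\<close> are represented by the functions on the whole space that vanish
  outside \<open>S\<close>, so that they form a linear subspace.
\<close>

definition restr :: "'a set \<Rightarrow> ('a \<Rightarrow> real) \<Rightarrow> 'a \<Rightarrow> real" where
  "restr S f = (\<lambda>x. if x \<in> S then f x else 0)"

definition P_space :: "nat \<Rightarrow> (real ^ 'n::finite) set \<Rightarrow> (real ^ 'n \<Rightarrow> real) set" where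
  "P_space l S = restr S ` Poly_le l"

definition P_star_space :: "nat \<Rightarrow> (real ^ 'n::finite) set \<Rightarrow> (real ^ 'n \<Rightarrow> real) set" where
  "P_star_space l S = restr S ` funs.span (\<Union>i\<in>{0..l div 2}. Hom_poly (l - 2 * i))"


section \<open>Surface measure on spheres\<close>

text \<open>
  For \<open>\<rho> > 0\<close>, the surface measure of a Borel subset \<open>A\<close> of the sphere of radius \<open>\<rho>\<close> about the
  origin of a Euclidean space of dimension \<open>d\<close> is \<open>d / \<rho>\<close> times the volume of the cone
  \<open>{r x | 0 < r \<le> 1, x \<in> A}\<close> (polar coordinates). The measure is obtained by projecting Lebesgue
  measure on the punctured ball radially onto the sphere; it is a measure on the Borel sets of
  the whole space that is concentrated on the sphere. See \<open>emeasure_surface_measure\<close> below.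
\<close>

definition surface_measure :: "real \<Rightarrow> 'a::euclidean_space measure" where
  "surface_measure \<rho> =
     scale_measure (ennreal (DIM('a) / \<rho>))
       (distr (restrict_space lborel (cball 0 \<rho> - {0})) borel (\<lambda>x. (\<rho> / norm x) *\<^sub>R x))"

lemma emeasure_surface_measure:
  fixes A :: "'a::euclidean_space set"
  assumes "\<rho> > 0" and A: "A \<in> sets borel" and AS: "A \<subseteq> sphere 0 \<rho>"
  shows "emeasure (surface_measure \<rho>) A =
    ennreal (DIM('a) / \<rho>) * emeasure lborel {r *\<^sub>R x |r x. 0 < r \<and> r \<le> 1 \<and> x \<in> A}"
proof -
  let ?M = "restrict_space lborel (cball 0 \<rho> - {0}) :: 'a measure"
  let ?f = "\<lambda>x::'a. (\<rho> / norm x) *\<^sub>R x"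
  have B: "cball 0 \<rho> - {0::'a} \<in> sets lborel" by simp
  have meas: "?f \<in> measurable ?M borel"
    by (rule measurable_restrict_space1) measurable
  have cone: "?f -` A \<inter> space ?M = {r *\<^sub>R x |r x. 0 < r \<and> r \<le> 1 \<and> x \<in> A}" (is "?L = ?R")
  proof (intro subset_antisym subsetI)
    fix y assume "y \<in> ?L"
    hence y: "?f y \<in> A" "norm y \<le> \<rho>" "y \<noteq> 0"
      by (auto simp: space_restrict_space)
    have "y = (norm y / \<rho>) *\<^sub>R ?f y" using y assms(1) by simp
    moreover have "0 < norm y / \<rho>" "norm y / \<rho> \<le> 1" using y assms(1) by auto
    ultimately show "y \<in> ?R" using y(1) by blast
  next
    fix y assume "y \<in> ?R"
    then obtain r x where rx: "y = r *\<^sub>R x" "0 < r" "r \<le> 1" "x \<in> A" by blast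
    have nx: "norm x = \<rho>" using rx(4) AS by auto
    have "?f y = x" using rx nx assms(1) by simp
    moreover have "norm y \<le> \<rho>" using rx nx assms(1) by (simp add: mult_left_le_one_le)
    moreover have "y \<noteq> 0" using rx nx assms(1) by auto
    ultimately show "y \<in> ?L" using rx(4) by (auto simp: space_restrict_space)
  qed
  have "emeasure (distr ?M borel ?f) A = emeasure ?M (?f -` A \<inter> space ?M)"
    by (rule emeasure_distr[OF meas A])
  also have "\<dots> = emeasure lborel (?f -` A \<inter> space ?M)"
    by (rule emeasure_restrict_space) (use B in \<open>auto simp: space_restrict_space\<close>)
  finally show ?thesis
    unfolding surface_measure_def cone by (simp add: emeasure_scale_measure)
qed

definition sphere_average :: "real \<Rightarrow> ('a::euclidean_space \<Rightarrow> real) \<Rightarrow> real" where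
  "sphere_average \<rho> f =
     (if \<rho> = 0 then f 0
      else 1 / measure (surface_measure \<rho>) (sphere 0 \<rho> :: 'a set) *
           (LINT x:sphere 0 \<rho>|surface_measure \<rho>. f x))"


section \<open>Euclidean designs\<close>

definition euclidean_design ::
  "nat \<Rightarrow> (real ^ 'n::finite) set \<Rightarrow> (real ^ 'n \<Rightarrow> real) \<Rightarrow> bool" where
  "euclidean_design t X W \<longleftrightarrow>
     finite X \<and> (\<forall>x\<in>X. W x > 0) \<and>
     (\<forall>f\<in>Poly_le t.
        (\<Sum>\<rho>\<in>norm ` X. (\<Sum>x\<in>X \<inter> sphere 0 \<rho>. W x) * sphere_average \<rho> f) = (\<Sum>x\<in>X. W x * f x))"

definition supp_spheres :: "(real ^ 'n::finite) set \<Rightarrow> (real ^ 'n) set" where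
  "supp_spheres X = (\<Union>\<rho>\<in>norm ` X. sphere 0 \<rho>)"

text \<open>The lower bound for the size: \<open>t = 2 e\<close> in the even case and \<open>t = 2 e - 1\<close> in the odd case.\<close>

definition design_bound :: "nat \<Rightarrow> (real ^ 'n::finite) set \<Rightarrow> nat" where
  "design_bound t X =
     (if even t then funs.dim (P_space (t div 2) (supp_spheres X))
      else let e = (t + 1) div 2; d = funs.dim (P_star_space (e - 1) (supp_spheres X))
           in if odd e \<and> 0 \<in> X then 2 * d - 1 else 2 * d)"

definition tight_euclidean_design ::
  "nat \<Rightarrow> (real ^ 'n::finite) set \<Rightarrow> (real ^ 'n \<Rightarrow> real) \<Rightarrow> bool" where
  "tight_euclidean_design t X W \<longleftrightarrow> euclidean_design t X W \<and> card X = design_bound t X"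


section \<open>The group \<open>A\<^sub>n\<close> and its corner vectors\<close>

text \<open>
  The coordinates are indexed by a finite linearly ordered type; \<open>n\<close> is its cardinality and
  \<open>coord_pos i\<close> is the position of the index \<open>i\<close>, counted from 1.
\<close>

definition coord_pos :: "'n::{finite,linorder} \<Rightarrow> nat" where
  "coord_pos i = card {j. j \<le> i}"

definition std_basis :: "nat \<Rightarrow> real ^ 'n::{finite,linorder}" where
  "std_basis k = (\<chi> i. if coord_pos i = k then 1 else 0)"

definition fundamental_root :: "nat \<Rightarrow> real ^ 'n::{finite,linorder}" where
  "fundamental_root i =
     (let n = CARD('n);
          a = (- 1 + sqrt (real n + 1)) / real n;
          b = (real n - 1 + sqrt (real n + 1)) / real n
      in if i < n then std_basis i - std_basis (i + 1)
         else (\<chi> j. if coord_pos j < n then a else b))"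

definition hyperplane_reflection :: "'a::real_inner \<Rightarrow> 'a \<Rightarrow> 'a" where
  "hyperplane_reflection \<alpha> x = x - (2 * (x \<bullet> \<alpha>) / (\<alpha> \<bullet> \<alpha>)) *\<^sub>R \<alpha>"

definition orthogonal_group :: "('a::euclidean_space \<Rightarrow> 'a) monoid" where
  "orthogonal_group =
     \<lparr>carrier = {f. orthogonal_transformation f}, mult = (\<circ>), one = id\<rparr>"

definition A_group :: "(real ^ 'n::{finite,linorder} \<Rightarrow> real ^ 'n::{finite,linorder}) set" where
  "A_group = generate orthogonal_group
     ((\<lambda>i. hyperplane_reflection (fundamental_root i)) ` {1..CARD('n)})"

definition corner_vector :: "nat \<Rightarrow> real ^ 'n::{finite,linorder}" where
  "corner_vector k =
     (let n = real CARD('n); q = real k;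
          D = sqrt (q * (n + 1 - q) * (n + 2 + 2 * sqrt (n + 1)));
          c = (n + 1 - q + sqrt (n + 1)) / D;
          d = - q / D
      in (\<chi> i. if coord_pos i \<le> k then c else d))"

definition A_orbit :: "real ^ 'n::{finite,linorder} \<Rightarrow> (real ^ 'n::{finite,linorder}) set" where
  "A_orbit v = {g v |g. g \<in> A_group}"

definition scaled_orbit :: "nat \<Rightarrow> real \<Rightarrow> (real ^ 'n::{finite,linorder}) set" where
  "scaled_orbit k r = (\<lambda>x. r *\<^sub>R x) ` A_orbit (corner_vector k)"

definition A_union :: "nat set \<Rightarrow> (nat \<Rightarrow> real) \<Rightarrow> (real ^ 'n::{finite,linorder}) set" where
  "A_union J r = (\<Union>k\<in>J. scaled_orbit k (r k))"


section \<open>The exceptional designs\<close>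

text \<open>
  In the case \<open>t = 5\<close>, \<open>n = 3\<close> the orbit of the second corner vector is a regular octahedron and
  the other two orbits form a cube. For cube radius 1 and cube weights 1, the polynomial
  \<open>x^4 + y^4 + z^4 - 3/5 (x^2 + y^2 + z^2)^2\<close>, in coordinates along the axes of the octahedron,
  forces \<open>6 * (2/5) * w 2 * r 2 ^ 4 = 8 * (4/15)\<close>, whence the constant \<open>8/9\<close>. (The literature
  source of this list has the reciprocal constant \<open>9/8\<close>, which does not give a 4-design.)
\<close>

definition one_sphere_case ::
  "nat \<Rightarrow> nat \<Rightarrow> nat set \<Rightarrow> (nat \<Rightarrow> real) \<Rightarrow> (nat \<Rightarrow> real) \<Rightarrow> bool" where
  "one_sphere_case n t J r w \<longleftrightarrow>
     (t = 2 \<and> J = {1} \<and> r 1 = 1 \<and> w 1 = 1) \<or>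
     (t = 2 \<and> J = {n} \<and> r n = 1 \<and> w n = 1) \<or>
     (t = 3 \<and> n = 3 \<and> J = {2} \<and> r 2 = 1 \<and> w 2 = 1) \<or>
     (t = 5 \<and> n = 2 \<and> J = {1, 2} \<and> r 1 = 1 \<and> r 2 = 1 \<and> w 1 = 1 \<and> w 2 = 1) \<or>
     (t = 5 \<and> n = 7 \<and> J = {2, 6} \<and> r 2 = 1 \<and> r 6 = 1 \<and> w 2 = 1 \<and> w 6 = 1)"

definition two_sphere_case ::
  "nat \<Rightarrow> nat \<Rightarrow> nat set \<Rightarrow> (nat \<Rightarrow> real) \<Rightarrow> (nat \<Rightarrow> real) \<Rightarrow> bool" where
  "two_sphere_case n t J r w \<longleftrightarrow>
     (t = 4 \<and> n = 2 \<and> J = {1, 2} \<and> r 1 = 1 \<and> r 2 \<noteq> 1 \<and> w 1 = 1 \<and> w 2 = 1 / r 2 ^ 3) \<or>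
     (t = 4 \<and> n = 4 \<and> J = {1, 3} \<and> r 1 = 1 \<and> r 3 = 1 / sqrt 6 \<and> w 1 = 1 \<and> w 3 = 27) \<or>
     (t = 4 \<and> n = 4 \<and> J = {2, 4} \<and> r 4 = 1 \<and> r 2 = 1 / sqrt 6 \<and> w 4 = 1 \<and> w 2 = 27) \<or>
     (t = 4 \<and> n = 5 \<and> J = {1, 4} \<and> r 1 = 1 \<and> r 4 = sqrt (8 / 5) \<and> w 1 = 1 \<and> w 4 = 1 / 2) \<or>
     (t = 4 \<and> n = 5 \<and> J = {2, 5} \<and> r 5 = 1 \<and> r 2 = sqrt (8 / 5) \<and> w 5 = 1 \<and> w 2 = 1 / 2) \<or>
     (t = 4 \<and> n = 6 \<and> J = {1, 5} \<and> r 1 = 1 \<and> r 5 = sqrt 15 \<and> w 1 = 1 \<and> w 5 = 1 / 81) \<or>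
     (t = 4 \<and> n = 6 \<and> J = {2, 6} \<and> r 6 = 1 \<and> r 2 = sqrt 15 \<and> w 6 = 1 \<and> w 2 = 1 / 81) \<or>
     (t = 5 \<and> n = 3 \<and> J = {1, 2, 3} \<and> r 1 = 1 \<and> r 3 = 1 \<and> r 2 \<noteq> 1 \<and>
        w 1 = 1 \<and> w 3 = 1 \<and> w 2 = 8 / (9 * r 2 ^ 4)) \<or>
     (t = 5 \<and> n = 5 \<and> J = {1, 3, 5} \<and> r 1 = 1 \<and> r 5 = 1 \<and> r 3 \<noteq> 1 \<and>
        w 1 = 1 \<and> w 5 = 1 \<and> w 3 = 27 / (25 * r 3 ^ 4))"

definition exceptional_case ::
  "nat \<Rightarrow> nat \<Rightarrow> nat set \<Rightarrow> (nat \<Rightarrow> real) \<Rightarrow> (nat \<Rightarrow> real) \<Rightarrow> bool" where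
  "exceptional_case n t J r w \<longleftrightarrow>
     (\<exists>\<rho> \<omega> r' w'. \<rho> > 0 \<and> \<omega> > 0 \<and> (\<forall>k\<in>J. r k = \<rho> * r' k \<and> w k = \<omega> * w' k) \<and>
        (one_sphere_case n t J r' w' \<or> two_sphere_case n t J r' w'))"

end

theory Submission
  imports Defs
begin

text \<open>
  Put \<open>m = n + 1\<close>. The group acts on the vertices \<open>u\<^sub>1, \<dots>, u\<^sub>m\<close> of a regular simplex as the symmetric
  group, and the orbit of \<open>v\<^sub>k\<close> consists of the normalized sums of \<open>k\<close> vertices, so it has
  \<open>m choose k\<close> elements. No such set is a 6-design: with \<open>y\<^sub>a = \<langle>x, u\<^sub>a\<rangle>\<close>, the polynomial
  \<open>((y\<^sub>1 - y\<^sub>2) (y\<^sub>2 - y\<^sub>3) (y\<^sub>1 - y\<^sub>3))\<^sup>2\<close> vanishes on it, because \<open>y\<close> takes only two values on each point,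
  but has positive mean on every sphere. For \<open>t \<le> 5\<close> the defect of the cubature formula is a symmetric
  functional in the \<open>y\<^sub>a\<close>, and \<open>\<Sum>y\<^sub>a = 0\<close> reduces its vanishing to that on the power sums of degree at
  most 5. The size condition \<open>\<Sum>\<^sub>k (m choose k) = dim\<close> leaves few sets \<open>J\<close>, most of which are
  excluded by the signs of the terms of these moments; the rest determine radii and weights.
\<close>

section \<open>Polynomial functions\<close>

text \<open>What bounds the list is the quartic coefficient
  \<open>m * (m + 1) - 6 * k * (m - k)\<close>, equal to \<open>(m - 2) * (m - 3)\<close> for k = 1
  and to \<open>(m - 3) * (m - 8)\<close> for k = 2. For large n the size condition admits only k in
  {1, 2, n - 1, n}, so beyond m = 8 the fourth moment has no terms of opposite sign; m = 8 leaves
  the pair {2, 6}, and m = 3 makes the condition empty. The signs in between allow two different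
  orbits to balance. With two orbits the cubic and quartic equations scale like
  \<open>w * r ^ 3\<close> and \<open>w * r ^ 4\<close>, so their quotient fixes the ratio of the
  radii. In degree five there are two odd conditions, from the fifth power sum and from
  \<open>norm x ^ 2\<close> times the third. Together with the size and the lower moments they leave
  only antipodal sets with equal radii and weights on opposite orbits. On those every odd function
  has zero defect, so for sufficiency only the quartic equation is checked; one radius then stays
  free in the families with a middle orbit, and the constants 8/9 and 27/25 are ratios of quartic
  contributions.\<close>

lemma sum_apply: "sum f A x = (\<Sum>a\<in>A. f a x)"
  by (induction A rule: infinite_finite_induct) (simp_all add: zero_fun_def plus_fun_def)

text \<open>Lists of coordinates replace exponent vectors: multiplying by a coordinate is Cons and
  the degree is the length, so span arguments run by list induction.\<close>

definition list_monomial :: "'n::finite list \<Rightarrow> real ^ 'n \<Rightarrow> real" where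
  "list_monomial is = (\<lambda>x. \<Prod>i\<leftarrow>is. x $ i)"

lemma list_monomial_simps [simp]:
  "list_monomial [] x = 1" "list_monomial (i # is) x = x $ i * list_monomial is x"
  by (simp_all add: list_monomial_def)

lemma list_monomial_eq_monomial_fun: "list_monomial is = monomial_fun (count_list is)"
proof (induction "is")
  case Nil
  then show ?case by (simp add: monomial_fun_def fun_eq_iff)
next
  case (Cons i "is")
  have "monomial_fun (count_list (i # is)) x = x $ i * monomial_fun (count_list is) x" for x
  proof -
    have "monomial_fun (count_list (i # is)) x =
      (\<Prod>j\<in>UNIV. (if i = j then x $ i else 1) * (x $ j) ^ count_list is j)"
      unfolding monomial_fun_def by (intro prod.cong) auto
    also have "\<dots> = x $ i * monomial_fun (count_list is) x"
      by (simp add: prod.distrib monomial_fun_def)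
    finally show ?thesis .
  qed
  then show ?case by (simp add: fun_eq_iff Cons del: count_list.simps)
qed

lemma sum_count_list: "sum (count_list is) (UNIV :: 'n::finite set) = length is"
  by (simp add: sum_count_set)

lemma monomial_fun_eq_list_monomial:
  fixes m :: "'n::finite \<Rightarrow> nat"
  obtains "is" where "monomial_fun m = list_monomial is" "length is = sum m UNIV"
proof -
  have "\<exists>is. \<forall>i. count_list is i = m i"
  proof -
    obtain xs :: "'n list" where "mset xs = (\<Sum>i\<in>UNIV. replicate_mset (m i) i)"
      using ex_mset by blast
    moreover have "count (\<Sum>i\<in>UNIV. replicate_mset (m i) i) j = m j" for j
      by (simp add: count_sum)
    ultimately have "\<forall>i. count_list xs i = m i" by (metis count_mset)
    then show ?thesis ..
  qed
  then obtain "is" where "count_list is = m" by blast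
  then show ?thesis
    using that list_monomial_eq_monomial_fun sum_count_list by metis
qed

lemma Hom_poly_eq: "(Hom_poly l :: (real ^ 'n::finite \<Rightarrow> real) set) = funs.span {list_monomial is |is. length is = l}"
proof -
  have "{monomial_fun m |m. sum m UNIV = l} =
      {list_monomial is |is :: 'n list. length is = l}"
    by (auto, metis monomial_fun_eq_list_monomial, metis list_monomial_eq_monomial_fun sum_count_list)
  then show ?thesis by (simp add: Hom_poly_def)
qed

lemma Poly_le_eq: "(Poly_le l :: (real ^ 'n::finite \<Rightarrow> real) set) = funs.span {list_monomial is |is. length is \<le> l}"
proof -
  have "{monomial_fun m |m. sum m UNIV \<le> l} =
      {list_monomial is |is :: 'n list. length is \<le> l}"
    by (auto, metis monomial_fun_eq_list_monomial, metis list_monomial_eq_monomial_fun sum_count_list)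
  then show ?thesis by (simp add: Poly_le_def)
qed

lemma Poly_le_add: "f \<in> Poly_le l \<Longrightarrow> g \<in> Poly_le l \<Longrightarrow> (\<lambda>x. f x + g x) \<in> Poly_le l"
  using funs.span_add[of f _ g] by (simp add: Poly_le_def plus_fun_def)

lemma Poly_le_scale: "f \<in> Poly_le l \<Longrightarrow> (\<lambda>x. c * f x) \<in> Poly_le l"
  by (simp add: Poly_le_def funs.span_scale)

lemma Poly_le_mono: "f \<in> Poly_le k \<Longrightarrow> k \<le> l \<Longrightarrow> f \<in> Poly_le l"
proof -
  assume "f \<in> Poly_le k" "k \<le> l"
  moreover have "Poly_le k \<subseteq> (Poly_le l :: (real ^ 'a \<Rightarrow> real) set)"
    unfolding Poly_le_eq by (rule funs.span_mono) (use \<open>k \<le> l\<close> in auto)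
  ultimately show ?thesis by auto
qed

lemma Poly_le_const: "(\<lambda>x. c) \<in> Poly_le l"
proof -
  have "list_monomial [] \<in> Poly_le l" unfolding Poly_le_eq by (rule funs.span_base) auto
  from Poly_le_scale[OF this, of c] show ?thesis by simp
qed

lemma Poly_le_sum: "(\<And>i. i \<in> A \<Longrightarrow> f i \<in> Poly_le l) \<Longrightarrow> (\<lambda>x. \<Sum>i\<in>A. f i x) \<in> Poly_le l"
  by (induction A rule: infinite_finite_induct) (auto intro: Poly_le_add Poly_le_const)

lemma Poly_le_nth_mult:
  assumes "f \<in> Poly_le l" shows "(\<lambda>x. x $ i * f x) \<in> Poly_le (Suc l)"
  using assms unfolding Poly_le_eq[of l]
proof (induction rule: funs.span_induct_alt)
  case base
  then show ?case by (simp add: zero_fun_def Poly_le_const)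
next
  case (step c g h)
  then obtain "is" where g: "g = list_monomial is" "length is \<le> l" by auto
  have "list_monomial (i # is) \<in> Poly_le (Suc l)"
    unfolding Poly_le_eq by (rule funs.span_base) (use g in auto)
  then have "(\<lambda>x. x $ i * g x) \<in> Poly_le (Suc l)" by (simp add: g list_monomial_def)
  then have "(\<lambda>x. c * (x $ i * g x) + x $ i * h x) \<in> Poly_le (Suc l)"
    by (intro Poly_le_add Poly_le_scale step.IH)
  then show ?case by (simp add: plus_fun_def algebra_simps)
qed

lemma Poly_le_inner_mult:
  assumes "f \<in> Poly_le l" shows "(\<lambda>x. (x \<bullet> v) * f x) \<in> Poly_le (Suc l)"
proof -
  have "(\<lambda>x. \<Sum>i\<in>UNIV. v $ i * (x $ i * f x)) \<in> Poly_le (Suc l)"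
    by (intro Poly_le_sum Poly_le_scale Poly_le_nth_mult assms)
  then show ?thesis by (simp add: inner_vec_def sum_distrib_left algebra_simps)
qed

lemma Poly_le_inner_power: "(\<lambda>x. (x \<bullet> v) ^ k) \<in> Poly_le k"
  by (induction k) (auto intro: Poly_le_const Poly_le_inner_mult)

lemma Poly_le_norm_mult:
  assumes "f \<in> Poly_le l" shows "(\<lambda>x. norm x ^ 2 * f x) \<in> Poly_le (l + 2)"
proof -
  have "(\<lambda>x. \<Sum>i\<in>UNIV. x $ i * (x $ i * f x)) \<in> Poly_le (Suc (Suc l))"
    by (intro Poly_le_sum Poly_le_nth_mult assms)
  moreover have "norm x ^ 2 * f x = (\<Sum>i\<in>UNIV. x $ i * (x $ i * f x))" for x
    by (simp add: power2_norm_eq_inner inner_vec_def sum_distrib_left algebra_simps)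
  ultimately show ?thesis by simp
qed

lemma Poly_le_continuous:
  assumes "f \<in> Poly_le l" shows "continuous_on UNIV f"
  using assms unfolding Poly_le_eq
proof (induction rule: funs.span_induct_alt)
  case base
  then show ?case by (simp add: zero_fun_def)
next
  case (step c g h)
  then obtain "is" where g: "g = list_monomial is" by auto
  have "continuous_on UNIV (list_monomial js :: real ^ 'a \<Rightarrow> real)" for js
  proof (induction js)
    case Nil
    then show ?case by (simp add: list_monomial_def)
  next
    case (Cons i js)
    have "continuous_on UNIV (\<lambda>x :: real ^ 'a. x $ i * list_monomial js x)"
      by (intro continuous_intros Cons)
    then show ?case by (simp add: list_monomial_def)
  qed
  then show ?case unfolding g plus_fun_def by (intro continuous_intros step.IH) auto
qed

text \<open>A spanning set adapted to a tight frame \<open>u\<close>, that is, to the identity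
  \<open>x = (\<Sum>a\<in>I. (x \<bullet> u a) *\<^sub>R u a)\<close>.\<close>

definition frame_monomial :: "('i \<Rightarrow> real ^ 'n::finite) \<Rightarrow> 'i list \<Rightarrow> real ^ 'n \<Rightarrow> real" where
  "frame_monomial u as = (\<lambda>x. \<Prod>a\<leftarrow>as. x \<bullet> u a)"

lemma frame_monomial_simps [simp]:
  "frame_monomial u [] x = 1" "frame_monomial u (a # as) x = (x \<bullet> u a) * frame_monomial u as x"
  by (simp_all add: frame_monomial_def)

lemma frame_monomial_Poly_le: "frame_monomial u as \<in> Poly_le (length as)"
proof (induction as)
  case Nil
  then show ?case by (simp add: frame_monomial_def Poly_le_const)
next
  case (Cons a as)
  show ?case using Poly_le_inner_mult[OF Cons, of "u a"] by (simp add: frame_monomial_def)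
qed

text \<open>By the frame identity each coordinate of x is a linear combination of the numbers
  \<open>x \<bullet> u a\<close>, so a monomial expands one factor at a time. The length is
  preserved, so degree bounds carry over to the index lists.\<close>

lemma list_monomial_in_span_frame_monomial:
  assumes "\<And>x. x = (\<Sum>a\<in>I. (x \<bullet> u a) *\<^sub>R u a)"
  shows "list_monomial is \<in> funs.span {frame_monomial u as |as. set as \<subseteq> I \<and> length as = length is}"
proof (induction "is")
  case Nil
  have "list_monomial [] = (frame_monomial u [] :: _ \<Rightarrow> real)"
    by (simp add: fun_eq_iff)
  then show ?case by (auto intro!: funs.span_base)
next
  case (Cons i "is")
  let ?Q = "\<lambda>l. funs.span {frame_monomial u as |as. set as \<subseteq> I \<and> length as = l}"
  have step: "(\<lambda>x. (x \<bullet> u a) * f x) \<in> ?Q (Suc l)" if "f \<in> ?Q l" "a \<in> I" for f l a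
    using that(1)
  proof (induction rule: funs.span_induct_alt)
    case base
    then show ?case using funs.span_zero by (simp add: zero_fun_def)
  next
    case (step c g h)
    then obtain as where g: "g = frame_monomial u as" "length as = l" "set as \<subseteq> I" by auto
    have "frame_monomial u (a # as) \<in> ?Q (Suc l)"
      using that(2) g by (intro funs.span_base) (auto intro!: exI[of _ "a # as"])
    then have "(\<lambda>x. c * ((x \<bullet> u a) * g x)) \<in> ?Q (Suc l)"
      by (intro funs.span_scale) (simp add: g frame_monomial_def)
    from funs.span_add[OF this step.IH] show ?case
      by (simp add: plus_fun_def algebra_simps)
  qed
  have sum: "(\<lambda>x. \<Sum>a\<in>A. f a x) \<in> ?Q l" if "\<And>a. a \<in> A \<Longrightarrow> f a \<in> ?Q l" for f A l
  proof -
    have "(\<lambda>x. \<Sum>a\<in>A. f a x) = sum f A" by (simp add: fun_eq_iff sum_apply)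
    then show ?thesis using funs.span_sum[of A f, OF that] by simp
  qed
  have "(\<lambda>x. \<Sum>a\<in>I. u a $ i * ((x \<bullet> u a) * list_monomial is x)) \<in> ?Q (Suc (length is))"
    by (intro sum funs.span_scale step Cons)
  moreover have "(\<Sum>a\<in>I. u a $ i * ((x \<bullet> u a) * list_monomial is x)) = list_monomial (i # is) x" for x
  proof -
    have "x $ i = (\<Sum>a\<in>I. (x \<bullet> u a) *\<^sub>R u a) $ i" using assms[of x] by simp
    then show ?thesis by (simp add: sum_distrib_left algebra_simps)
  qed
  ultimately show ?case by (simp add: fun_eq_iff[symmetric])
qed

section \<open>Averages over spheres\<close>

lemma nn_integral_lborel_reflect:
  fixes f :: "'a::euclidean_space \<Rightarrow> ennreal"
  assumes [measurable]: "f \<in> borel_measurable borel"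
  shows "(\<integral>\<^sup>+x. f (z - x) \<partial>lborel) = (\<integral>\<^sup>+x. f x \<partial>lborel)"
proof -
  have "(\<integral>\<^sup>+x. f x \<partial>lborel) =
      (\<integral>\<^sup>+x. f x \<partial>density (distr lborel borel (\<lambda>x. z + (- 1) *\<^sub>R x)) (\<lambda>_. ennreal (\<bar>- 1\<bar> ^ DIM('a))))"
    using lborel_affine[of "- 1" z] by (simp add: ennreal_power)
  also have "\<dots> = (\<integral>\<^sup>+x. f (z - x) \<partial>lborel)"
    by (simp add: nn_integral_density nn_integral_distr)
  finally show ?thesis ..
qed

lemma nn_integral_indicator_translate:
  fixes A :: "'a::euclidean_space set"
  assumes [measurable]: "A \<in> sets borel"
  shows "(\<integral>\<^sup>+y. indicator A (y - z) \<partial>lborel) = emeasure lborel A"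
proof -
  have "emeasure lborel A = (\<integral>\<^sup>+y. indicator A y \<partial>distr lborel borel ((+) (- z)))"
    by (simp add: lborel_distr_plus)
  also have "\<dots> = (\<integral>\<^sup>+y. indicator A (y - z) \<partial>lborel)"
    by (subst nn_integral_distr) auto
  finally show ?thesis ..
qed

text \<open>Tonelli's theorem applied to \<open>1\<^sub>A (g x) * 1\<^sub>B (y - g x)\<close>, where \<open>B\<close> is the unit ball: integrating
  over \<open>y\<close> first gives \<open>vol B * vol (g -` A)\<close>, and after the substitution \<open>x \<mapsto> inv g y - x\<close> one gets
  \<open>vol A * vol B\<close>.\<close>

lemma distr_lborel_orthogonal_transformation:
  fixes g :: "'a::euclidean_space \<Rightarrow> 'a"
  assumes g: "orthogonal_transformation g"
  shows "distr lborel borel g = lborel"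
proof (rule measure_eqI)
  fix A :: "'a set" assume "A \<in> sets (distr lborel borel g)"
  then have A [measurable]: "A \<in> sets borel" by simp
  have lin: "linear g" using g orthogonal_transformation_linear by blast
  have [measurable]: "g \<in> borel_measurable borel"
    using lin by (intro borel_measurable_continuous_onI linear_continuous_on) (simp add: linear_conv_bounded_linear)
  define B where "B = cball (0::'a) 1"
  have B [measurable]: "B \<in> sets borel" by (simp add: B_def)
  have "emeasure lborel B * emeasure (distr lborel borel g) A
      = (\<integral>\<^sup>+x. emeasure lborel B * indicator A (g x) \<partial>lborel)"
    by (simp add: nn_integral_cmult nn_integral_indicator[symmetric] nn_integral_distr del: nn_integral_indicator)
  also have "\<dots> = (\<integral>\<^sup>+x. (\<integral>\<^sup>+y. indicator A (g x) * indicator B (y - g x) \<partial>lborel) \<partial>lborel)"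
    by (rule nn_integral_cong, subst nn_integral_cmult)
      (simp_all add: nn_integral_indicator_translate mult.commute)
  also have "\<dots> = (\<integral>\<^sup>+y. (\<integral>\<^sup>+x. indicator A (g x) * indicator B (y - g x) \<partial>lborel) \<partial>lborel)"
    by (rule lborel_pair.Fubini') measurable
  also have "\<dots> = (\<integral>\<^sup>+y. (\<integral>\<^sup>+x. indicator A (y - g x) * indicator B (g x) \<partial>lborel) \<partial>lborel)"
  proof (rule nn_integral_cong)
    fix y
    obtain z where z: "y = g z" using orthogonal_transformation_surj[OF g] by (metis surjD)
    have "(\<integral>\<^sup>+x. indicator A (g x) * indicator B (y - g x) \<partial>lborel)
        = (\<integral>\<^sup>+x. indicator A (g (z - x)) * indicator B (y - g (z - x)) \<partial>lborel)"
      by (rule nn_integral_lborel_reflect[symmetric]) measurable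
    also have "\<dots> = (\<integral>\<^sup>+x. indicator A (y - g x) * indicator B (g x) \<partial>lborel)"
      by (simp add: linear_diff[OF lin] z)
    finally show "(\<integral>\<^sup>+x. indicator A (g x) * indicator B (y - g x) \<partial>lborel) = \<dots>" .
  qed
  also have "\<dots> = (\<integral>\<^sup>+x. (\<integral>\<^sup>+y. indicator A (y - g x) * indicator B (g x) \<partial>lborel) \<partial>lborel)"
    by (rule lborel_pair.Fubini') measurable
  also have "\<dots> = (\<integral>\<^sup>+x. emeasure lborel A * indicator B (g x) \<partial>lborel)"
    by (rule nn_integral_cong, subst nn_integral_multc) (simp_all add: nn_integral_indicator_translate)
  \<comment> \<open>Norm preservation enters here: \<open>g x\<close> lies in the ball exactly when
    x does.\<close>
  also have "\<dots> = (\<integral>\<^sup>+x. emeasure lborel A * indicator B x \<partial>lborel)"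
    using orthogonal_transformation_norm[OF g] by (auto simp: B_def indicator_def)
  also have "\<dots> = emeasure lborel B * emeasure lborel A"
    using B by (subst nn_integral_cmult_indicator) (simp_all add: mult.commute)
  finally have "emeasure lborel B * emeasure (distr lborel borel g) A = emeasure lborel B * emeasure lborel A" .
  moreover have "emeasure lborel B \<noteq> 0" "emeasure lborel B \<noteq> \<infinity>"
    using emeasure_lborel_cball_finite[of "0::'a" 1] content_cball_pos[of 1 "0::'a"]
    unfolding B_def by (auto simp: measure_def)
  ultimately show "emeasure (distr lborel borel g) A = emeasure lborel A"
    by (simp add: ennreal_mult_cancel_left)
qed simp

lemma scale_measure_eq_density: "scale_measure c M = density M (\<lambda>_. c)"
  by (rule measure_eqI) (simp_all add: emeasure_density_const)

text \<open>The factor \<open>DIM('a) / \<rho>\<close> of the surface measure cancels against the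
  total mass, which leaves the mean over the solid ball of f composed with radial projection. Later
  facts about averages are facts about this Lebesgue integral.\<close>

lemma sphere_average_eq:
  fixes f :: "'a::euclidean_space \<Rightarrow> real"
  assumes "\<rho> > 0" and [measurable]: "f \<in> borel_measurable borel"
  shows "sphere_average \<rho> f =
    (LINT x|lborel. indicator (cball 0 \<rho> - {0}) x * f ((\<rho> / norm x) *\<^sub>R x)) / measure lborel (cball (0::'a) \<rho>)"
proof -
  let ?M = "restrict_space lborel (cball 0 \<rho> - {0}) :: 'a measure"
  let ?p = "\<lambda>x::'a. (\<rho> / norm x) *\<^sub>R x"
  let ?c = "DIM('a) / \<rho>"
  have [measurable]: "?p \<in> borel_measurable ?M"
    by (rule measurable_restrict_space1) measurable
  have c: "?c > 0" using assms by simp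
  have sph: "\<rho> = norm (?p x)" if "x \<in> space ?M" for x
    using that assms by (auto simp: space_restrict_space)
  have [measurable]: "sphere (0::'a) \<rho> \<in> sets borel" by (rule borel_closed) simp
  have S: "surface_measure \<rho> = density (distr ?M borel ?p) (\<lambda>_. ennreal ?c)"
    by (simp add: surface_measure_def scale_measure_eq_density)
  have "(LINT x:sphere 0 \<rho>|surface_measure \<rho>. f x) =
      ?c * (LINT x|?M. indicator (sphere 0 \<rho>) (?p x) * f (?p x))"
    unfolding S set_lebesgue_integral_def using c assms(1)
    by (subst integral_density) (simp_all add: integral_distr)
  also have "(LINT x|?M. indicator (sphere 0 \<rho>) (?p x) * f (?p x)) = (LINT x|?M. f (?p x))"
    using sph by (intro Bochner_Integration.integral_cong) (auto simp: indicator_def)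
  also have "\<dots> = (LINT x|lborel. indicator (cball 0 \<rho> - {0}) x * f (?p x))"
    by (subst integral_restrict_space) auto
  finally have 1: "(LINT x:sphere 0 \<rho>|surface_measure \<rho>. f x) =
      ?c * (LINT x|lborel. indicator (cball 0 \<rho> - {0}) x * f (?p x))" .
  have "emeasure (distr ?M borel ?p) (sphere 0 \<rho>) = emeasure ?M (?p -` sphere 0 \<rho> \<inter> space ?M)"
    by (rule emeasure_distr) auto
  also have "?p -` sphere 0 \<rho> \<inter> space ?M = cball 0 \<rho> - {0}"
    using sph by (auto simp: space_restrict_space)
  also have "emeasure ?M \<dots> = emeasure lborel (cball (0::'a) \<rho> - {0})"
    by (rule emeasure_restrict_space) auto
  also have "\<dots> = emeasure lborel (cball (0::'a) \<rho>)"
    by (rule emeasure_Diff_null_set) auto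
  finally have "measure (surface_measure \<rho>) (sphere 0 \<rho> :: 'a set) = ?c * measure lborel (cball (0::'a) \<rho>)"
    using c by (simp add: surface_measure_def measure_def enn2real_mult)
  with 1 c assms show ?thesis by (simp add: sphere_average_def)
qed

lemma borel_measurable_radial_projection [measurable]:
  fixes f :: "'a::euclidean_space \<Rightarrow> real"
  assumes [measurable]: "f \<in> borel_measurable borel"
  shows "(\<lambda>x. indicator (cball 0 \<rho> - {0}) x * f ((\<rho> / norm x) *\<^sub>R x)) \<in> borel_measurable borel"
proof -
  have [measurable]: "cball 0 \<rho> - {0::'a} \<in> sets borel" by simp
  show ?thesis by measurable
qed

lemma integrable_radial_projection:
  fixes f :: "'a::euclidean_space \<Rightarrow> real"
  assumes "\<rho> > 0" and cont: "continuous_on UNIV f"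
  shows "integrable lborel (\<lambda>x. indicator (cball 0 \<rho> - {0}) x * f ((\<rho> / norm x) *\<^sub>R x))"
proof -
  have [measurable]: "f \<in> borel_measurable borel"
    using cont by (rule borel_measurable_continuous_onI)
  have "compact (f ` sphere 0 \<rho>)"
    using cont by (intro compact_continuous_image continuous_on_subset[OF cont]) auto
  then obtain B where B: "\<And>x. x \<in> sphere 0 \<rho> \<Longrightarrow> \<bar>f x\<bar> \<le> B"
    by (metis bounded_iff compact_imp_bounded imageI real_norm_def)
  show ?thesis
  proof (rule Bochner_Integration.integrable_bound)
    show "integrable lborel (\<lambda>x. B * indicator (cball (0::'a) \<rho>) x)"
      using emeasure_lborel_cball_finite[of "0::'a" \<rho>]
      by (intro integrable_mult_right integrable_real_indicator) auto
    have "\<bar>f ((\<rho> / norm x) *\<^sub>R x)\<bar> \<le> B" if "x \<noteq> 0" for x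
      using that assms by (intro B) auto
    then show "AE x in lborel. norm (indicator (cball 0 \<rho> - {0}) x * f ((\<rho> / norm x) *\<^sub>R x))
        \<le> norm (B * indicator (cball (0::'a) \<rho>) x)"
      by (intro AE_I2) (force simp: indicator_def abs_mult)
  qed simp
qed

lemma sphere_average_add:
  assumes "\<rho> > 0" "continuous_on UNIV f" "continuous_on UNIV g"
  shows "sphere_average \<rho> (\<lambda>x. f x + g x) = sphere_average \<rho> f + sphere_average \<rho> g"
proof -
  have [measurable]: "f \<in> borel_measurable borel" "g \<in> borel_measurable borel"
    using assms by (auto intro: borel_measurable_continuous_onI)
  show ?thesis
    using assms by (simp add: sphere_average_eq distrib_left add_divide_distrib integrable_radial_projection)
qed

lemma sphere_average_cmult:
  assumes "\<rho> > 0" "continuous_on UNIV f"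
  shows "sphere_average \<rho> (\<lambda>x. c * f x) = c * sphere_average \<rho> f"
proof -
  have [measurable]: "f \<in> borel_measurable borel"
    using assms by (auto intro: borel_measurable_continuous_onI)
  have "(LINT x|lborel. indicator (cball 0 \<rho> - {0}) x * (c * f ((\<rho> / norm x) *\<^sub>R x))) =
      c * (LINT x|lborel. indicator (cball 0 \<rho> - {0}) x * f ((\<rho> / norm x) *\<^sub>R x))"
    by (subst integral_mult_right_zero[symmetric]) (simp add: algebra_simps)
  then show ?thesis using assms by (simp add: sphere_average_eq)
qed

lemma sphere_average_cong:
  assumes "\<And>x. norm x = \<rho> \<Longrightarrow> f x = g x" "\<rho> \<noteq> 0"
  shows "sphere_average \<rho> f = sphere_average \<rho> g"
proof -
  have "(LINT x:sphere 0 \<rho>|surface_measure \<rho>. f x) = (LINT x:sphere 0 \<rho>|surface_measure \<rho>. g x)"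
    unfolding set_lebesgue_integral_def
    by (intro Bochner_Integration.integral_cong) (auto simp: indicator_def assms)
  then show ?thesis using assms by (simp add: sphere_average_def)
qed

lemma sphere_average_const:
  assumes "\<rho> > 0"
  shows "sphere_average \<rho> (\<lambda>x::'a::euclidean_space. c) = c"
proof -
  have "measure lborel (cball (0::'a) \<rho> - {0}) = measure lborel (cball (0::'a) \<rho>)"
    by (intro measure_Diff_null_set) auto
  then show ?thesis
    using assms content_cball_pos[of \<rho> "0::'a"] by (simp add: sphere_average_eq)
qed

lemma sphere_average_sum:
  assumes "\<rho> > 0" "\<And>i. i \<in> A \<Longrightarrow> continuous_on UNIV (f i)"
  shows "sphere_average \<rho> (\<lambda>x. \<Sum>i\<in>A. f i x) = (\<Sum>i\<in>A. sphere_average \<rho> (f i))"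
  using assms(2)
  by (induction A rule: infinite_finite_induct)
    (simp_all add: sphere_average_const sphere_average_add assms(1) continuous_on_sum)

lemma sphere_average_orthogonal_transformation:
  fixes f :: "'a::euclidean_space \<Rightarrow> real" and g :: "'a \<Rightarrow> 'a"
  assumes "\<rho> > 0" "continuous_on UNIV f" and g: "orthogonal_transformation g"
  shows "sphere_average \<rho> (\<lambda>x. f (g x)) = sphere_average \<rho> f"
proof -
  have lin: "linear g" using g orthogonal_transformation_linear by blast
  have contg: "continuous_on UNIV g"
    using lin by (intro linear_continuous_on) (simp add: linear_conv_bounded_linear)
  have [measurable]: "f \<in> borel_measurable borel" "g \<in> borel_measurable borel"
    using assms(2) contg by (auto intro: borel_measurable_continuous_onI)
  have "indicator (cball 0 \<rho> - {0}) (g x) = (indicator (cball 0 \<rho> - {0}) x :: real)" for x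
  proof -
    have "norm (g x) = norm x" by (rule orthogonal_transformation_norm[OF g])
    moreover from this have "g x = 0 \<longleftrightarrow> x = 0" by (metis norm_eq_zero)
    ultimately show ?thesis by (simp add: indicator_def)
  qed
  then have "indicator (cball 0 \<rho> - {0}) x * f (g ((\<rho> / norm x) *\<^sub>R x)) =
      (\<lambda>x. indicator (cball 0 \<rho> - {0}) x * f ((\<rho> / norm x) *\<^sub>R x)) (g x)" for x
    by (simp add: linear_scale[OF lin] orthogonal_transformation_norm[OF g])
  then have "(LINT x|lborel. indicator (cball 0 \<rho> - {0}) x * f (g ((\<rho> / norm x) *\<^sub>R x))) =
      (LINT x|lborel. (\<lambda>x. indicator (cball 0 \<rho> - {0}) x * f ((\<rho> / norm x) *\<^sub>R x)) (g x))"
    by presburger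
  also have "\<dots> = (LINT x|distr lborel borel g. indicator (cball 0 \<rho> - {0}) x * f ((\<rho> / norm x) *\<^sub>R x))"
    by (subst integral_distr) auto
  also have "\<dots> = (LINT x|lborel. indicator (cball 0 \<rho> - {0}) x * f ((\<rho> / norm x) *\<^sub>R x))"
    by (simp add: distr_lborel_orthogonal_transformation[OF g])
  finally show ?thesis using assms by (simp add: sphere_average_eq)
qed

text \<open>A zero mean would make the nonnegative integrand vanish almost everywhere, whereas the
  cone over the points with \<open>f x \<noteq> 0\<close> contains a nonempty open set.\<close>

lemma sphere_average_pos:
  fixes f :: "'a::euclidean_space \<Rightarrow> real"
  assumes "\<rho> > 0" and cont: "continuous_on UNIV f" and nonneg: "\<And>x. f x \<ge> 0"
    and z: "norm z = \<rho>" "f z \<noteq> 0"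
  shows "sphere_average \<rho> f > 0"
proof -
  have [measurable]: "f \<in> borel_measurable borel"
    using cont by (auto intro: borel_measurable_continuous_onI)
  let ?h = "\<lambda>x. indicator (cball 0 \<rho> - {0}) x * f ((\<rho> / norm x) *\<^sub>R x)"
  have int: "integrable lborel ?h" using assms by (intro integrable_radial_projection)
  have "integral\<^sup>L lborel ?h \<noteq> 0"
  proof
    assume "integral\<^sup>L lborel ?h = 0"
    then have ae: "AE x in lborel. ?h x = 0"
      using integral_nonneg_eq_0_iff_AE[OF int] nonneg by auto
    \<comment> \<open>The open ball, rather than \<open>cball\<close>, makes \<open>U\<close> open.
      The point z lies on its boundary, so half of z serves as the witness.\<close>
    define U where "U = {x \<in> ball 0 \<rho> - {0}. f ((\<rho> / norm x) *\<^sub>R x) \<in> - {0}}"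
    have "continuous_on (ball 0 \<rho> - {0}) (\<lambda>x. f ((\<rho> / norm x) *\<^sub>R x))"
      by (auto intro!: continuous_intros continuous_on_compose2[OF cont])
    moreover have "U = (ball 0 \<rho> - {0}) \<inter> (\<lambda>x. f ((\<rho> / norm x) *\<^sub>R x)) -` (- {0})"
      by (auto simp: U_def)
    ultimately have "open U"
      by (simp only:) (rule continuous_open_preimage, auto)
    moreover have "(1 / 2) *\<^sub>R z \<in> U"
      using z assms(1) by (auto simp: U_def)
    ultimately have "\<not> negligible U"
      using open_not_negligible by blast
    moreover have "negligible U"
    proof -
      have "AE x in lborel. x \<notin> U"
        using ae by (rule AE_mp) (auto simp: U_def indicator_def)
      then have "U \<in> null_sets lborel"
        using \<open>open U\<close> by (subst AE_iff_null_sets) auto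
      then show ?thesis by (simp add: negligible_iff_null_sets null_sets_completionI)
    qed
    ultimately show False by blast
  qed
  moreover have "integral\<^sup>L lborel ?h \<ge> 0"
    using nonneg by (intro integral_nonneg_AE) auto
  ultimately have "integral\<^sup>L lborel ?h > 0" by simp
  then show ?thesis
    using assms content_cball_pos[of \<rho> "0::'a"] by (simp add: sphere_average_eq)
qed

lemma sphere_average_odd:
  fixes f :: "'a::euclidean_space \<Rightarrow> real"
  assumes "\<rho> > 0" "continuous_on UNIV f" "\<And>x. f (- x) = - f x"
  shows "sphere_average \<rho> f = 0"
proof -
  have "orthogonal_transformation (\<lambda>x::'a. - x)"
    by (simp add: orthogonal_transformation_neg)
  from sphere_average_orthogonal_transformation[OF assms(1,2) this]
  show ?thesis using sphere_average_cmult[OF assms(1,2), of "- 1"] by (simp add: assms(3))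
qed

text \<open>The ratio of the two fourth moments comes from
  \<open>(s + t)\<^sup>4 + (s - t)\<^sup>4 = 2 s\<^sup>4 + 12 s\<^sup>2 t\<^sup>2 + 2 t\<^sup>4\<close> and rotation invariance.\<close>

lemma sphere_average_inner_power4:
  fixes v :: "real ^ 'n::finite"
  assumes "\<rho> > 0"
  shows "sphere_average \<rho> (\<lambda>x. (x \<bullet> v) ^ 4) =
    3 * \<rho> ^ 4 * norm v ^ 4 / (real CARD('n) * (real CARD('n) + 2))"
proof -
  define q where "q w = sphere_average \<rho> (\<lambda>x::real ^ 'n. (x \<bullet> w) ^ 4)" for w
  define e where "e i = (axis i 1 :: real ^ 'n)" for i
  \<comment> \<open>Rotation invariance: the fourth moment in direction w depends only on
    \<open>norm w\<close>, so a single constant \<open>Q\<close> remains.\<close>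
  have q_cong: "q a = q b" if "norm a = norm b" for a b
  proof -
    obtain f where f: "orthogonal_transformation f" "f a = b"
      using orthogonal_transformation_exists[OF \<open>norm a = norm b\<close>] by blast
    have "q b = sphere_average \<rho> (\<lambda>x. (f x \<bullet> b) ^ 4)"
      unfolding q_def
      by (rule sphere_average_orthogonal_transformation[symmetric, OF assms _ f(1)]) (intro continuous_intros)
    also have "(\<lambda>x. (f x \<bullet> b) ^ 4) = (\<lambda>x. (x \<bullet> a) ^ 4)"
      using f by (auto simp: orthogonal_transformation_def)
    finally show ?thesis by (simp add: q_def)
  qed
  have q_scale: "q (c *\<^sub>R w) = c ^ 4 * q w" for c w
    unfolding q_def using assms
    by (subst sphere_average_cmult[symmetric]) (auto intro!: continuous_intros simp: power_mult_distrib)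
  define i0 :: 'n where "i0 = (SOME i. True)"
  define Q where "Q = q (e i0)"
  have Q: "q w = norm w ^ 4 * Q" for w
    using q_cong[of w "norm w *\<^sub>R e i0"] q_scale by (simp add: Q_def e_def)
  define s where "s i j = sphere_average \<rho> (\<lambda>x::real ^ 'n. (x $ i)\<^sup>2 * (x $ j)\<^sup>2)" for i j
  have s: "s i j = (if i = j then Q else Q / 3)" for i j
  proof (cases "i = j")
    case True
    have "s i i = q (e i)"
      unfolding s_def q_def by (simp add: e_def inner_axis power4_eq_xxxx power2_eq_square mult.assoc)
    then show ?thesis using True Q[of "e i"] by (simp add: e_def)
  next
    case False
    have n: "norm (e i + e j) ^ 4 = 4" "norm (e i - e j) ^ 4 = 4"
    proof -
      have "norm (e i + e j) ^ 2 = 2" "norm (e i - e j) ^ 2 = 2"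
        using False unfolding power2_norm_eq_inner
        by (simp_all add: e_def inner_axis_axis inner_add_left inner_add_right inner_diff_left inner_diff_right)
      moreover have "t ^ 4 = (t ^ 2) ^ 2" for t :: real by simp
      ultimately show "norm (e i + e j) ^ 4 = 4" "norm (e i - e j) ^ 4 = 4"
        by (simp_all only:) simp_all
    qed
    have "(x \<bullet> (e i + e j)) ^ 4 + (x \<bullet> (e i - e j)) ^ 4 =
        (2 * (x \<bullet> e i) ^ 4 + 2 * (x \<bullet> e j) ^ 4) + 12 * ((x $ i)\<^sup>2 * (x $ j)\<^sup>2)" for x
      by (simp add: e_def inner_axis inner_add_right inner_diff_right) algebra
    then have "sphere_average \<rho> (\<lambda>x. (x \<bullet> (e i + e j)) ^ 4 + (x \<bullet> (e i - e j)) ^ 4) =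
        sphere_average \<rho> (\<lambda>x. (2 * (x \<bullet> e i) ^ 4 + 2 * (x \<bullet> e j) ^ 4) + 12 * ((x $ i)\<^sup>2 * (x $ j)\<^sup>2))"
      by presburger
    then have "q (e i + e j) + q (e i - e j) = (2 * q (e i) + 2 * q (e j)) + 12 * s i j"
      unfolding q_def s_def using assms
      by (simp add: sphere_average_add sphere_average_cmult continuous_intros)
    then show ?thesis using False n Q[of "e i"] Q[of "e j"] by (simp add: Q[of "e i + e j"] Q[of "e i - e j"]) (simp add: e_def)
  qed
  let ?N = "real CARD('n)"
  \<comment> \<open>Expanding \<open>norm x ^ 4\<close> as the square of the sum of squared
    coordinates and averaging both sides fixes \<open>Q\<close>.\<close>
  have "\<rho> ^ 4 = sphere_average \<rho> (\<lambda>x::real ^ 'n. norm x ^ 4)"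
    using assms by (subst sphere_average_cong[of \<rho> _ "\<lambda>_. \<rho> ^ 4"]) (auto simp: sphere_average_const)
  also have "(\<lambda>x::real ^ 'n. norm x ^ 4) = (\<lambda>x. \<Sum>i\<in>UNIV. \<Sum>j\<in>UNIV. (x $ i)\<^sup>2 * (x $ j)\<^sup>2)"
  proof
    fix x :: "real ^ 'n"
    have "norm x ^ 4 = (norm x ^ 2) * (norm x ^ 2)" by (simp add: power4_eq_xxxx power2_eq_square)
    also have "norm x ^ 2 = (\<Sum>i\<in>UNIV. (x $ i)\<^sup>2)"
      unfolding power2_norm_eq_inner inner_vec_def by (simp add: power2_eq_square)
    finally show "norm x ^ 4 = (\<Sum>i\<in>UNIV. \<Sum>j\<in>UNIV. (x $ i)\<^sup>2 * (x $ j)\<^sup>2)"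
      by (simp add: sum_product)
  qed
  also have "sphere_average \<rho> \<dots> = (\<Sum>i\<in>(UNIV::'n set). \<Sum>j\<in>(UNIV::'n set). s i j)"
    unfolding s_def using assms by (simp add: sphere_average_sum continuous_intros)
  also have "\<dots> = (\<Sum>i\<in>(UNIV::'n set). \<Sum>j\<in>(UNIV::'n set). Q / 3 + (if i = j then 2 * Q / 3 else 0))"
    by (intro sum.cong) (auto simp: s)
  also have "\<dots> = ?N * (?N + 2) * Q / 3"
    by (simp add: sum.distrib) (simp add: field_simps)
  finally have "Q * (?N * (?N + 2)) = 3 * \<rho> ^ 4" by (simp add: algebra_simps)
  moreover have "?N * (?N + 2) \<noteq> 0" using of_nat_0_le_iff[of "CARD('n)"] by (simp add: add_nonneg_eq_0_iff)
  ultimately have "Q = 3 * \<rho> ^ 4 / (?N * (?N + 2))" by (metis nonzero_eq_divide_eq)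
  then show ?thesis using Q[of v] by (simp add: q_def)
qed

section \<open>Dimensions of spaces of restricted polynomials\<close>

text \<open>Independence is stated for the indexed family, so it also excludes repetitions and the
  dimension counts indices: two equal members would satisfy a relation with coefficients 1 and
  -1.\<close>

lemma dim_span_image_eq_card:
  fixes b :: "'i \<Rightarrow> 'a \<Rightarrow> real"
  assumes fin: "finite I"
    and indep: "\<And>c i. (\<And>x. (\<Sum>i\<in>I. c i * b i x) = 0) \<Longrightarrow> i \<in> I \<Longrightarrow> c i = 0"
  shows "funs.dim (funs.span (b ` I)) = card I"
proof -
  have inj: "inj_on b I"
  proof (rule inj_onI, rule ccontr)
    fix i j assume ij: "i \<in> I" "j \<in> I" "b i = b j" "i \<noteq> j"
    let ?c = "\<lambda>k. (if k = i then 1 else 0) - (if k = j then 1 else 0 :: real)"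
    have "(\<Sum>k\<in>I. ?c k * b k x) = 0" for x
    proof -
      have "(\<Sum>k\<in>I. ?c k * b k x) =
          (\<Sum>k\<in>I. if k = i then b k x else 0) - (\<Sum>k\<in>I. if k = j then b k x else 0)"
        unfolding sum_subtractf[symmetric] by (intro sum.cong) auto
      also have "\<dots> = b i x - b j x" using ij fin by simp
      finally show ?thesis using ij by simp
    qed
    from indep[OF this ij(1)] show False using ij by simp
  qed
  have "funs.independent (b ` I)"
  proof (rule funs.independent_if_scalars_zero)
    fix f v assume f: "(\<Sum>g\<in>b ` I. (\<lambda>x. f g * g x)) = 0" and v: "v \<in> b ` I"
    have "(\<Sum>i\<in>I. f (b i) * b i x) = 0" for x
    proof -
      have "(\<Sum>g\<in>b ` I. f g * g x) = 0" using fun_cong[OF f, of x] by (simp add: sum_apply zero_fun_def)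
      then show ?thesis by (simp add: sum.reindex[OF inj])
    qed
    from indep[of "\<lambda>i. f (b i)", OF this] v show "f v = 0" by blast
  qed (use fin in simp)
  then show ?thesis
    by (simp add: funs.dim_eq_card_independent card_image[OF inj])
qed

lemma restr_image_span: "restr S ` funs.span B = funs.span (restr S ` B)"
proof -
  interpret h: module_hom "\<lambda>(c::real) (f::'a \<Rightarrow> real) x. c * f x" "\<lambda>(c::real) (f::'a \<Rightarrow> real) x. c * f x" "restr S"
    by unfold_locales (auto simp: restr_def fun_eq_iff)
  show ?thesis by (rule h.span_image[symmetric])
qed

text \<open>Sorted lists stand for multisets of coordinates and name each monomial once, which is
  what a basis count needs.\<close>

definition sorted_lists :: "nat \<Rightarrow> 'n::{finite,linorder} list set" where
  "sorted_lists l = {is. length is = l \<and> sorted is}"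

lemma list_monomial_sort: "list_monomial (sort is) = list_monomial is"
  unfolding list_monomial_eq_monomial_fun count_mset[symmetric] by simp

lemma list_monomial_image_sorted_lists:
  "list_monomial ` sorted_lists l = {list_monomial is |is. length is = l}"
proof -
  have "list_monomial is \<in> list_monomial ` sorted_lists l" if "length is = l" for "is" :: "'a list"
    using that by (intro image_eqI[of _ _ "sort is"]) (auto simp: list_monomial_sort sorted_lists_def)
  then show ?thesis by (auto simp: sorted_lists_def)
qed

lemma P_space_eq:
  "P_space l S = funs.span (restr S ` list_monomial ` (\<Union>k\<in>{..l}. sorted_lists k))"
proof -
  have "{list_monomial is |is :: 'a list. length is \<le> l} = (\<Union>k\<in>{..l}. {list_monomial is |is. length is = k})"
    by auto
  also have "\<dots> = list_monomial ` (\<Union>k\<in>{..l}. sorted_lists k)"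
    by (simp add: list_monomial_image_sorted_lists image_UN)
  finally show ?thesis by (simp add: P_space_def Poly_le_eq restr_image_span)
qed

lemma P_star_space_eq:
  "P_star_space l S = funs.span (restr S ` list_monomial ` (\<Union>i\<in>{0..l div 2}. sorted_lists (l - 2 * i)))"
proof -
  have "funs.span (\<Union>i\<in>I. funs.span (B i)) = funs.span (\<Union>i\<in>I. B i)" for I :: "nat set" and B :: "nat \<Rightarrow> (real ^ 'a::{finite,linorder} \<Rightarrow> real) set"
  proof (rule subset_antisym)
    show "funs.span (\<Union>i\<in>I. funs.span (B i)) \<subseteq> funs.span (\<Union>i\<in>I. B i)"
      by (intro funs.span_minimal funs.subspace_span UN_least funs.span_mono) auto
    show "funs.span (\<Union>i\<in>I. B i) \<subseteq> funs.span (\<Union>i\<in>I. funs.span (B i))"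
      by (intro funs.span_mono UN_mono funs.span_superset) auto
  qed
  then show ?thesis
    unfolding P_star_space_def Hom_poly_eq restr_image_span image_UN list_monomial_image_sorted_lists
    by (simp add: restr_image_span image_UN)
qed

lemma sorted_lists_simps:
  "sorted_lists 0 = {[]}"
  "sorted_lists (Suc 0) = range (\<lambda>i. [i])"
  "sorted_lists 2 = (\<lambda>(i, j). [i, j]) ` {(i, j). i \<le> j}"
  by (auto simp: sorted_lists_def length_Suc_conv numeral_2_eq_2)

lemma card_pairs_le: "card {(i, j). i \<le> (j :: 'n::{finite,linorder})} = CARD('n) * (CARD('n) + 1) div 2"
proof -
  let ?L = "{(i, j). i < (j :: 'n)}" and ?G = "{(i, j). j < (i :: 'n)}" and ?D = "{(i, j). i = (j :: 'n)}"
  have "?G = prod.swap ` ?L" by (auto simp: image_def)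
  then have 1: "card ?G = card ?L" by (simp add: card_image)
  have "?D = (\<lambda>i. (i, i)) ` UNIV" by auto
  then have 2: "card ?D = CARD('n)" by (simp add: card_image inj_on_def)
  have "(UNIV :: ('n \<times> 'n) set) = ?L \<union> ?G \<union> ?D" by auto
  then have "CARD('n \<times> 'n) = card (?L \<union> ?G \<union> ?D)" by simp
  also have "\<dots> = card ?L + card ?G + card ?D"
    by (subst card_Un_disjoint; (subst card_Un_disjoint)?) auto
  finally have 3: "CARD('n) * CARD('n) = 2 * card ?L + CARD('n)" using 1 2 by simp
  have "{(i, j). i \<le> (j :: 'n)} = ?L \<union> ?D" by auto
  then have "card {(i, j). i \<le> (j :: 'n)} = card ?L + card ?D"
    by (simp only:) (subst card_Un_disjoint, auto)
  with 2 3 show ?thesis by simp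
qed

lemma card_sorted_lists:
  "card (sorted_lists 0 :: 'n::{finite,linorder} list set) = 1"
  "card (sorted_lists (Suc 0) :: 'n list set) = CARD('n)"
  "card (sorted_lists 2 :: 'n list set) = CARD('n) * (CARD('n) + 1) div 2"
proof -
  show "card (sorted_lists 2 :: 'n list set) = CARD('n) * (CARD('n) + 1) div 2"
    unfolding sorted_lists_simps by (subst card_image) (auto simp: inj_on_def card_pairs_le)
  show "card (sorted_lists (Suc 0) :: 'n list set) = CARD('n)"
    unfolding sorted_lists_simps by (subst card_image) (auto simp: inj_on_def)
qed (simp add: sorted_lists_simps)

lemma finite_sorted_lists [simp]: "finite (sorted_lists l)"
  by (rule finite_subset[OF _ finite_lists_length_eq[of UNIV l]]) (auto simp: sorted_lists_def)

lemma sorted_lists_disjoint: "is \<in> sorted_lists k \<Longrightarrow> is \<in> sorted_lists l \<Longrightarrow> k = l"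
  by (simp add: sorted_lists_def)

text \<open>Evaluation at \<plusminus>\<rho> e_i and at \<rho> (e_i + e_j) / sqrt 2 suffices: up to
  scaling, the only quadratic polynomial vanishing on the sphere is
  \<open>norm x ^ 2 - \<rho> ^ 2\<close>. For a general M this determines only sums of opposite
  entries.\<close>

lemma quadratic_vanishing_on_sphere:
  fixes M :: "real ^ 'n::finite ^ 'n"
  assumes "\<rho> > 0" and van: "\<And>x. norm x = \<rho> \<Longrightarrow> c + b \<bullet> x + x \<bullet> (M *v x) = 0"
  shows "b = 0" "c + \<rho>\<^sup>2 * M $ i $ i = 0" "i \<noteq> j \<Longrightarrow> M $ i $ j + M $ j $ i = 0"
proof -
  let ?e = "\<lambda>i. axis i 1 :: real ^ 'n"
  have M: "?e i \<bullet> (M *v ?e j) = M $ i $ j" for i j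
    by (simp add: matrix_vector_mult_basis column_def inner_axis')
  have diag: "c + \<rho>\<^sup>2 * M $ i $ i = 0" and lin: "b $ i = 0" for i
  proof -
    have 1: "c + \<rho> * (b $ i) + \<rho>\<^sup>2 * M $ i $ i = 0"
      using van[of "\<rho> *\<^sub>R ?e i"] \<open>\<rho> > 0\<close> M[of i i]
      by (simp add: matrix_vector_mult_scaleR inner_axis power2_eq_square)
    have 2: "c - \<rho> * (b $ i) + \<rho>\<^sup>2 * M $ i $ i = 0"
      using van[of "(- \<rho>) *\<^sub>R ?e i"] \<open>\<rho> > 0\<close> M[of i i]
      by (simp add: matrix_vector_mult_scaleR inner_axis power2_eq_square del: scaleR_minus_left)
    from 1 2 show "c + \<rho>\<^sup>2 * M $ i $ i = 0" by simp
    from 1 2 have "\<rho> * (b $ i) = 0" by linarith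
    then show "b $ i = 0" using \<open>\<rho> > 0\<close> by simp
  qed
  show b: "b = 0" using lin by (simp add: vec_eq_iff)
  show "c + \<rho>\<^sup>2 * M $ i $ i = 0" by (rule diag)
  assume "i \<noteq> j"
  define s where "s = \<rho> / sqrt 2"
  have s: "s\<^sup>2 = \<rho>\<^sup>2 / 2" by (simp add: s_def power_divide)
  have "norm (s *\<^sub>R (?e i + ?e j)) = \<rho>"
  proof -
    have "(norm (?e i + ?e j))\<^sup>2 = 2" using \<open>i \<noteq> j\<close>
      unfolding power2_norm_eq_inner by (simp add: inner_add_left inner_add_right inner_axis_axis)
    then have "norm (?e i + ?e j) = sqrt 2" by (metis norm_ge_zero real_sqrt_unique)
    then show ?thesis using \<open>\<rho> > 0\<close> by (simp add: s_def)
  qed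
  from van[OF this] have "c + s\<^sup>2 * (M $ i $ i + M $ j $ j + (M $ i $ j + M $ j $ i)) = 0"
    by (simp add: b matrix_vector_mult_scaleR matrix_vector_right_distrib inner_add_left inner_add_right M
        power2_eq_square algebra_simps)
  then have "\<rho>\<^sup>2 * (M $ i $ j + M $ j $ i) = 0"
    using diag[of i] diag[of j] unfolding s by (simp add: algebra_simps)
  then show "M $ i $ j + M $ j $ i = 0" using \<open>\<rho> > 0\<close> by simp
qed

lemma dim_span_restr_quadratic:
  fixes I :: "'n::{finite,linorder} list set" and S :: "(real ^ 'n::{finite,linorder}) set"
  assumes I: "I \<subseteq> sorted_lists 0 \<union> sorted_lists (Suc 0) \<union> sorted_lists 2"
    and \<rho>: "\<rho> > 0" "sphere 0 \<rho> \<subseteq> S"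
    and const: "[] \<notin> I \<or> (\<exists>i. [i, i] \<notin> I) \<or> (\<exists>\<rho>'. \<rho>' > 0 \<and> \<rho>' \<noteq> \<rho> \<and> sphere 0 \<rho>' \<subseteq> S)"
  shows "funs.dim (funs.span (restr S ` list_monomial ` I)) = card I"
proof -
  let ?K = "sorted_lists 0 \<union> sorted_lists (Suc 0) \<union> sorted_lists 2 :: 'n list set"
  have finI: "finite I" using I by (rule finite_subset) auto
  have "funs.dim (funs.span ((\<lambda>is. restr S (list_monomial is)) ` I)) = card I"
  proof (rule dim_span_image_eq_card[OF finI])
    fix c and k assume van: "\<And>x. (\<Sum>is\<in>I. c is * restr S (list_monomial is) x) = 0" and k: "k \<in> I"
    define d where "d is = (if is \<in> I then c is else 0)" for "is"
    \<comment> \<open>Sorted pairs make \<open>M\<close> upper triangular, so the vanishing of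
      \<open>M $ i $ j + M $ j $ i\<close> for distinct indices yields each mixed
      coefficient.\<close>
    define M :: "(real, 'n) vec ^ 'n::{finite,linorder}" where "M = (\<chi> i j. if i \<le> j then d [i, j] else 0)"
    define b where "b = (\<chi> i. d [i])"
    have quad: "d [] + b \<bullet> x + x \<bullet> (M *v x) = 0" if "x \<in> S" for x
    proof -
      have "0 = (\<Sum>is\<in>I. c is * list_monomial is x)"
        using van[of x] that by (simp add: restr_def)
      also have "\<dots> = (\<Sum>is\<in>?K. d is * list_monomial is x)"
        using I by (intro sum.mono_neutral_cong_left) (auto simp: d_def)
      also have "\<dots> = (\<Sum>is\<in>sorted_lists 0. d is * list_monomial is x) +
          (\<Sum>is\<in>sorted_lists (Suc 0). d is * list_monomial is x) + (\<Sum>is\<in>sorted_lists 2. d is * list_monomial is x)"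
        by (subst sum.union_disjoint; (subst sum.union_disjoint)?) (auto dest: sorted_lists_disjoint)
      also have "(\<Sum>is\<in>sorted_lists 0. d is * list_monomial is x) = d []"
        by (simp add: sorted_lists_simps)
      also have "(\<Sum>is\<in>sorted_lists (Suc 0). d is * list_monomial is x) = b \<bullet> x"
        unfolding sorted_lists_simps by (subst sum.reindex) (auto simp: inj_on_def b_def inner_vec_def)
      also have "(\<Sum>is\<in>sorted_lists 2. d is * list_monomial is x) =
          (\<Sum>(i, j)\<in>{(i, j). i \<le> j}. d [i, j] * (x $ i * x $ j))"
        unfolding sorted_lists_simps
        by (subst sum.reindex) (auto simp: inj_on_def intro!: sum.cong)
      also have "\<dots> = (\<Sum>(i, j)\<in>UNIV \<times> UNIV. x $ i * (M $ i $ j * x $ j))"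
        by (rule sum.mono_neutral_cong_left) (auto simp: M_def split: if_splits)
      also have "\<dots> = x \<bullet> (M *v x)"
        unfolding sum.cartesian_product[symmetric]
        by (simp add: inner_vec_def matrix_vector_mult_def sum_distrib_left)
      finally show ?thesis by simp
    qed
    have quad\<rho>: "d [] + b \<bullet> x + x \<bullet> (M *v x) = 0" if "norm x = \<rho>" for x
      using quad[of x] \<rho> that by auto
    note * = quadratic_vanishing_on_sphere[OF \<rho>(1) quad\<rho>]
    have "d [] = 0"
    proof -
      consider "[] \<notin> I" | i where "[i, i] \<notin> I" | \<rho>' where "\<rho>' > 0" "\<rho>' \<noteq> \<rho>" "sphere 0 \<rho>' \<subseteq> S"
        using const by blast
      then show ?thesis
      proof cases
        case 1
        then show ?thesis by (simp add: d_def)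
      next
        case 2
        then show ?thesis using *(2)[of i] by (simp add: M_def d_def)
      next
        case 3
        have "d [] + b \<bullet> x + x \<bullet> (M *v x) = 0" if "norm x = \<rho>'" for x
          using quad[of x] 3 that by auto
        note ** = quadratic_vanishing_on_sphere(2)[OF 3(1) this]
        \<comment> \<open>Both radii give the same value for \<open>d []\<close>, namely
          \<open>- \<rho>\<^sup>2 * M $ i $ i = - \<rho>'\<^sup>2 * M $ i $ i\<close>.\<close>
        have "(\<rho>\<^sup>2 - \<rho>'\<^sup>2) * M $ i $ i = 0" for i
        proof -
          have "(\<rho>\<^sup>2 - \<rho>'\<^sup>2) * M $ i $ i = (d [] + \<rho>\<^sup>2 * M $ i $ i) - (d [] + \<rho>'\<^sup>2 * M $ i $ i)"
            by (simp add: algebra_simps)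
          then show ?thesis using *(2)[of i] **[of i] by simp
        qed
        moreover have "\<rho>\<^sup>2 \<noteq> \<rho>'\<^sup>2"
          using 3 \<rho> by (simp add: power2_eq_iff)
        ultimately show ?thesis using *(2) by simp
      qed
    qed
    moreover have "d [i] = 0" for i using *(1) by (simp add: b_def vec_eq_iff)
    moreover have "d [i, j] = 0" if "i \<le> j" for i j
    proof (cases "i = j")
      case True
      then show ?thesis using *(2)[of i] \<open>d [] = 0\<close> \<rho> by (simp add: M_def)
    next
      case False
      then show ?thesis using *(3)[of i j] that by (simp add: M_def)
    qed
    ultimately have "d k = 0"
      using k I by (auto simp: sorted_lists_simps)
    then show "c k = 0" using k by (simp add: d_def)
  qed
  then show ?thesis by (simp add: image_image)
qed

text \<open>On one sphere the constant 1 is the sum of the squares divided by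
  \<open>\<rho>\<^sup>2\<close>; this is the drop of one dimension relative to several
  radii.\<close>

lemma restr_const_in_span:
  fixes \<rho> :: real
  assumes "\<rho> > 0"
  shows "restr (sphere 0 \<rho>) (list_monomial []) \<in>
    funs.span (restr (sphere 0 \<rho>) ` list_monomial ` (sorted_lists 2 :: 'n::{finite,linorder} list set))"
proof -
  let ?S = "sphere (0 :: real ^ 'n::{finite,linorder}) \<rho>"
  let ?f = "\<lambda>i::'n. (\<lambda>x. 1 / \<rho>\<^sup>2 * restr ?S (list_monomial [i, i]) x)"
  have "sum ?f UNIV \<in> funs.span (restr ?S ` list_monomial ` sorted_lists 2)"
    by (intro funs.span_sum funs.span_scale funs.span_base imageI) (simp add: sorted_lists_def)
  moreover have "sum ?f UNIV = restr ?S (list_monomial [])"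
  proof
    fix x
    have "sum ?f UNIV x = (\<Sum>i\<in>UNIV. ?f i x)"
      by (rule sum_apply)
    also have "\<dots> = (if x \<in> ?S then 1 / \<rho>\<^sup>2 * (\<Sum>i\<in>UNIV. x $ i * x $ i) else 0)"
      by (simp add: restr_def sum_divide_distrib)
    also have "(\<Sum>i\<in>UNIV. x $ i * x $ i) = (norm x)\<^sup>2"
      by (simp add: power2_norm_eq_inner inner_vec_def)
    also have "(if x \<in> ?S then 1 / \<rho>\<^sup>2 * (norm x)\<^sup>2 else 0) = restr ?S (list_monomial []) x"
      using assms by (simp add: restr_def)
    finally show "sum ?f UNIV x = restr ?S (list_monomial []) x" .
  qed
  ultimately show ?thesis by simp
qed

section \<open>Dimensions of the restricted spaces in the bounds for t at most 5\<close>

context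
  fixes S :: "(real ^ 'n::{finite,linorder}) set" and \<rho> :: real
  assumes \<rho>: "\<rho> > 0" "sphere 0 \<rho> \<subseteq> S"
begin

lemma dim_P_space_1: "funs.dim (P_space 1 S) = CARD('n) + 1"
proof -
  have "(\<Union>k\<in>{..1}. sorted_lists k) = (sorted_lists 0 \<union> sorted_lists (Suc 0) :: 'n list set)"
    by (auto simp: atMost_Suc)
  moreover have "card (sorted_lists 0 \<union> sorted_lists (Suc 0) :: 'n list set) = CARD('n) + 1"
    by (subst card_Un_disjoint) (auto simp: card_sorted_lists, auto simp: sorted_lists_def)
  moreover have "[i, i] \<notin> sorted_lists 0 \<union> sorted_lists (Suc 0)" for i :: 'n
    by (simp add: sorted_lists_def)
  ultimately show ?thesis
    unfolding P_space_eq using dim_span_restr_quadratic[OF _ \<rho>, of "sorted_lists 0 \<union> sorted_lists (Suc 0)"]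
    by auto
qed

lemma dim_P_star_space_0: "funs.dim (P_star_space 0 S) = 1"
proof -
  have "[i, i] \<notin> sorted_lists 0" for i :: 'n
    by (simp add: sorted_lists_def)
  then show ?thesis
    unfolding P_star_space_eq using dim_span_restr_quadratic[OF _ \<rho>, of "sorted_lists 0"]
    by (auto simp: card_sorted_lists)
qed

lemma dim_P_star_space_1: "funs.dim (P_star_space 1 S) = CARD('n)"
proof -
  have "[] \<notin> (sorted_lists (Suc 0) :: 'n list set)"
    by (simp add: sorted_lists_def)
  then show ?thesis
    unfolding P_star_space_eq using dim_span_restr_quadratic[OF _ \<rho>, of "sorted_lists (Suc 0)"]
    by (auto simp: card_sorted_lists)
qed

lemma dim_P_space_2_multiple:
  assumes "\<rho>' > 0" "\<rho>' \<noteq> \<rho>" "sphere 0 \<rho>' \<subseteq> S"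
  shows "funs.dim (P_space 2 S) = (CARD('n) + 1) * (CARD('n) + 2) div 2"
proof -
  have "(\<Union>k\<in>{..2}. sorted_lists k) = (sorted_lists 0 \<union> sorted_lists (Suc 0) \<union> sorted_lists 2 :: 'n list set)"
    by (auto simp: numeral_2_eq_2 atMost_Suc)
  moreover have "card (sorted_lists 0 \<union> sorted_lists (Suc 0) \<union> sorted_lists 2 :: 'n list set) =
      1 + CARD('n) + CARD('n) * (CARD('n) + 1) div 2"
    by (subst card_Un_disjoint; (subst card_Un_disjoint)?)
      (auto simp: card_sorted_lists, auto simp: sorted_lists_def)
  moreover have "\<dots> = (CARD('n) + 1) * (CARD('n) + 2) div 2"
    by (simp add: algebra_simps)
  ultimately show ?thesis
    unfolding P_space_eq using assms dim_span_restr_quadratic[OF subset_refl \<rho>] by auto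
qed

lemma dim_P_star_space_2_multiple:
  assumes "\<rho>' > 0" "\<rho>' \<noteq> \<rho>" "sphere 0 \<rho>' \<subseteq> S"
  shows "funs.dim (P_star_space 2 S) = CARD('n) * (CARD('n) + 1) div 2 + 1"
proof -
  have "(\<Union>i\<in>{0..2 div 2}. sorted_lists (2 - 2 * i)) = (sorted_lists 0 \<union> sorted_lists 2 :: 'n list set)"
    by (auto simp: atLeastAtMostSuc_conv)
  moreover have "card (sorted_lists 0 \<union> sorted_lists 2 :: 'n list set) = 1 + CARD('n) * (CARD('n) + 1) div 2"
    by (subst card_Un_disjoint) (auto simp: card_sorted_lists, auto simp: sorted_lists_def)
  ultimately show ?thesis
    unfolding P_star_space_eq
    using assms dim_span_restr_quadratic[OF _ \<rho>, of "sorted_lists 0 \<union> sorted_lists 2"] by auto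
qed

end

lemma dim_P_space_2_sphere:
  assumes "\<rho> > 0"
  shows "funs.dim (P_space 2 (sphere (0 :: real ^ 'n::{finite,linorder}) \<rho>)) = CARD('n) * (CARD('n) + 3) div 2"
proof -
  let ?S = "sphere (0 :: (real, 'n) vec) \<rho>"
  have "(\<Union>k\<in>{..2}. sorted_lists k) = insert [] (sorted_lists (Suc 0) \<union> sorted_lists 2 :: 'n list set)"
    by (auto simp: numeral_2_eq_2 atMost_Suc sorted_lists_simps(1))
  moreover have "restr ?S (list_monomial []) \<in>
      funs.span (restr ?S ` list_monomial ` (sorted_lists (Suc 0) \<union> sorted_lists 2))"
    using restr_const_in_span[OF assms] by (rule rev_subsetD) (intro funs.span_mono, auto)
  moreover have "card (sorted_lists (Suc 0) \<union> sorted_lists 2 :: 'n list set) = CARD('n) + CARD('n) * (CARD('n) + 1) div 2"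
    by (subst card_Un_disjoint) (auto simp: card_sorted_lists, auto simp: sorted_lists_def)
  moreover have "\<dots> = CARD('n) * (CARD('n) + 3) div 2"
    by (simp add: algebra_simps)
  moreover have "[] \<notin> (sorted_lists (Suc 0) \<union> sorted_lists 2 :: 'n list set)"
    by (simp add: sorted_lists_def)
  ultimately show ?thesis
    using dim_span_restr_quadratic[OF _ assms subset_refl, of "sorted_lists (Suc 0) \<union> sorted_lists 2 :: 'n list set"]
    unfolding P_space_eq by (simp only: image_insert funs.span_redundant) auto
qed

lemma dim_P_star_space_2_sphere:
  assumes "\<rho> > 0"
  shows "funs.dim (P_star_space 2 (sphere (0 :: real ^ 'n::{finite,linorder}) \<rho>)) = CARD('n) * (CARD('n) + 1) div 2"
proof -
  have "(\<Union>i\<in>{0..2 div 2}. sorted_lists (2 - 2 * i)) = insert [] (sorted_lists 2 :: 'n list set)"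
    by (auto simp: atLeastAtMostSuc_conv sorted_lists_simps(1))
  moreover have "[] \<notin> (sorted_lists 2 :: 'n list set)"
    by (simp add: sorted_lists_def)
  ultimately show ?thesis
    using dim_span_restr_quadratic[OF _ assms subset_refl, of "sorted_lists 2 :: 'n list set"]
      restr_const_in_span[where 'n = 'n, OF assms]
    unfolding P_star_space_eq by (simp only: image_insert funs.span_redundant card_sorted_lists) auto
qed

section \<open>The orbits of the corner vectors\<close>

lemma coord_pos_inj: "inj coord_pos"
proof -
  have "coord_pos i < coord_pos j" if "i < j" for i j :: 'a
  proof -
    have "{k. k \<le> i} \<subset> {k. k \<le> j}"
      using that by (intro psubsetI) (auto simp: set_eq_iff not_le intro!: exI[of _ j])
    then show ?thesis unfolding coord_pos_def by (intro psubset_card_mono) auto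
  qed
  then show ?thesis by (metis injI linorder_neqE less_irrefl)
qed

lemma range_coord_pos: "range (coord_pos :: 'n::{finite,linorder} \<Rightarrow> nat) = {1..CARD('n)}"
proof (rule card_subset_eq)
  have "coord_pos i \<in> {1..CARD('n)}" for i :: 'n
  proof -
    have "card {i} \<le> coord_pos i" unfolding coord_pos_def by (intro card_mono) auto
    moreover have "coord_pos i \<le> CARD('n)" unfolding coord_pos_def by (intro card_mono) auto
    ultimately show ?thesis by simp
  qed
  then show "range (coord_pos :: 'n \<Rightarrow> nat) \<subseteq> {1..CARD('n)}" by blast
  show "card (range (coord_pos :: 'n \<Rightarrow> nat)) = card {1..CARD('n)}"
    by (simp add: card_image coord_pos_inj)
qed simp

lemma coord_pos_le: "coord_pos (i :: 'n::{finite,linorder}) \<le> CARD('n)"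
  using range_coord_pos[where 'n = 'n] by (metis atLeastAtMost_iff rangeI)

lemma coord_pos_ge_1: "coord_pos (i :: 'n::{finite,linorder}) \<ge> 1"
  using range_coord_pos[where 'n = 'n] by (metis atLeastAtMost_iff rangeI)

lemma sum_coord_pos: "(\<Sum>i\<in>(UNIV :: 'n::{finite,linorder} set). f (coord_pos i)) = (\<Sum>a=1..CARD('n). f a)"
  using sum.reindex[OF coord_pos_inj[where 'a = 'n], of f] by (simp add: range_coord_pos)

text \<open>The vectors \<open>simplex_vector 1, \<dots>, simplex_vector (n + 1)\<close> are the vertices of a regular simplex,
  namely the images of the standard basis vectors under an isometry from the hyperplane
  \<open>\<Sum>x\<^sub>a = 0\<close> of \<open>\<real>\<^sup>n\<^sup>+\<^sup>1\<close> onto \<open>\<real>\<^sup>n\<close>, preceded by the orthogonal projection to that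
  hyperplane. The group permutes them like the symmetric group.\<close>

definition simplex_vector :: "nat \<Rightarrow> real ^ 'n::{finite,linorder}" where
  "simplex_vector a =
     (let s = sqrt (real CARD('n) + 1)
      in if a \<le> CARD('n) then (\<chi> i. (if coord_pos i = a then 1 else 0) - 1 / (s * (s + 1)))
         else (\<chi> i. - 1 / s))"

context
  fixes s :: real
  assumes s: "s = sqrt (real CARD('n::{finite,linorder}) + 1)"
begin

lemma simplex_s: "s > 1" "real CARD('n) = (s - 1) * (s + 1)"
proof -
  have "real CARD('n) > 0" by simp
  then show "s > 1" unfolding s by simp
  have "s\<^sup>2 = real CARD('n) + 1" unfolding s by simp
  then show "real CARD('n) = (s - 1) * (s + 1)" by (simp add: algebra_simps power2_eq_square)
qed

lemma simplex_vector_nth: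
  "a \<le> CARD('n) \<Longrightarrow> (simplex_vector a :: real ^ 'n::{finite,linorder}) $ i = (if coord_pos i = a then 1 else 0) - 1 / (s * (s + 1))"
  "a > CARD('n) \<Longrightarrow> (simplex_vector a :: (real, 'n) vec) $ i = - 1 / s"
  by (auto simp: simplex_vector_def Let_def s)

lemma sum_simplex_vector_nth:
  assumes "a \<le> CARD('n)" "a \<ge> 1"
  shows "(\<Sum>i\<in>UNIV. (simplex_vector a :: real ^ 'n::{finite,linorder}) $ i * f (coord_pos i)) =
    f a - (\<Sum>b=1..CARD('n). f b) / (s * (s + 1))"
proof -
  have "(\<Sum>i\<in>UNIV. (simplex_vector a :: (real, 'n) vec) $ i * f (coord_pos i)) =
      (\<Sum>b=1..CARD('n). ((if b = a then 1 else 0) - 1 / (s * (s + 1))) * f b)"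
    by (subst sum_coord_pos[symmetric]) (simp add: simplex_vector_nth assms)
  also have "\<dots> = (\<Sum>b=1..CARD('n). if b = a then f b else 0) - (\<Sum>b=1..CARD('n). f b / (s * (s + 1)))"
    unfolding sum_subtractf[symmetric] by (intro sum.cong) (auto simp: algebra_simps)
  also have "\<dots> = f a - (\<Sum>b=1..CARD('n). f b) / (s * (s + 1))"
    using assms by (simp add: sum_divide_distrib)
  finally show ?thesis .
qed

text \<open>The shift c = 1 / (s (s + 1)) solves n c^2 - 2 c + 1 / s^2 = 0, so the Gram matrix is
  the identity minus the constant 1 / s^2: that of the standard basis projected along the all-ones
  vector.\<close>

lemma simplex_vector_inner':
  assumes "a \<in> {1..Suc CARD('n)}" "b \<in> {1..Suc CARD('n)}"
  shows "(simplex_vector a :: real ^ 'n::{finite,linorder}) \<bullet> simplex_vector b = (if a = b then 1 else 0) - 1 / s\<^sup>2"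
proof -
  let ?u = "simplex_vector :: nat \<Rightarrow> (real, 'n) vec"
  have *: "?u a \<bullet> simplex_vector b = (if a = b then 1 else 0) - 1 / s\<^sup>2"
    if a: "a \<in> {1..CARD('n)}" and b: "b \<in> {1..Suc CARD('n)}" for a b
  proof (cases "b \<le> CARD('n)")
    case True
    let ?f = "\<lambda>d. (if d = b then 1 else 0) - 1 / (s * (s + 1))"
    have "?u a \<bullet> simplex_vector b =
        (\<Sum>i\<in>UNIV. ?u a $ i * ?f (coord_pos i))"
      by (simp add: inner_vec_def simplex_vector_nth(1)[OF True])
    also have "\<dots> = ?f a - (\<Sum>d=1..CARD('n). ?f d) / (s * (s + 1))"
      using a by (intro sum_simplex_vector_nth) auto
    also have "(\<Sum>d=1..CARD('n). ?f d) = 1 - (s - 1) * (s + 1) / (s * (s + 1))"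
      using True b by (simp add: sum_subtractf simplex_s(2))
    also have "?f a - \<dots> / (s * (s + 1)) = (if a = b then 1 else 0) - 1 / s\<^sup>2"
      using simplex_s(1) by (simp add: divide_simps power2_eq_square) (simp add: algebra_simps)
    finally show ?thesis .
  next
    case False
    then have "?u a \<bullet> simplex_vector b =
        (\<Sum>i\<in>UNIV. ?u a $ i * (\<lambda>_. - 1 / s) (coord_pos i))"
      by (simp add: inner_vec_def simplex_vector_nth(2))
    also have "\<dots> = - 1 / s - (\<Sum>d=1..CARD('n). - 1 / s) / (s * (s + 1))"
      using a by (intro sum_simplex_vector_nth) auto
    also have "\<dots> = - 1 / s\<^sup>2"
      using simplex_s by (simp add: divide_simps power2_eq_square)
    finally show ?thesis using a False by auto
  qed
  show ?thesis
  proof (cases "a \<le> CARD('n)")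
    case True
    then show ?thesis using * assms by simp
  next
    case a: False
    show ?thesis
    proof (cases "b \<le> CARD('n)")
      case True
      then show ?thesis using *[of b a] assms by (auto simp: inner_commute)
    next
      case False
      then have "?u a \<bullet> simplex_vector b = real CARD('n) / s\<^sup>2"
        using a by (simp add: inner_vec_def simplex_vector_nth(2) power2_eq_square)
      also have "\<dots> = 1 - 1 / s\<^sup>2"
        using simplex_s by (simp add: divide_simps power2_eq_square) (simp add: algebra_simps)
      finally show ?thesis using a False assms by auto
    qed
  qed
qed

text \<open>The Gram matrix is an orthogonal projection, so the simplex vectors form a Parseval
  frame; here this is checked coordinatewise. The identity feeds
  \<open>list_monomial_in_span_frame_monomial\<close> and makes the squared simplex coordinates sum
  to \<open>norm x ^ 2\<close>.\<close>

lemma simplex_vector_frame':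
  "x = (\<Sum>a=1..Suc CARD('n). (x \<bullet> simplex_vector a) *\<^sub>R (simplex_vector a :: real ^ 'n::{finite,linorder}))"
proof -
  let ?u = "simplex_vector :: nat \<Rightarrow> (real, 'n) vec"
  define X where "X = (\<Sum>i\<in>UNIV. x $ i)"
  define c where "c = 1 / (s * (s + 1))"
  have nth: "?u a $ i = (if coord_pos i = a then 1 else 0) - c"
    if "a \<le> CARD('n)" for a i
    using that by (simp add: simplex_vector_nth c_def)
  obtain f where f: "x $ i = f (coord_pos i)" for i
    using inv_f_f[OF coord_pos_inj[where 'a = 'n]] by (metis comp_apply)
  have X: "X = (\<Sum>a=1..CARD('n). f a)" unfolding X_def f by (rule sum_coord_pos)
  have inner: "x \<bullet> simplex_vector a = f a - X * c" if "a \<in> {1..CARD('n)}" for a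
    using sum_simplex_vector_nth[of a f] that by (simp add: inner_vec_def f X mult.commute c_def)
  have last: "x \<bullet> simplex_vector (Suc CARD('n)) = - X / s"
    by (simp add: inner_vec_def simplex_vector_nth(2) X_def sum_divide_distrib sum_negf)
  have "(\<Sum>a=1..Suc CARD('n). (x \<bullet> simplex_vector a) *\<^sub>R ?u a) $ i = x $ i" for i
  proof -
    have "(\<Sum>a=1..Suc CARD('n). (x \<bullet> simplex_vector a) *\<^sub>R ?u a) $ i
        = (\<Sum>a=1..CARD('n). (x \<bullet> simplex_vector a) * ?u a $ i) + X / s\<^sup>2"
      by (simp add: sum_component last simplex_vector_nth(2) power2_eq_square)
    also have "(\<Sum>a=1..CARD('n). (x \<bullet> simplex_vector a) * ?u a $ i) =
        (\<Sum>a=1..CARD('n). (if a = coord_pos i then f a - X * c else 0) - (f a - X * c) * c)"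
      by (intro sum.cong) (auto simp: inner nth algebra_simps)
    also have "\<dots> = f (coord_pos i) - X * c - (X - real CARD('n) * (X * c)) * c"
    proof -
      have "(\<Sum>a=1..CARD('n). f a - X * c) = X - real CARD('n) * (X * c)"
        by (simp add: sum_subtractf X)
      then show ?thesis
        unfolding sum_subtractf[of "\<lambda>a. if a = coord_pos i then f a - X * c else 0"] sum_distrib_right[symmetric]
        using coord_pos_le[of i] coord_pos_ge_1[of i] by simp
    qed
    also have "\<dots> = f (coord_pos i) - X / s\<^sup>2"
      unfolding c_def using simplex_s by (simp add: divide_simps power2_eq_square) (simp add: algebra_simps)
    finally show ?thesis by (simp add: f)
  qed
  then show ?thesis by (simp add: vec_eq_iff)
qed

text \<open>For \<open>i < CARD('n)\<close> the common shift c = 1 / (s (s + 1)) cancels. For the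
  last root the entries are 1 / s - c = 1 / (s + 1) and 1 + 1 / s - c = (s + 2) / (s + 1), which
  explains the constants a and b. The generators thus exchange consecutive vertices.\<close>

lemma fundamental_root_eq':
  assumes "i \<in> {1..CARD('n)}"
  shows "fundamental_root i = (simplex_vector i - simplex_vector (Suc i) :: real ^ 'n::{finite,linorder})"
proof (cases "i < CARD('n)")
  case True
  then show ?thesis
    by (simp add: vec_eq_iff fundamental_root_def Let_def std_basis_def simplex_vector_nth)
next
  case False
  then have i: "i = CARD('n)" using assms by simp
  have N: "real CARD('n) = s * s - 1" using simplex_s(2) by (simp add: algebra_simps)
  have a: "(- 1 + s) / real CARD('n) = 1 / (s + 1)" and b: "(real CARD('n) - 1 + s) / real CARD('n) = (s + 2) / (s + 1)"
    using simplex_s by (simp_all add: divide_simps N) (simp_all add: algebra_simps)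
  have "coord_pos j < CARD('n) \<longleftrightarrow> coord_pos j \<noteq> CARD('n)" for j :: 'n
    using coord_pos_le[of j] by linarith
  then show ?thesis
    using simplex_s(1)
    by (simp add: vec_eq_iff fundamental_root_def Let_def simplex_vector_nth i s[symmetric] a b)
      (simp add: divide_simps, simp add: N algebra_simps)
qed

text \<open>With s^2 = n + 1 the factor n + 2 + 2 s is (s + 1)^2 and leaves the square root; what
  remains is the normalization of a sum of k vertices.\<close>

lemma corner_vector_eq':
  assumes "k \<in> {1..CARD('n)}"
  shows "corner_vector k = (s / sqrt (real k * (s\<^sup>2 - real k))) *\<^sub>R
    (\<Sum>a=1..k. simplex_vector a :: real ^ 'n::{finite,linorder})"
proof -
  have s2: "s\<^sup>2 = real CARD('n) + 1" unfolding s by simp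
  then have N: "real CARD('n) = s * s - 1" by (simp add: power2_eq_square)
  define q where "q = sqrt (real k * (s\<^sup>2 - real k))"
  have q: "q > 0" using assms by (simp add: q_def s2)
  have "sqrt (real k * (real CARD('n) + 1 - real k) * (real CARD('n) + 2 + 2 * s)) = sqrt (real k * (s\<^sup>2 - real k) * (s + 1)\<^sup>2)"
    by (simp add: N power2_eq_square algebra_simps)
  also have "\<dots> = q * (s + 1)" using simplex_s by (simp add: q_def real_sqrt_mult)
  finally have D: "sqrt (real k * (real CARD('n) + 1 - real k) * (real CARD('n) + 2 + 2 * s)) = q * (s + 1)" .
  have sum: "(\<Sum>a=1..k. simplex_vector a :: (real, 'n) vec) $ i = (if coord_pos i \<le> k then 1 else 0) - real k / (s * (s + 1))" for i
  proof -
    have "(\<Sum>a=1..k. simplex_vector a :: (real, 'n) vec) $ i =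
        (\<Sum>a=1..k. (if a = coord_pos i then 1 else 0) - 1 / (s * (s + 1)))"
      using assms by (auto simp: sum_component simplex_vector_nth(1) intro!: sum.cong)
    also have "\<dots> = (if coord_pos i \<le> k then 1 else 0) - real k / (s * (s + 1))"
      using coord_pos_ge_1[of i] by (simp add: sum_subtractf)
    finally show ?thesis .
  qed
  have "corner_vector k $ i = ((s / q) *\<^sub>R (\<Sum>a=1..k. simplex_vector a :: (real, 'n) vec)) $ i" for i
  proof -
    have "corner_vector k $ i = (if coord_pos i \<le> k then (real CARD('n) + 1 - real k + s) / (q * (s + 1))
        else - real k / (q * (s + 1)))"
      by (simp only: corner_vector_def Let_def vec_lambda_beta s[symmetric] D)
    also have "\<dots> = s / q * ((if coord_pos i \<le> k then 1 else 0) - real k / (s * (s + 1)))"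
      using simplex_s(1) q by (simp add: divide_simps) (simp add: N algebra_simps)
    finally show ?thesis by (simp only: vector_scaleR_component sum real_scaleR_def)
  qed
  then show ?thesis by (simp add: vec_eq_iff q_def)
qed

end

lemmas simplex_vector_frame = simplex_vector_frame'[OF refl]
lemmas fundamental_root_eq = fundamental_root_eq'[OF refl]

lemma simplex_vector_inner:
  assumes "a \<in> {1..Suc CARD('n)}" "b \<in> {1..Suc CARD('n)}"
  shows "(simplex_vector a :: real ^ 'n::{finite,linorder}) \<bullet> simplex_vector b =
    (if a = b then 1 else 0) - 1 / real (Suc CARD('n))"
  using simplex_vector_inner'[OF refl assms] by (simp add: add.commute)

text \<open>The sum is orthogonal to all simplex vectors, hence zero by the frame identity.\<close>

lemma sum_simplex_vector: "(\<Sum>a=1..Suc CARD('n). simplex_vector a :: real ^ 'n::{finite,linorder}) = 0"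
proof -
  let ?u = "simplex_vector :: nat \<Rightarrow> (real, 'n) vec"
  have "(\<Sum>a=1..Suc CARD('n). ?u a) \<bullet> ?u b = 0" if "b \<in> {1..Suc CARD('n)}" for b
  proof -
    have "(\<Sum>a=1..Suc CARD('n). ?u a) \<bullet> ?u b =
        (\<Sum>a=1..Suc CARD('n). (if a = b then 1 else 0) - 1 / real (Suc CARD('n)))"
      unfolding inner_sum_left using that by (intro sum.cong refl simplex_vector_inner)
    also have "\<dots> = 0" using that unfolding sum_subtractf by simp
    finally show ?thesis .
  qed
  then show ?thesis
    using simplex_vector_frame[of "\<Sum>a=1..Suc CARD('n). ?u a"] by simp
qed

section \<open>Subsets of vertices and the action of the reflections on them\<close>

definition simplex_face_sum :: "nat set \<Rightarrow> real ^ 'n::{finite,linorder}" where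
  "simplex_face_sum T = (\<Sum>a\<in>T. simplex_vector a)"

lemma simplex_face_sum_inner:
  assumes "T \<subseteq> {1..Suc CARD('n)}" "a \<in> {1..Suc CARD('n)}"
  shows "(simplex_face_sum T :: real ^ 'n::{finite,linorder}) \<bullet> simplex_vector a =
    (if a \<in> T then 1 else 0) - real (card T) / real (Suc CARD('n))"
proof -
  have "finite T" using assms(1) finite_subset by blast
  have "(simplex_face_sum T :: (real, 'n) vec) \<bullet> simplex_vector a =
      (\<Sum>b\<in>T. (if b = a then 1 else 0) - 1 / real (Suc CARD('n)))"
    unfolding simplex_face_sum_def inner_sum_left
    using assms by (intro sum.cong refl simplex_vector_inner) auto
  also have "\<dots> = (if a \<in> T then 1 else 0) - real (card T) / real (Suc CARD('n))"
    using \<open>finite T\<close> unfolding sum_subtractf by simp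
  finally show ?thesis .
qed

lemma norm_simplex_face_sum:
  assumes "T \<subseteq> {1..Suc CARD('n)}"
  shows "(norm (simplex_face_sum T :: real ^ 'n::{finite,linorder}))\<^sup>2 =
    real (card T) * (real (Suc CARD('n)) - real (card T)) / real (Suc CARD('n))"
proof -
  have "(norm (simplex_face_sum T :: (real, 'n) vec))\<^sup>2 =
      (\<Sum>a\<in>T. (simplex_face_sum T :: (real, 'n) vec) \<bullet> simplex_vector a)"
    by (simp add: power2_norm_eq_inner simplex_face_sum_def inner_sum_right)
  also have "\<dots> = (\<Sum>a\<in>T. 1 - real (card T) / real (Suc CARD('n)))"
    using assms by (intro sum.cong refl) (subst simplex_face_sum_inner, auto)
  also have "\<dots> = real (card T) * (real (Suc CARD('n)) - real (card T)) / real (Suc CARD('n))"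
    by (simp add: field_simps)
  finally show ?thesis .
qed

lemma hyperplane_reflection_involution: "hyperplane_reflection \<alpha> (hyperplane_reflection \<alpha> x) = x"
  by (cases "\<alpha> = 0") (simp_all add: hyperplane_reflection_def inner_diff_left algebra_simps diff_divide_distrib)

lemma orthogonal_transformation_hyperplane_reflection:
  "orthogonal_transformation (hyperplane_reflection (\<alpha> :: 'a::real_inner))"
proof (cases "\<alpha> = 0")
  case True
  then have "hyperplane_reflection \<alpha> = (\<lambda>x. x)" by (simp add: hyperplane_reflection_def fun_eq_iff)
  then show ?thesis by simp
next
  case False
  show ?thesis unfolding orthogonal_transformation_def
  proof (intro conjI allI)
    show "linear (hyperplane_reflection \<alpha>)"
      by (rule linearI) (simp_all add: hyperplane_reflection_def inner_add_left algebra_simps add_divide_distrib)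
    fix v w
    have "\<alpha> \<bullet> \<alpha> \<noteq> 0" using False by simp
    then show "hyperplane_reflection \<alpha> v \<bullet> hyperplane_reflection \<alpha> w = v \<bullet> w"
      by (simp add: hyperplane_reflection_def inner_diff_left inner_diff_right inner_commute field_simps)
  qed
qed

abbreviation swap :: "nat \<Rightarrow> nat \<Rightarrow> nat \<Rightarrow> nat" where
  "swap \<equiv> Transposition.transpose"

text \<open>The root u_a - u_b has squared length 2 and inner product 1, -1 or 0 with a vertex, so
  the reflection exchanges u_a and u_b and fixes the others.\<close>

lemma reflection_simplex_face_sum:
  assumes T: "T \<subseteq> {1..Suc CARD('n)}" and ab: "a \<in> {1..Suc CARD('n)}" "b \<in> {1..Suc CARD('n)}" "a \<noteq> b"
  shows "hyperplane_reflection (simplex_vector a - simplex_vector b) (simplex_face_sum T :: real ^ 'n::{finite,linorder}) =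
    simplex_face_sum (swap a b ` T)"
proof -
  let ?u = "simplex_vector :: nat \<Rightarrow> (real, 'n) vec"
  let ?R = "hyperplane_reflection (?u a - ?u b)"
  have lin: "linear ?R"
    using orthogonal_transformation_hyperplane_reflection orthogonal_transformation_linear by blast
  have 2: "(?u a - ?u b) \<bullet> (?u a - ?u b) = 2"
    using ab by (simp add: inner_diff_left inner_diff_right simplex_vector_inner)
  have "?R (?u d) = ?u (swap a b d)" if "d \<in> {1..Suc CARD('n)}" for d
  proof -
    have "?u d \<bullet> (?u a - ?u b) = (if d = a then 1 else 0) - (if d = b then 1 else 0)"
      using ab that by (simp add: inner_diff_right simplex_vector_inner)
    then show ?thesis
      unfolding hyperplane_reflection_def 2 using ab by (auto simp: Transposition.transpose_def)
  qed
  then have "?R (simplex_face_sum T) = (\<Sum>d\<in>T. ?u (swap a b d))"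
    unfolding simplex_face_sum_def linear_sum[OF lin] using T by (intro sum.cong) auto
  also have "\<dots> = simplex_face_sum (swap a b ` T)"
    unfolding simplex_face_sum_def by (subst sum.reindex) auto
  finally show ?thesis .
qed

lemma swap_image_subset:
  assumes "T \<subseteq> I" "a \<in> I" "b \<in> I"
  shows "swap a b ` T \<subseteq> I" "card (swap a b ` T) = card T"
proof -
  show "swap a b ` T \<subseteq> I" using assms by (auto simp: Transposition.transpose_def)
  show "card (swap a b ` T) = card T" by (simp add: card_image)
qed

text \<open>Replacing an element i + 1 by a missing i lowers the sum of the set, and a set admitting
  no such step is an initial segment: bubble sort as an induction rule.\<close>

lemma subset_adjacent_swaps_induct:
  fixes T :: "nat set"
  assumes T: "T \<subseteq> {1..Suc N}"
    and init: "P {1..card T}"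
    and step: "\<And>T' i. T' \<subseteq> {1..Suc N} \<Longrightarrow> card T' = card T \<Longrightarrow> i \<in> {1..N} \<Longrightarrow> P T' \<Longrightarrow> P (swap i (Suc i) ` T')"
  shows "P T"
  using assms
proof (induction "\<Sum>T" arbitrary: T rule: less_induct)
  case less
  have fin: "finite T" using less.prems(1) finite_subset by blast
  show ?case
  proof (cases "\<exists>i\<in>{1..N}. Suc i \<in> T \<and> i \<notin> T")
    case True
    then obtain i where i: "i \<in> {1..N}" "Suc i \<in> T" "i \<notin> T" by blast
    let ?T' = "swap i (Suc i) ` T"
    have eq: "?T' = insert i (T - {Suc i})"
      using i by (auto simp: Transposition.transpose_def image_iff split: if_splits)
    have sub: "?T' \<subseteq> {1..Suc N}" "card ?T' = card T"
      using swap_image_subset[OF less.prems(1), of i "Suc i"] i by auto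
    have "\<Sum>?T' = i + (\<Sum>T - Suc i)"
      unfolding eq using i fin by (simp add: sum_diff1_nat)
    moreover have "\<Sum>T \<ge> Suc i" using i fin by (intro member_le_sum) auto
    ultimately have smaller: "\<Sum>?T' < \<Sum>T" by linarith
    have "P ?T'"
    proof (rule less.hyps)
      show "\<Sum>?T' < \<Sum>T" by (rule smaller)
      show "P {1..card ?T'}" using less.prems(2) sub(2) by simp
      show "P (swap j (Suc j) ` T')"
        if "T' \<subseteq> {1..Suc N}" "card T' = card ?T'" "j \<in> {1..N}" "P T'" for T' j
        using that sub(2) by (intro less.prems(3)) auto
    qed (use sub in simp)
    have "P (swap i (Suc i) ` ?T')"
      using sub i(1) \<open>P ?T'\<close> by (rule less.prems(3))
    then show ?thesis by (simp add: image_image)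
  next
    case False
    have "{1..j} \<subseteq> T" if "j \<in> T" for j
      using that
    proof (induction j)
      case (Suc j)
      show ?case
      proof (cases "j = 0")
        case False
        then have "j \<in> {1..N}" using Suc.prems less.prems(1) by auto
        then have "j \<in> T" using \<open>\<not> (\<exists>i\<in>{1..N}. Suc i \<in> T \<and> i \<notin> T)\<close> Suc.prems by blast
        then show ?thesis using Suc by (auto simp: le_Suc_eq)
      qed (use Suc.prems in auto)
    qed simp
    then have "T = {1..card T}"
    proof (cases "T = {}")
      case False
      have "T = {1..Max T}"
        using \<open>\<And>j. j \<in> T \<Longrightarrow> {1..j} \<subseteq> T\<close>[OF Max_in[OF fin False]] fin less.prems(1) by auto
      then show ?thesis by (metis card_atLeastAtMost diff_Suc_1 One_nat_def)
    qed simp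
    then show ?thesis using less.prems(2) by simp
  qed
qed

text \<open>The scalar is r divided by the norm of the face sum, see
  \<open>norm_simplex_face_sum\<close>. Subsets of equal size index the points of one orbit.\<close>

definition orbit_point :: "real \<Rightarrow> nat set \<Rightarrow> real ^ 'n::{finite,linorder}" where
  "orbit_point r T =
     (let m = real (Suc CARD('n)); k = real (card T)
      in (r * sqrt (m / (k * (m - k)))) *\<^sub>R simplex_face_sum T)"

lemma orbit_point_inner:
  assumes "T \<subseteq> {1..Suc CARD('n)}" "a \<in> {1..Suc CARD('n)}" "card T = k" "m = Suc CARD('n)"
  shows "(orbit_point r T :: real ^ 'n::{finite,linorder}) \<bullet> simplex_vector a =
    r * sqrt (real m / (real k * (real m - real k))) * ((if a \<in> T then 1 else 0) - real k / real m)"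
  using simplex_face_sum_inner[OF assms(1,2)] assms(3,4) by (simp add: orbit_point_def Let_def)

lemma norm_orbit_point:
  assumes "T \<subseteq> {1..Suc CARD('n)}" "card T \<in> {1..CARD('n)}" "r > 0"
  shows "norm (orbit_point r T :: real ^ 'n::{finite,linorder}) = r"
proof -
  let ?m = "real (Suc CARD('n))" and ?k = "real (card T)"
  have pos: "?k > 0" "?m - ?k > 0" "?m > 0" using assms by auto
  have "(norm (orbit_point r T :: (real, 'n) vec))\<^sup>2 =
      r\<^sup>2 * (?m / (?k * (?m - ?k))) * (?k * (?m - ?k) / ?m)"
    using pos by (simp add: orbit_point_def Let_def power_mult_distrib norm_simplex_face_sum[OF assms(1)]
        del: of_nat_Suc)
  also have "\<dots> = r\<^sup>2" using pos by (simp del: of_nat_Suc)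
  finally show ?thesis using \<open>r > 0\<close> by simp
qed

text \<open>The simplex coordinates are 1 - k / m on T and - k / m off T, up to a positive factor.
  Thus T is recovered from the point whatever its radius, and distinct orbits are disjoint even on a
  common sphere.\<close>

lemma orbit_point_support:
  assumes "T \<subseteq> {1..Suc CARD('n)}" "card T \<in> {1..CARD('n)}" "r > 0"
  shows "T = {a \<in> {1..Suc CARD('n)}. (orbit_point r T :: real ^ 'n::{finite,linorder}) \<bullet> simplex_vector a > 0}"
proof -
  let ?m = "real (Suc CARD('n))" and ?k = "real (card T)"
  have pos: "?k > 0" "?m - ?k > 0" "?m > 0" using assms by auto
  then have c: "r * sqrt (?m / (?k * (?m - ?k))) > 0" using assms(3) by simp
  have mem: "(if a \<in> T then 1 else 0) - ?k / ?m > 0 \<longleftrightarrow> a \<in> T" for a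
    using pos by (simp add: divide_simps del: of_nat_Suc)
  have scale: "0 < c * x \<longleftrightarrow> 0 < x" if "c > 0" for c x :: real
    using that by (simp add: zero_less_mult_iff)
  have "(orbit_point r T :: (real, 'n) vec) \<bullet> simplex_vector a > 0 \<longleftrightarrow> a \<in> T"
    if "a \<in> {1..Suc CARD('n)}" for a
    unfolding orbit_point_inner[OF assms(1) that refl refl, of r] scale[OF c] by (rule mem)
  then show ?thesis using assms(1) by auto
qed

lemma reflection_orbit_point:
  assumes "T \<subseteq> {1..Suc CARD('n)}" "a \<in> {1..Suc CARD('n)}" "b \<in> {1..Suc CARD('n)}" "a \<noteq> b"
  shows "hyperplane_reflection (simplex_vector a - simplex_vector b) (orbit_point r T :: real ^ 'n::{finite,linorder}) =
    orbit_point r (swap a b ` T)"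
proof -
  have "linear (hyperplane_reflection (simplex_vector a - simplex_vector b :: (real, 'n) vec))"
    using orthogonal_transformation_hyperplane_reflection orthogonal_transformation_linear by blast
  then show ?thesis
    using swap_image_subset(2)[OF assms(1-3)] reflection_simplex_face_sum[OF assms]
    by (simp add: orbit_point_def Let_def linear_scale)
qed

lemma corner_vector_eq:
  assumes "k \<in> {1..CARD('n)}"
  shows "corner_vector k = (orbit_point 1 {1..k} :: real ^ 'n::{finite,linorder})"
  using corner_vector_eq'[OF refl assms]
  by (simp add: orbit_point_def Let_def simplex_face_sum_def real_sqrt_divide add.commute)

text \<open>\<open>generate\<close> also admits inverses of the generators; being involutions, they
  add nothing new.\<close>

lemma inv_hyperplane_reflection:
  "inv\<^bsub>orthogonal_group\<^esub> (hyperplane_reflection (\<alpha> :: 'a::euclidean_space)) = hyperplane_reflection \<alpha>"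
proof -
  let ?h = "hyperplane_reflection \<alpha>"
  have h: "?h \<circ> ?h = id" by (simp add: fun_eq_iff hyperplane_reflection_involution)
  have "(THE y. orthogonal_transformation y \<and> ?h \<circ> y = id \<and> y \<circ> ?h = id) = ?h"
  proof (rule the_equality)
    fix y assume "orthogonal_transformation y \<and> ?h \<circ> y = id \<and> y \<circ> ?h = id"
    then have "?h \<circ> (?h \<circ> y) = ?h \<circ> id" by simp
    then show "y = ?h" unfolding comp_assoc[symmetric] h by simp
  qed (use h orthogonal_transformation_hyperplane_reflection in auto)
  then show ?thesis by (simp add: m_inv_def orthogonal_group_def)
qed

text \<open>One map \<sigma> is chosen before T and r, so that the maps compose along with the group
  elements.\<close>

lemma A_group_orbit_point:
  assumes "g \<in> A_group"
  shows "\<exists>\<sigma>. \<forall>T r. T \<subseteq> {1..Suc CARD('n)} \<longrightarrow> \<sigma> T \<subseteq> {1..Suc CARD('n)} \<and> card (\<sigma> T) = card T \<and>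
    g (orbit_point r T :: real ^ 'n::{finite,linorder}) = orbit_point r (\<sigma> T)"
  using assms unfolding A_group_def
proof (induction rule: generate.induct)
  case one
  then show ?case by (intro exI[of _ "\<lambda>T. T"]) (simp add: orthogonal_group_def)
next
  case (incl h)
  then obtain i where i: "i \<in> {1..CARD('n)}" "h = hyperplane_reflection (fundamental_root i)" by blast
  show ?case
    using i reflection_orbit_point[where 'n = 'n, of _ i "Suc i"] swap_image_subset[of _ "{1..Suc CARD('n)}" i "Suc i"]
    by (intro exI[of _ "(`) (swap i (Suc i))"]) (simp add: fundamental_root_eq)
next
  case (inv h)
  then obtain i where i: "i \<in> {1..CARD('n)}" "h = hyperplane_reflection (fundamental_root i)" by blast
  show ?case
    using i reflection_orbit_point[where 'n = 'n, of _ i "Suc i"] swap_image_subset[of _ "{1..Suc CARD('n)}" i "Suc i"]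
    by (intro exI[of _ "(`) (swap i (Suc i))"]) (simp add: fundamental_root_eq inv_hyperplane_reflection)
next
  case (eng h1 h2)
  then obtain \<sigma>1 \<sigma>2 where
    "\<forall>T r. T \<subseteq> {1..Suc CARD('n)} \<longrightarrow> \<sigma>1 T \<subseteq> {1..Suc CARD('n)} \<and> card (\<sigma>1 T) = card T \<and>
      h1 (orbit_point r T) = orbit_point r (\<sigma>1 T)"
    "\<forall>T r. T \<subseteq> {1..Suc CARD('n)} \<longrightarrow> \<sigma>2 T \<subseteq> {1..Suc CARD('n)} \<and> card (\<sigma>2 T) = card T \<and>
      h2 (orbit_point r T) = orbit_point r (\<sigma>2 T)"
    by blast
  then show ?case by (intro exI[of _ "\<sigma>1 \<circ> \<sigma>2"]) (simp add: orthogonal_group_def)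
qed

text \<open>Group elements take orbit points to orbit points of subsets of the same size;
  conversely, adjacent swaps lead from \<open>{1..k}\<close> to any subset of size k.\<close>

lemma A_orbit_eq:
  assumes k: "k \<in> {1..CARD('n)}"
  shows "A_orbit (corner_vector k :: real ^ 'n::{finite,linorder}) =
    orbit_point 1 ` {T. T \<subseteq> {1..Suc CARD('n)} \<and> card T = k}"
proof (rule subset_antisym)
  have k': "{1..k} \<subseteq> {1..Suc CARD('n)}" using k by auto
  show "A_orbit (corner_vector k :: (real, 'n) vec) \<subseteq> orbit_point 1 ` {T. T \<subseteq> {1..Suc CARD('n)} \<and> card T = k}"
  proof
    fix x assume "x \<in> A_orbit (corner_vector k :: (real, 'n) vec)"
    then obtain g where g: "g \<in> A_group" "x = g (orbit_point 1 {1..k})"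
      by (auto simp: A_orbit_def corner_vector_eq[OF k])
    from A_group_orbit_point[OF g(1)] k' obtain T where
      "T \<subseteq> {1..Suc CARD('n)}" "card T = card {1..k}" "g (orbit_point 1 {1..k}) = orbit_point 1 T"
      by meson
    then show "x \<in> orbit_point 1 ` {T. T \<subseteq> {1..Suc CARD('n)} \<and> card T = k}"
      using g by auto
  qed
  have "orbit_point 1 T \<in> A_orbit (corner_vector k :: (real, 'n) vec)"
    if "T \<subseteq> {1..Suc CARD('n)}" "card T = k" for T
    using that(1)
  proof (rule subset_adjacent_swaps_induct)
    have "(id :: (real, 'n) vec \<Rightarrow> _) \<in> A_group"
      unfolding A_group_def using generate.one[of orthogonal_group] by (simp add: orthogonal_group_def)
    then show "orbit_point 1 {1..card T} \<in> A_orbit (corner_vector k :: (real, 'n) vec)"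
      unfolding A_orbit_def corner_vector_eq[OF k] that(2)
      by (auto intro!: exI[of _ id])
  next
    fix T' i
    assume T': "T' \<subseteq> {1..Suc CARD('n)}" "card T' = card T" and i: "i \<in> {1..CARD('n)}"
      and "orbit_point 1 T' \<in> A_orbit (corner_vector k :: (real, 'n) vec)"
    then obtain g where g: "g \<in> A_group" "(orbit_point 1 T' :: (real, 'n) vec) = g (corner_vector k)"
      by (auto simp: A_orbit_def)
    let ?R = "hyperplane_reflection (fundamental_root i) :: (real, 'n) vec \<Rightarrow> _"
    have "?R \<in> generate orthogonal_group ((\<lambda>i. hyperplane_reflection (fundamental_root i)) ` {1..CARD('n)})"
      using i by (intro generate.incl) blast
    from generate.eng[OF this g(1)[unfolded A_group_def]] have "?R \<circ> g \<in> A_group"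
      by (simp add: A_group_def orthogonal_group_def)
    moreover have "(?R \<circ> g) (corner_vector k) = orbit_point 1 (swap i (Suc i) ` T')"
      using reflection_orbit_point[OF T'(1), of i "Suc i" 1] i
      by (simp add: g(2)[symmetric] fundamental_root_eq)
    ultimately show "orbit_point 1 (swap i (Suc i) ` T') \<in> A_orbit (corner_vector k :: (real, 'n) vec)"
      unfolding A_orbit_def mem_Collect_eq by metis
  qed
  then show "orbit_point 1 ` {T. T \<subseteq> {1..Suc CARD('n)} \<and> card T = k} \<subseteq> A_orbit (corner_vector k :: (real, 'n) vec)"
    by blast
qed

lemma scaled_orbit_eq:
  assumes "k \<in> {1..CARD('n)}"
  shows "scaled_orbit k r = (orbit_point r :: _ \<Rightarrow> real ^ 'n::{finite,linorder}) ` {T. T \<subseteq> {1..Suc CARD('n)} \<and> card T = k}"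
proof -
  have "r *\<^sub>R orbit_point 1 T = (orbit_point r T :: (real, 'n) vec)" for T
    by (simp add: orbit_point_def Let_def)
  then show ?thesis by (simp add: scaled_orbit_def A_orbit_eq[OF assms] image_image)
qed

text \<open>Complementary faces have opposite sums because the vertices sum to zero, and k (m - k)
  is unchanged. So -1 exchanges the orbits of k and m - k.\<close>

lemma orbit_point_Compl:
  assumes "T \<subseteq> {1..Suc CARD('n)}"
  shows "orbit_point r ({1..Suc CARD('n)} - T) = - (orbit_point r T :: real ^ 'n::{finite,linorder})"
proof -
  have fin: "finite T" using assms finite_subset by blast
  have "simplex_face_sum ({1..Suc CARD('n)} - T) + simplex_face_sum T = (0 :: (real, 'n) vec)"
    unfolding simplex_face_sum_def using sum.subset_diff[OF assms, of simplex_vector] sum_simplex_vector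
    by (metis finite_atLeastAtMost)
  moreover have "card ({1..Suc CARD('n)} - T) = Suc CARD('n) - card T" "card T \<le> Suc CARD('n)"
    using fin assms card_mono[OF _ assms] by (simp_all add: card_Diff_subset)
  ultimately show ?thesis
    by (simp add: orbit_point_def Let_def of_nat_diff eq_neg_iff_add_eq_0 scaleR_right_distrib[symmetric] mult.commute del: of_nat_Suc)
qed

section \<open>Moment conditions\<close>

declare binomial_Suc_Suc [simp del]

definition k_subsets :: "nat \<Rightarrow> nat \<Rightarrow> nat set set" where
  "k_subsets m k = {T. T \<subseteq> {1..m} \<and> card T = k}"

lemma finite_k_subsets [simp]: "finite (k_subsets m k)"
  by (rule finite_subset[of _ "Pow {1..m}"]) (auto simp: k_subsets_def)

lemma card_k_subsets: "card (k_subsets m k) = m choose k"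
  using n_subsets[of "{1..m}" k] by (simp add: k_subsets_def)

lemma bij_betw_swap_k_subsets:
  assumes "a \<in> {1..m}" "b \<in> {1..m}"
  shows "bij_betw ((`) (swap a b)) (k_subsets m k) (k_subsets m k)"
proof (rule bij_betwI[where g = "(`) (swap a b)"])
  show "(`) (swap a b) \<in> k_subsets m k \<rightarrow> k_subsets m k"
    using swap_image_subset[OF _ assms] by (auto simp: k_subsets_def simp del: image_subset_iff)
  then show "(`) (swap a b) \<in> k_subsets m k \<rightarrow> k_subsets m k" .
qed (simp_all add: image_image)

lemma bij_betw_Compl_k_subsets:
  assumes "k \<le> m"
  shows "bij_betw (\<lambda>T. {1..m} - T) (k_subsets m k) (k_subsets m (m - k))"
proof (rule bij_betwI[where g = "\<lambda>T. {1..m} - T"])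
  have "card ({1..m} - T) = m - card T" if "T \<subseteq> {1..m}" for T
    using that finite_subset[OF that] by (simp add: card_Diff_subset)
  then show "(\<lambda>T. {1..m} - T) \<in> k_subsets m k \<rightarrow> k_subsets m (m - k)"
    "(\<lambda>T. {1..m} - T) \<in> k_subsets m (m - k) \<rightarrow> k_subsets m k"
    using assms by (auto simp: k_subsets_def)
qed (auto simp: k_subsets_def)

text \<open>Pairs of an orbit index and a subset parametrize the points injectively by
  \<open>orbit_point_support\<close>, also when several radii agree; sums, size and norms follow
  from this.\<close>

lemma sum_A_union:
  fixes h :: "real ^ 'n::{finite,linorder} \<Rightarrow> real"
  assumes J: "J \<subseteq> {1..CARD('n)}" and r: "\<And>k. k \<in> J \<Longrightarrow> r k > 0"
  shows "(\<Sum>x\<in>A_union J r. h x) = (\<Sum>k\<in>J. \<Sum>T\<in>k_subsets (Suc CARD('n)) k. h (orbit_point (r k) T))"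
    and "finite (A_union J r :: ((real, 'n) vec) set)"
    and "card (A_union J r :: ((real, 'n) vec) set) = (\<Sum>k\<in>J. Suc CARD('n) choose k)"
    and "norm ` (A_union J r :: ((real, 'n) vec) set) = r ` J"
proof -
  let ?K = "k_subsets (Suc CARD('n))"
  let ?p = "\<lambda>(k, T). orbit_point (r k) T :: (real, 'n) vec"
  have finJ: "finite J" using J finite_subset by blast
  have T: "T \<subseteq> {1..Suc CARD('n)}" "card T \<in> {1..CARD('n)}" "card T = k" if "k \<in> J" "T \<in> ?K k" for k T
    using that J by (auto simp: k_subsets_def)
  have X: "A_union J r = ?p ` Sigma J ?K"
  proof -
    have "A_union J r = (\<Union>k\<in>J. (orbit_point (r k) :: _ \<Rightarrow> (real, 'n) vec) ` ?K k)"
      unfolding A_union_def k_subsets_def using J by (intro SUP_cong refl scaled_orbit_eq) auto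
    then show ?thesis by auto
  qed
  have inj: "inj_on ?p (Sigma J ?K)"
  proof (rule inj_onI, clarify)
    fix k T k' T' assume k: "k \<in> J" "T \<in> ?K k" "k' \<in> J" "T' \<in> ?K k'"
      and eq: "orbit_point (r k) T = (orbit_point (r k') T' :: (real, 'n) vec)"
    have "T = {a \<in> {1..Suc CARD('n)}. (orbit_point (r k) T :: (real, 'n) vec) \<bullet> simplex_vector a > 0}"
      using T[OF k(1,2)] r k by (intro orbit_point_support) auto
    also have "\<dots> = T'"
      unfolding eq using T[OF k(3,4)] r k by (intro orbit_point_support[symmetric]) auto
    finally show "k = k' \<and> T = T'" using T[OF k(1,2)] T[OF k(3,4)] by auto
  qed
  show "(\<Sum>x\<in>A_union J r. h x) = (\<Sum>k\<in>J. \<Sum>T\<in>?K k. h (orbit_point (r k) T))"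
    unfolding X by (subst sum.reindex[OF inj]) (simp add: sum.Sigma finJ case_prod_unfold)
  show "finite (A_union J r :: ((real, 'n) vec) set)"
    unfolding X using finJ by simp
  show "card (A_union J r :: ((real, 'n) vec) set) = (\<Sum>k\<in>J. Suc CARD('n) choose k)"
    unfolding X by (simp add: card_image[OF inj] finJ card_k_subsets)
  have ne: "?K k \<noteq> {}" if "k \<in> J" for k
  proof -
    have "card (?K k) > 0" unfolding card_k_subsets using that J by (auto simp: zero_less_binomial_iff)
    then show ?thesis by auto
  qed
  have n: "norm (?p (k, T)) = r k" if "k \<in> J" "T \<in> ?K k" for k T
    using norm_orbit_point[OF T(1,2)[OF that]] r that by simp
  have "norm ` ?p ` Sigma J ?K = (\<lambda>(k, T). r k) ` Sigma J ?K"
    unfolding image_image using n by (intro image_cong) auto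
  also have "\<dots> = r ` J" using ne by force
  finally show "norm ` (A_union J r :: ((real, 'n) vec) set) = r ` J"
    unfolding X .
qed

text \<open>Left minus right side of the cubature formula, taken orbit by orbit: each point carries
  the average over its own sphere, so several orbits on one sphere require no grouping.\<close>

definition moment_defect ::
  "nat set \<Rightarrow> (nat \<Rightarrow> real) \<Rightarrow> (nat \<Rightarrow> real) \<Rightarrow> (real ^ 'n::{finite,linorder} \<Rightarrow> real) \<Rightarrow> real" where
  "moment_defect J r w f =
     (\<Sum>k\<in>J. w k * (\<Sum>T\<in>k_subsets (Suc CARD('n)) k. sphere_average (r k) f - f (orbit_point (r k) T)))"

text \<open>Up to the factor 1 / m this is the weighted sum over the design of norm x ^ (p - 3)
  times the third power sum; p = 3 and p = 5 occur. The spherical averages are zero by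
  oddness.\<close>

definition cubic_moment :: "nat \<Rightarrow> nat set \<Rightarrow> (nat \<Rightarrow> real) \<Rightarrow> (nat \<Rightarrow> real) \<Rightarrow> nat \<Rightarrow> real" where
  "cubic_moment m J r w p = (\<Sum>k\<in>J. w k * real (m choose k) * r k ^ p *
     (sqrt (real m / (real k * (real m - real k))) * (real m - 2 * real k)))"

text \<open>Weighted excess of the fourth power sum over its spherical average, times m + 1.\<close>

definition quartic_moment :: "nat \<Rightarrow> nat set \<Rightarrow> (nat \<Rightarrow> real) \<Rightarrow> (nat \<Rightarrow> real) \<Rightarrow> real" where
  "quartic_moment m J r w = (\<Sum>k\<in>J. w k * real (m choose k) * r k ^ 4 *
     ((real m * (real m + 1) - 6 * (real k * (real m - real k))) / (real k * (real m - real k))))"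

text \<open>The fifth power sum on an orbit contains a multiple of the cubic term with p = 5; this
  is what is left when that multiple is removed.\<close>

definition quintic_moment :: "nat \<Rightarrow> nat set \<Rightarrow> (nat \<Rightarrow> real) \<Rightarrow> (nat \<Rightarrow> real) \<Rightarrow> real" where
  "quintic_moment m J r w = (\<Sum>k\<in>J. w k * real (m choose k) * r k ^ 5 *
     (sqrt (real m / (real k * (real m - real k))) * (real m - 2 * real k) / (real k * (real m - real k))))"

text \<open>The engine of the reduction: the relation between the simplex vectors provides the zero
  sum, symmetry the equality of the terms outside Z, and earlier steps the zeros on Z.\<close>

lemma sum_vanishing_off_constant:
  fixes F :: "nat \<Rightarrow> real"
  assumes "finite I" "(\<Sum>d\<in>I. F d) = 0" "\<And>d. d \<in> I \<Longrightarrow> d \<in> Z \<Longrightarrow> F d = 0"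
    and const: "\<And>d d'. d \<in> I - Z \<Longrightarrow> d' \<in> I - Z \<Longrightarrow> d \<noteq> d' \<Longrightarrow> F d = F d'"
    and d: "d \<in> I"
  shows "F d = 0"
proof (cases "d \<in> Z")
  case False
  have "(\<Sum>e\<in>I. F e) = (\<Sum>e\<in>I - Z. F e)"
    using assms by (intro sum.mono_neutral_right) auto
  also have "\<dots> = (\<Sum>e\<in>I - Z. F d)"
    using const[of d] d False by (intro sum.cong refl) (metis DiffI)
  also have "\<dots> = card (I - Z) * F d" by simp
  finally have "real (card (I - Z)) * F d = 0" using assms(2) by simp
  moreover have "card (I - Z) \<noteq> 0" using assms(1) d False by auto
  ultimately show ?thesis by simp
qed (use assms in auto)

section \<open>The defect functional: linearity, symmetry and vanishing criteria\<close>

context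
  fixes J :: "nat set" and r w :: "nat \<Rightarrow> real" and D :: "(real ^ 'n::{finite,linorder} \<Rightarrow> real) \<Rightarrow> real"
  assumes J: "J \<subseteq> {1..CARD('n)}" and r: "\<And>k. k \<in> J \<Longrightarrow> r k > 0"
    and D: "D = moment_defect J r w"
begin

lemma orbit_params:
  assumes "k \<in> J" "T \<in> k_subsets (Suc CARD('n)) k"
  shows "T \<subseteq> {1..Suc CARD('n)}" "card T \<in> {1..CARD('n)}" "card T = k"
  using assms J by (auto simp: k_subsets_def)

text \<open>Summing sphere by sphere is the same as attaching to every point the average over the
  sphere through it.\<close>

lemma euclidean_design_iff:
  fixes W :: "real ^ 'n::{finite,linorder} \<Rightarrow> real"
  assumes w: "\<And>k. k \<in> J \<Longrightarrow> w k > 0"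
    and W: "\<And>k x. k \<in> J \<Longrightarrow> x \<in> scaled_orbit k (r k) \<Longrightarrow> W x = w k"
  shows "euclidean_design t (A_union J r) W \<longleftrightarrow> (\<forall>f\<in>Poly_le t. D f = 0)"
proof -
  let ?X = "A_union J r :: ((real, 'n) vec) set"
  note X = sum_A_union[OF J r]
  have pos: "\<forall>x\<in>?X. W x > 0" using w W by (auto simp: A_union_def)
  have W': "W (orbit_point (r k) T) = w k" if "k \<in> J" "T \<in> k_subsets (Suc CARD('n)) k" for k T
  proof (rule W[OF that(1)])
    have "k \<in> {1..CARD('n)}" using that J by auto
    then show "(orbit_point (r k) T :: (real, 'n) vec) \<in> scaled_orbit k (r k)"
      using that(2) by (simp add: scaled_orbit_eq k_subsets_def del: atLeastAtMost_iff)
  qed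
  have "(\<Sum>\<rho>\<in>norm ` ?X. (\<Sum>x\<in>?X \<inter> sphere 0 \<rho>. W x) * sphere_average \<rho> f) - (\<Sum>x\<in>?X. W x * f x) = D f"
    for f
  proof -
    have "(\<Sum>\<rho>\<in>norm ` ?X. (\<Sum>x\<in>?X \<inter> sphere 0 \<rho>. W x) * sphere_average \<rho> f) =
        (\<Sum>\<rho>\<in>norm ` ?X. \<Sum>x\<in>{x \<in> ?X. norm x = \<rho>}. W x * sphere_average (norm x) f)"
      by (intro sum.cong refl, subst sum_distrib_right) (auto intro!: sum.cong)
    also have "\<dots> = (\<Sum>x\<in>?X. W x * sphere_average (norm x) f)"
      by (rule sum.image_gen[symmetric]) (rule X(2), auto)
    finally have "(\<Sum>\<rho>\<in>norm ` ?X. (\<Sum>x\<in>?X \<inter> sphere 0 \<rho>. W x) * sphere_average \<rho> f) - (\<Sum>x\<in>?X. W x * f x) =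
        (\<Sum>x\<in>?X. W x * (sphere_average (norm x) f - f x))"
      by (simp add: sum_subtractf right_diff_distrib)
    also have "\<dots> = (\<Sum>k\<in>J. \<Sum>T\<in>k_subsets (Suc CARD('n)) k. W (orbit_point (r k) T) *
        (sphere_average (norm (orbit_point (r k) T :: (real, 'n) vec)) f - f (orbit_point (r k) T)))"
      by (rule X(1)) auto
    also have "\<dots> = D f"
      unfolding D moment_defect_def sum_distrib_left
      using W' norm_orbit_point[OF orbit_params(1,2)] r by (intro sum.cong refl) auto
    finally show ?thesis .
  qed
  then show ?thesis
    unfolding euclidean_design_def using pos X(2) by (auto simp: eq_iff_diff_eq_0[of "sum _ _"])
qed

lemma defect_add:
  "continuous_on UNIV f \<Longrightarrow> continuous_on UNIV g \<Longrightarrow> D (\<lambda>x. f x + g x) = D f + D g"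
  unfolding D moment_defect_def sum.distrib[symmetric] distrib_left[symmetric]
  by (intro sum.cong refl arg_cong2[where f = "(*)"]) (simp add: sphere_average_add r)

lemma defect_cmult: "continuous_on UNIV f \<Longrightarrow> D (\<lambda>x. c * f x) = c * D f"
  unfolding D moment_defect_def sum_distrib_left
  by (intro sum.cong refl) (simp add: sphere_average_cmult r algebra_simps)

text \<open>A radial function agrees with its average on every sphere. Hence constants, norm x ^ 2
  and norm x ^ 4 impose no condition.\<close>

lemma defect_norm: "D (\<lambda>x. h (norm x)) = 0"
proof -
  have "sphere_average (r k) (\<lambda>x :: real ^ 'n::{finite,linorder}. h (norm x)) = h (r k)" if "k \<in> J" for k
    using r[OF that] by (subst sphere_average_cong[of "r k" _ "\<lambda>_. h (r k)"]) (auto simp: sphere_average_const)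
  then show ?thesis
    unfolding D moment_defect_def using norm_orbit_point[OF orbit_params(1,2)] r by simp
qed

lemma defect_sum: "(\<And>i. i \<in> A \<Longrightarrow> continuous_on UNIV (f i)) \<Longrightarrow> D (\<lambda>x. \<Sum>i\<in>A. f i x) = (\<Sum>i\<in>A. D (f i))"
proof (induction A rule: infinite_finite_induct)
  case (insert a A)
  have "D (\<lambda>x. f a x + (\<Sum>i\<in>A. f i x)) = D (f a) + D (\<lambda>x. \<Sum>i\<in>A. f i x)"
    using insert.prems by (intro defect_add continuous_on_sum) auto
  then show ?case using insert by simp
qed (use defect_norm[of "\<lambda>_. 0"] in simp_all)

lemma defect_span:
  assumes "f \<in> funs.span B" "\<And>g. g \<in> B \<Longrightarrow> continuous_on UNIV g \<and> D g = 0"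
  shows "D f = 0"
proof -
  have "continuous_on UNIV f \<and> D f = 0"
    using assms(1)
  proof (induction rule: funs.span_induct_alt)
    case base
    then show ?case using defect_norm[of "\<lambda>_. 0"] by (simp add: zero_fun_def)
  next
    case (step c g h)
    then have g: "continuous_on UNIV g" "D g = 0" using assms(2) by auto
    then have cg: "continuous_on UNIV (\<lambda>x. c * g x)" using g by (intro continuous_intros)
    have "continuous_on UNIV (\<lambda>x. c * g x + h x)" using cg step.IH by (intro continuous_on_add) auto
    moreover have "D (\<lambda>x. c * g x + h x) = 0"
      using defect_add[OF cg, of h] defect_cmult[OF g(1), of c] step.IH g(2) by simp
    ultimately show ?case by (simp add: plus_fun_def)
  qed
  then show ?thesis ..
qed

text \<open>The average is invariant under the reflection, and the orbit sum is only reordered by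
  the swap of the vertices a and b.\<close>

lemma defect_reflection:
  assumes f: "continuous_on UNIV f" and ab: "a \<in> {1..Suc CARD('n)}" "b \<in> {1..Suc CARD('n)}" "a \<noteq> b"
  shows "D (\<lambda>x. f (hyperplane_reflection (simplex_vector a - simplex_vector b) x)) = D f"
proof -
  let ?R = "hyperplane_reflection (simplex_vector a - simplex_vector b :: real ^ 'n::{finite,linorder})"
  have "(\<Sum>T\<in>k_subsets (Suc CARD('n)) k. sphere_average (r k) (\<lambda>x. f (?R x)) - f (?R (orbit_point (r k) T))) =
      (\<Sum>T\<in>k_subsets (Suc CARD('n)) k. sphere_average (r k) f - f (orbit_point (r k) T))" if "k \<in> J" for k
  proof -
    have "sphere_average (r k) (\<lambda>x. f (?R x)) = sphere_average (r k) f"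
      using r[OF that] f orthogonal_transformation_hyperplane_reflection by (rule sphere_average_orthogonal_transformation)
    then have "(\<Sum>T\<in>k_subsets (Suc CARD('n)) k. sphere_average (r k) (\<lambda>x. f (?R x)) - f (?R (orbit_point (r k) T))) =
      (\<Sum>T\<in>k_subsets (Suc CARD('n)) k. sphere_average (r k) f - f (orbit_point (r k) (swap a b ` T)))"
      using reflection_orbit_point[OF orbit_params(1)[OF that] ab] by (intro sum.cong) auto
    also have "\<dots> = (\<Sum>T\<in>k_subsets (Suc CARD('n)) k. sphere_average (r k) f - f (orbit_point (r k) T))"
      by (rule sum.reindex_bij_betw[OF bij_betw_swap_k_subsets[OF ab(1,2)]])
    finally show ?thesis .
  qed
  then show ?thesis unfolding D moment_defect_def by simp
qed

text \<open>The complement map pairs the orbits of k and m - k through -1, so with equal radii and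
  weights the values of an odd function cancel, within one orbit if k = m - k.\<close>

lemma defect_odd:
  assumes f: "continuous_on UNIV f" "\<And>x. f (- x) = - f x"
    and antipodal: "\<And>k. k \<in> J \<Longrightarrow> Suc CARD('n) - k \<in> J \<and> r (Suc CARD('n) - k) = r k \<and> w (Suc CARD('n) - k) = w k"
  shows "D f = 0"
proof -
  let ?m = "Suc CARD('n)"
  define s where "s k = (\<Sum>T\<in>k_subsets ?m k. f (orbit_point (r k) T))" for k
  have Df: "D f = - (\<Sum>k\<in>J. w k * s k)"
    unfolding D moment_defect_def sum_negf[symmetric] s_def
    by (intro sum.cong refl) (simp add: sphere_average_odd r f sum_negf)
  have s: "s (?m - k) = - s k" if "k \<in> J" for k
  proof -
    have "k \<le> ?m" using that J by auto
    have "s (?m - k) = (\<Sum>T\<in>k_subsets ?m (?m - k). f (orbit_point (r k) T))"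
      using antipodal[OF that] by (simp add: s_def)
    also have "\<dots> = (\<Sum>T\<in>k_subsets ?m k. f (orbit_point (r k) ({1..?m} - T)))"
      by (rule sum.reindex_bij_betw[OF bij_betw_Compl_k_subsets[OF \<open>k \<le> ?m\<close>], symmetric])
    also have "\<dots> = (\<Sum>T\<in>k_subsets ?m k. - f (orbit_point (r k) T))"
      by (intro sum.cong refl) (simp add: orbit_point_Compl[OF orbit_params(1)[OF that]] f del: One_nat_def)
    also have "\<dots> = - s k" by (simp add: s_def sum_negf)
    finally show ?thesis .
  qed
  have bij: "bij_betw (\<lambda>k. ?m - k) J J"
    using antipodal J by (intro bij_betwI[where g = "\<lambda>k. ?m - k"]) auto
  have "(\<Sum>k\<in>J. w k * s k) = (\<Sum>k\<in>J. w (?m - k) * s (?m - k))"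
    by (rule sum.reindex_bij_betw[OF bij, symmetric])
  also have "\<dots> = - (\<Sum>k\<in>J. w k * s k)"
    unfolding sum_negf[symmetric] using antipodal s by (intro sum.cong) auto
  finally show ?thesis using Df by simp
qed

lemma defect_invariant:
  assumes "\<And>k. k \<in> J \<Longrightarrow> sphere_average (r k) f = A k"
    and "\<And>k T. k \<in> J \<Longrightarrow> T \<in> k_subsets (Suc CARD('n)) k \<Longrightarrow> f (orbit_point (r k) T) = B k"
  shows "D f = (\<Sum>k\<in>J. w k * real (Suc CARD('n) choose k) * (A k - B k))"
  unfolding D moment_defect_def using assms by (simp add: card_k_subsets mult.assoc)

section \<open>Power sums of the simplex coordinates on an orbit\<close>

lemma power_sum_orbit_point:
  assumes "T \<subseteq> {1..Suc CARD('n)}" "card T = k" "m = Suc CARD('n)"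
  shows "(\<Sum>a\<in>{1..Suc CARD('n)}. ((orbit_point \<rho> T :: real ^ 'n::{finite,linorder}) \<bullet> simplex_vector a) ^ j) =
    (\<rho> * sqrt (real m / (real k * (real m - real k)))) ^ j *
    (real k * (1 - real k / real m) ^ j + (real m - real k) * (- real k / real m) ^ j)"
proof -
  let ?I = "{1..Suc CARD('n)}" and ?c = "\<rho> * sqrt (real m / (real k * (real m - real k)))"
  have fin: "finite T" using assms finite_subset by blast
  have "(\<Sum>a\<in>?I. ((orbit_point \<rho> T :: (real, 'n) vec) \<bullet> simplex_vector a) ^ j) =
      (\<Sum>a\<in>?I. ?c ^ j * ((if a \<in> T then 1 else 0) - real k / real m) ^ j)"
    by (intro sum.cong refl) (subst orbit_point_inner[OF assms(1) _ assms(2,3)], auto simp: power_mult_distrib)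
  also have "\<dots> = ?c ^ j * ((\<Sum>a\<in>T. (1 - real k / real m) ^ j) + (\<Sum>a\<in>?I - T. (- real k / real m) ^ j))"
    unfolding sum_distrib_left[symmetric]
    by (subst sum.subset_diff[OF assms(1)], simp, simp add: add.commute)
  also have "card (?I - T) = m - k"
    using assms fin by (simp add: card_Diff_subset)
  then have "?c ^ j * ((\<Sum>a\<in>T. (1 - real k / real m) ^ j) + (\<Sum>a\<in>?I - T. (- real k / real m) ^ j)) =
      ?c ^ j * (real k * (1 - real k / real m) ^ j + (real m - real k) * (- real k / real m) ^ j)"
    using assms card_mono[OF _ assms(1)] by (simp add: of_nat_diff del: of_nat_Suc)
  finally show ?thesis .
qed

lemma defect_cubic:
  "D (\<lambda>x. norm x ^ (2 * i) * (\<Sum>a\<in>{1..Suc CARD('n)}. (x \<bullet> simplex_vector a) ^ 3)) =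
    - cubic_moment (Suc CARD('n)) J r w (2 * i + 3) / real (Suc CARD('n))"
proof -
  let ?m = "Suc CARD('n)"
  let ?f = "\<lambda>x :: real ^ 'n::{finite,linorder}. norm x ^ (2 * i) * (\<Sum>a\<in>{1..?m}. (x \<bullet> simplex_vector a) ^ 3)"
  let ?l = "\<lambda>k. sqrt (real ?m / (real k * (real ?m - real k)))"
  let ?B = "\<lambda>k. r k ^ (2 * i + 3) * (?l k * (real ?m - 2 * real k)) / real ?m"
  have "D ?f = (\<Sum>k\<in>J. w k * real (?m choose k) * (0 - ?B k))"
  proof (rule defect_invariant)
    fix k assume k: "k \<in> J"
    show "sphere_average (r k) ?f = 0"
      using r[OF k]
      by (intro sphere_average_odd) (auto intro!: continuous_intros simp: sum_negf simp del: sum.cl_ivl_Suc)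
    fix T assume T: "T \<in> k_subsets ?m k"
    note T' = orbit_params[OF k T]
    define K M where "K = real k" and "M = real ?m"
    have pos: "K > 0" "M > K" using T' by (auto simp: K_def M_def)
    \<comment> \<open>Only \<open>l * l\<close> is rational in K and M; an odd power keeps one
      factor \<open>l\<close>, the root in the cubic moment.\<close>
    define l where "l = ?l k"
    have l2: "l * l = M / (K * (M - K))"
      using pos by (simp add: l_def K_def M_def del: of_nat_Suc)
    have "norm (orbit_point (r k) T :: (real, 'n) vec) = r k"
      using norm_orbit_point[OF T'(1,2)] r[OF k] by simp
    then have "?f (orbit_point (r k) T) =
        r k ^ (2 * i) * ((r k * l) ^ 3 * (K * (1 - K / M) ^ 3 + (M - K) * (- K / M) ^ 3))"
      by (simp only: power_sum_orbit_point[OF T'(1,3) refl] l_def K_def M_def)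
    also have "\<dots> = r k ^ (2 * i + 3) * (l * (l * l) * (K * (1 - K / M) ^ 3 + (M - K) * (- K / M) ^ 3))"
      by (simp add: power_add power_mult_distrib power3_eq_cube)
    also have "l * (l * l) * (K * (1 - K / M) ^ 3 + (M - K) * (- K / M) ^ 3) = l * (M - 2 * K) / M"
      unfolding l2 using pos by (simp add: divide_simps power3_eq_cube) algebra
    finally show "?f (orbit_point (r k) T) = ?B k" by (simp add: l_def K_def M_def del: of_nat_Suc)
  qed
  also have "\<dots> = - cubic_moment ?m J r w (2 * i + 3) / real ?m"
    unfolding cubic_moment_def sum_divide_distrib sum_negf[symmetric]
    by (intro sum.cong refl) (simp del: of_nat_Suc)
  finally show ?thesis .
qed

text \<open>The value on an orbit contains the difference of 1 / (k (m - k)) and 2 / m^2; the second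
  part is a multiple of the cubic moment with p = 5.\<close>

lemma defect_quintic:
  "D (\<lambda>x. \<Sum>a\<in>{1..Suc CARD('n)}. (x \<bullet> simplex_vector a) ^ 5) =
    2 / (real (Suc CARD('n)))\<^sup>2 * cubic_moment (Suc CARD('n)) J r w 5 - quintic_moment (Suc CARD('n)) J r w"
proof -
  let ?m = "Suc CARD('n)"
  let ?f = "\<lambda>x :: real ^ 'n::{finite,linorder}. \<Sum>a\<in>{1..?m}. (x \<bullet> simplex_vector a) ^ 5"
  let ?l = "\<lambda>k. sqrt (real ?m / (real k * (real ?m - real k)))"
  let ?B = "\<lambda>k. r k ^ 5 * (?l k * (real ?m - 2 * real k) * (1 / (real k * (real ?m - real k)) - 2 / (real ?m)\<^sup>2))"
  have "D ?f = (\<Sum>k\<in>J. w k * real (?m choose k) * (0 - ?B k))"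
  proof (rule defect_invariant)
    fix k assume k: "k \<in> J"
    show "sphere_average (r k) ?f = 0"
      using r[OF k]
      by (intro sphere_average_odd) (auto intro!: continuous_intros simp: sum_negf simp del: sum.cl_ivl_Suc)
    fix T assume T: "T \<in> k_subsets ?m k"
    note T' = orbit_params[OF k T]
    define K M where "K = real k" and "M = real ?m"
    have pos: "K > 0" "M > K" using T' by (auto simp: K_def M_def)
    define l where "l = ?l k"
    have l2: "l * l = M / (K * (M - K))"
      using pos by (simp add: l_def K_def M_def del: of_nat_Suc)
    have "?f (orbit_point (r k) T) = (r k * l) ^ 5 * (K * (1 - K / M) ^ 5 + (M - K) * (- K / M) ^ 5)"
      by (simp only: power_sum_orbit_point[OF T'(1,3) refl] l_def K_def M_def)
    also have "\<dots> = r k ^ 5 * (l * ((l * l) * (l * l) * (K * (1 - K / M) ^ 5 + (M - K) * (- K / M) ^ 5)))"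
      by (simp add: power_mult_distrib eval_nat_numeral)
    also have "(l * l) * (l * l) * (K * (1 - K / M) ^ 5 + (M - K) * (- K / M) ^ 5) =
        (M - 2 * K) * (1 / (K * (M - K)) - 2 / M\<^sup>2)"
      unfolding l2 using pos by (simp add: divide_simps eval_nat_numeral) algebra
    finally show "?f (orbit_point (r k) T) = ?B k" by (simp add: l_def K_def M_def mult.assoc del: of_nat_Suc)
  qed
  also have "\<dots> = (\<Sum>k\<in>J. 2 / (real ?m)\<^sup>2 * (w k * real (?m choose k) * r k ^ 5 * (?l k * (real ?m - 2 * real k))) -
      w k * real (?m choose k) * r k ^ 5 * (?l k * (real ?m - 2 * real k) / (real k * (real ?m - real k))))"
    by (intro sum.cong refl) (simp add: right_diff_distrib mult_ac del: of_nat_Suc)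
  also have "\<dots> = 2 / (real ?m)\<^sup>2 * cubic_moment ?m J r w 5 - quintic_moment ?m J r w"
    unfolding cubic_moment_def quintic_moment_def sum_subtractf sum_distrib_left ..
  finally show ?thesis .
qed

lemma defect_quartic:
  "D (\<lambda>x. \<Sum>a\<in>{1..Suc CARD('n)}. (x \<bullet> simplex_vector a) ^ 4) =
    - quartic_moment (Suc CARD('n)) J r w / (real (Suc CARD('n)) + 1)"
proof -
  let ?u = "simplex_vector :: nat \<Rightarrow> (real, 'n) vec"
  let ?m = "Suc CARD('n)"
  let ?f = "\<lambda>x :: real ^ 'n::{finite,linorder}. \<Sum>a\<in>{1..?m}. (x \<bullet> simplex_vector a) ^ 4"
  define M where "M = real ?m"
  have N: "real CARD('n) = M - 1" and M: "M > 1" by (simp_all add: M_def)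
  let ?A = "\<lambda>k. r k ^ 4 * (3 * (M - 1) / (M * (M + 1)))"
  let ?B = "\<lambda>k. r k ^ 4 * ((M\<^sup>2 - 3 * (real k * (M - real k))) / (M * (real k * (M - real k))))"
  have "D ?f = (\<Sum>k\<in>J. w k * real (?m choose k) * (?A k - ?B k))"
  proof (rule defect_invariant)
    fix k assume k: "k \<in> J"
    \<comment> \<open>Each simplex vector has squared length (m - 1) / m, the input to the
      fourth-moment formula of the sphere.\<close>
    have u: "norm (?u a) ^ 4 = ((M - 1) / M)\<^sup>2" if "a \<in> {1..?m}" for a
    proof -
      have "norm (?u a) ^ 4 = ((norm (?u a))\<^sup>2)\<^sup>2"
        by simp
      also have "(norm (?u a))\<^sup>2 = (M - 1) / M"
        using simplex_vector_inner[OF that that] M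
        by (simp add: power2_norm_eq_inner M_def[symmetric] diff_divide_distrib del: of_nat_Suc)
      finally show ?thesis .
    qed
    have "sphere_average (r k) ?f = (\<Sum>a\<in>{1..?m}. 3 * r k ^ 4 * ((M - 1) / M)\<^sup>2 / ((M - 1) * (M + 1)))"
      using r[OF k] by (subst sphere_average_sum)
        (auto intro!: continuous_intros sum.cong simp: sphere_average_inner_power4 u N simp del: of_nat_Suc sum.cl_ivl_Suc)
    also have "\<dots> = M * (3 * r k ^ 4 * ((M - 1) / M)\<^sup>2 / ((M - 1) * (M + 1)))"
      by (simp add: M_def)
    also have "\<dots> = ?A k"
      using M by (simp add: divide_simps power2_eq_square)
    finally show "sphere_average (r k) ?f = ?A k" .
    fix T assume T: "T \<in> k_subsets ?m k"
    note T' = orbit_params[OF k T]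
    define K where "K = real k"
    have pos: "K > 0" "M > K" using T' by (auto simp: K_def M_def)
    define l where "l = sqrt (M / (K * (M - K)))"
    have l2: "l * l = M / (K * (M - K))"
      using pos by (simp add: l_def)
    have "?f (orbit_point (r k) T) = (r k * l) ^ 4 * (K * (1 - K / M) ^ 4 + (M - K) * (- K / M) ^ 4)"
      by (simp only: power_sum_orbit_point[OF T'(1,3) refl] l_def K_def M_def)
    also have "\<dots> = r k ^ 4 * ((l * l) * (l * l) * (K * (1 - K / M) ^ 4 + (M - K) * (- K / M) ^ 4))"
      by (simp add: power_mult_distrib power4_eq_xxxx)
    also have "(l * l) * (l * l) * (K * (1 - K / M) ^ 4 + (M - K) * (- K / M) ^ 4) = (M\<^sup>2 - 3 * (K * (M - K))) / (M * (K * (M - K)))"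
      unfolding l2 using pos by (simp add: divide_simps power4_eq_xxxx power2_eq_square) algebra
    finally show "?f (orbit_point (r k) T) = ?B k" by (simp add: K_def)
  qed
  also have "\<dots> = - quartic_moment ?m J r w / (M + 1)"
    unfolding quartic_moment_def sum_divide_distrib sum_negf[symmetric]
  proof (intro sum.cong refl)
    fix k assume k: "k \<in> J"
    define K where "K = real k"
    have pos: "K > 0" "M > K" using k J by (auto simp: K_def M_def)
    have "?A k - ?B k = - (r k ^ 4 * ((M * (M + 1) - 6 * (K * (M - K))) / (K * (M - K))) / (M + 1))"
      using pos unfolding K_def[symmetric] by (simp add: divide_simps power2_eq_square) algebra
    then show "w k * real (?m choose k) * (?A k - ?B k) =
        - (w k * real (?m choose k) * r k ^ 4 *
          ((real ?m * (real ?m + 1) - 6 * (real k * (real ?m - real k))) / (real k * (real ?m - real k)))) / (M + 1)"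
      unfolding M_def[symmetric] K_def[symmetric] by simp
  qed
  finally show ?thesis by (simp add: M_def)
qed

section \<open>Reduction from products of simplex coordinates to power sums\<close>

definition frame_defect :: "nat list \<Rightarrow> real" where
  "frame_defect as = D (frame_monomial simplex_vector as)"

lemma frame_monomial_continuous: "continuous_on UNIV (frame_monomial u as)"
  using frame_monomial_Poly_le by (rule Poly_le_continuous)

lemma frame_defect_mset: "mset as = mset bs \<Longrightarrow> frame_defect as = frame_defect bs"
  unfolding frame_defect_def frame_monomial_def by (metis mset_map prod_mset_prod_list)

lemma frame_defect_swap:
  assumes "set as \<subseteq> {1..Suc CARD('n)}" and ab: "a \<in> {1..Suc CARD('n)}" "b \<in> {1..Suc CARD('n)}"
  shows "frame_defect (map (swap a b) as) = frame_defect as"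
proof (cases "a = b")
  case False
  let ?u = "simplex_vector :: nat \<Rightarrow> real ^ 'n::{finite,linorder}"
  let ?R = "hyperplane_reflection (?u a - ?u b)"
  have "?R x \<bullet> ?u c = x \<bullet> ?u (swap a b c)" if "c \<in> {1..Suc CARD('n)}" for x c
  proof -
    have "?R x \<bullet> ?u c = ?R (?R x) \<bullet> ?R (?u c)"
      using orthogonal_transformation_hyperplane_reflection[of "?u a - ?u b"]
      by (simp add: orthogonal_transformation_def)
    moreover have "?R (?u c) = ?u (swap a b c)"
      using reflection_simplex_face_sum[where 'n = 'n, of "{c}" a b] that ab False by (simp add: simplex_face_sum_def)
    ultimately show ?thesis by (simp add: hyperplane_reflection_involution)
  qed
  then have "frame_monomial ?u as (?R x) = frame_monomial ?u (map (swap a b) as) x" for x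
    using assms(1) by (induction as) (simp_all add: Transposition.transpose_def)
  then show ?thesis
    unfolding frame_defect_def
    using defect_reflection[OF frame_monomial_continuous ab False, of simplex_vector as] by presburger
qed simp

lemma sum_frame_defect: "(\<Sum>d\<in>{1..Suc CARD('n)}. frame_defect (d # as)) = 0"
proof -
  have "(\<Sum>d\<in>{1..Suc CARD('n)}. frame_defect (d # as)) =
      D (\<lambda>x. \<Sum>d\<in>{1..Suc CARD('n)}. frame_monomial simplex_vector (d # as) x)"
    unfolding frame_defect_def by (rule defect_sum[symmetric]) (rule frame_monomial_continuous)
  also have "(\<lambda>x :: real ^ 'n::{finite,linorder}. \<Sum>d\<in>{1..Suc CARD('n)}. frame_monomial simplex_vector (d # as) x) = (\<lambda>x. 0)"
    unfolding frame_monomial_simps sum_distrib_right[symmetric] inner_sum_right[symmetric] sum_simplex_vector by simp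
  also have "D (\<lambda>x. 0) = 0" using defect_norm[of "\<lambda>_. 0"] .
  finally show ?thesis .
qed

lemma sum_inner_simplex_vector_power2: "(\<Sum>a\<in>{1..Suc CARD('n)}. (x \<bullet> simplex_vector a)\<^sup>2) = norm (x :: real ^ 'n::{finite,linorder}) ^ 2"
proof -
  have "x \<bullet> x = x \<bullet> (\<Sum>a=1..Suc CARD('n). (x \<bullet> simplex_vector a) *\<^sub>R simplex_vector a)"
    using simplex_vector_frame[of x] by simp
  then show ?thesis
    by (simp only: power2_norm_eq_inner) (simp add: inner_sum_right power2_eq_square del: sum.cl_ivl_Suc)
qed

text \<open>Letters outside \<open>as\<close> are interchangeable by swaps fixing \<open>as\<close>.
  Since the sum over the first letter vanishes, only the lists repeating a letter of
  \<open>as\<close> remain to be checked.\<close>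

lemma frame_defect_Cons_eq_0:
  assumes as: "set as \<subseteq> {1..Suc CARD('n)}" and zero: "\<And>d. d \<in> set as \<Longrightarrow> frame_defect (d # as) = 0"
    and d: "d \<in> {1..Suc CARD('n)}"
  shows "frame_defect (d # as) = 0"
proof (rule sum_vanishing_off_constant[OF _ sum_frame_defect _ _ d, of "set as"])
  fix d d' assume d: "d \<in> {1..Suc CARD('n)} - set as" "d' \<in> {1..Suc CARD('n)} - set as"
  have "map (swap d d') as = as"
    using d by (intro map_idI) (auto simp: Transposition.transpose_def)
  then have "map (swap d d') (d # as) = d' # as" by simp
  then show "frame_defect (d # as) = frame_defect (d' # as)"
    using frame_defect_swap[of "d # as" d d'] as d by simp
qed (use zero in auto)

text \<open>By symmetry all pure powers of one degree have the same defect, so each inherits the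
  vanishing of their sum.\<close>

lemma frame_defect_replicate_eq_0:
  assumes "D (\<lambda>x. \<Sum>a\<in>{1..Suc CARD('n)}. (x \<bullet> simplex_vector a) ^ l) = 0" "a \<in> {1..Suc CARD('n)}"
  shows "frame_defect (replicate l a) = 0"
proof (rule sum_vanishing_off_constant[OF _ _ _ _ assms(2), of _ "{}"])
  have pow: "frame_monomial simplex_vector (replicate l a) = (\<lambda>x :: real ^ 'n::{finite,linorder}. (x \<bullet> simplex_vector a) ^ l)" for a
    by (simp add: frame_monomial_def prod_list_replicate)
  show "(\<Sum>a\<in>{1..Suc CARD('n)}. frame_defect (replicate l a)) = 0"
    unfolding frame_defect_def pow using assms(1)
    by (subst defect_sum[symmetric]) (auto intro!: continuous_intros simp del: sum.cl_ivl_Suc)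
  fix d d' assume "d \<in> {1..Suc CARD('n)} - {}" "d' \<in> {1..Suc CARD('n)} - {}"
  then show "frame_defect (replicate l d) = frame_defect (replicate l d')"
    using frame_defect_swap[of "replicate l d" d d'] by (auto simp: set_replicate_conv_if)
qed auto

lemma frame_defect_1: "a \<in> {1..Suc CARD('n)} \<Longrightarrow> frame_defect [a] = 0"
  by (rule frame_defect_Cons_eq_0) auto

lemma frame_defect_2:
  assumes ab: "a \<in> {1..Suc CARD('n)}" "b \<in> {1..Suc CARD('n)}"
  shows "frame_defect [a, b] = 0"
proof (rule frame_defect_Cons_eq_0[OF _ _ ab(1)])
  have "frame_defect (replicate 2 b) = 0"
    by (rule frame_defect_replicate_eq_0[OF _ ab(2)]) (simp only: sum_inner_simplex_vector_power2 defect_norm[of "\<lambda>s. s\<^sup>2"])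
  then show "frame_defect [d, b] = 0" if "d \<in> set [b]" for d
    using that by (simp add: numeral_2_eq_2)
qed (use ab in auto)

text \<open>The patterns are settled in the order aaa, abb, abc, each following from the previous
  one by \<open>frame_defect_Cons_eq_0\<close>.\<close>

lemma frame_defect_3:
  assumes cube: "\<And>a. a \<in> {1..Suc CARD('n)} \<Longrightarrow> frame_defect [a, a, a] = 0"
    and abc: "a \<in> {1..Suc CARD('n)}" "b \<in> {1..Suc CARD('n)}" "c \<in> {1..Suc CARD('n)}"
  shows "frame_defect [a, b, c] = 0"
proof -
  have aab: "frame_defect [d, a, a] = 0" if "d \<in> {1..Suc CARD('n)}" "a \<in> {1..Suc CARD('n)}" for d a
    by (rule frame_defect_Cons_eq_0) (use that cube in auto)
  show ?thesis
  proof (rule frame_defect_Cons_eq_0[OF _ _ abc(1)])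
    fix d assume "d \<in> set [b, c]"
    then have "mset [d, b, c] = mset (if d = b then [c, b, b] else [b, c, c])" by auto
    from frame_defect_mset[OF this] show "frame_defect [d, b, c] = 0" using aab abc by (simp split: if_splits)
  qed (use abc in auto)
qed

text \<open>The pattern aabb is the obstacle: putting a repeated letter in front of abb leads back
  to aabb itself. A second relation helps, that the squared coordinates sum to norm x ^ 2. After
  that, the patterns with three and four different letters follow as in degree three.\<close>

lemma frame_defect_4:
  assumes quart: "\<And>a. a \<in> {1..Suc CARD('n)} \<Longrightarrow> frame_defect [a, a, a, a] = 0"
    and abcd: "a \<in> {1..Suc CARD('n)}" "b \<in> {1..Suc CARD('n)}" "c \<in> {1..Suc CARD('n)}" "d \<in> {1..Suc CARD('n)}"
  shows "frame_defect [a, b, c, d] = 0"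
proof -
  let ?I = "{1..Suc CARD('n)}"
  have abbb: "frame_defect [a, b, b, b] = 0" if "a \<in> ?I" "b \<in> ?I" for a b
    by (rule frame_defect_Cons_eq_0) (use that quart in auto)
  have radial: "(\<Sum>a\<in>?I. frame_defect [a, a, b, b]) = D (\<lambda>x. norm x ^ 2 * (x \<bullet> simplex_vector b)\<^sup>2)" for b
  proof -
    have "(\<Sum>a\<in>?I. frame_defect [a, a, b, b]) = D (\<lambda>x. \<Sum>a\<in>?I. frame_monomial simplex_vector [a, a, b, b] x)"
      unfolding frame_defect_def by (rule defect_sum[symmetric]) (rule frame_monomial_continuous)
    also have "(\<lambda>x :: real ^ 'n::{finite,linorder}. \<Sum>a\<in>?I. frame_monomial simplex_vector [a, a, b, b] x) =
        (\<lambda>x. norm x ^ 2 * (x \<bullet> simplex_vector b)\<^sup>2)"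
      unfolding sum_inner_simplex_vector_power2[symmetric] sum_distrib_right
      by (intro ext sum.cong refl) (simp add: power2_eq_square)
    finally show ?thesis .
  qed
  \<comment> \<open>Summed over b this function becomes radial, and by symmetry its defect is the
    same for every b.\<close>
  have "D (\<lambda>x. norm x ^ 2 * (x \<bullet> simplex_vector b)\<^sup>2) = 0" if "b \<in> ?I" for b
  proof (rule sum_vanishing_off_constant[OF _ _ _ _ that, of _ "{}"])
    have "(\<Sum>b\<in>?I. D (\<lambda>x. norm x ^ 2 * (x \<bullet> simplex_vector b)\<^sup>2)) =
        D (\<lambda>x. \<Sum>b\<in>?I. norm x ^ 2 * (x \<bullet> simplex_vector b)\<^sup>2)"
      by (rule defect_sum[symmetric]) (intro continuous_intros)
    also have "\<dots> = D (\<lambda>x. norm x ^ 2 * norm x ^ 2)"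
      unfolding sum_distrib_left[symmetric] sum_inner_simplex_vector_power2 ..
    also have "\<dots> = 0" using defect_norm[of "\<lambda>s. s ^ 2 * s ^ 2"] .
    finally show "(\<Sum>b\<in>?I. D (\<lambda>x. norm x ^ 2 * (x \<bullet> simplex_vector b)\<^sup>2)) = 0" .
    fix e e' assume e: "e \<in> ?I - {}" "e' \<in> ?I - {}"
    have "(\<Sum>a\<in>?I. frame_defect [a, a, e, e]) = (\<Sum>a\<in>?I. frame_defect (map (swap e e') [a, a, e, e]))"
      using e by (intro sum.cong refl frame_defect_swap[symmetric]) auto
    also have "\<dots> = (\<Sum>a\<in>?I. (\<lambda>a. frame_defect [a, a, e', e']) (swap e e' a))"
      by simp
    also have "\<dots> = (\<Sum>a\<in>?I. frame_defect [a, a, e', e'])"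
    proof (rule sum.reindex_bij_betw)
      have "swap e e' ` ?I \<subseteq> ?I" using e by (intro swap_image_subset) auto
      then show "bij_betw (swap e e') ?I ?I"
        by (intro bij_betwI[where g = "swap e e'"]) auto
    qed
    finally show "D (\<lambda>x. norm x ^ 2 * (x \<bullet> simplex_vector e)\<^sup>2) = D (\<lambda>x. norm x ^ 2 * (x \<bullet> simplex_vector e')\<^sup>2)"
      unfolding radial .
  qed auto
  then have radial0: "(\<Sum>a\<in>?I. frame_defect [a, a, b, b]) = 0" if "b \<in> ?I" for b
    using radial that by simp
  have aabb: "frame_defect [a, a, b, b] = 0" if "a \<in> ?I" "b \<in> ?I" for a b
  proof (rule sum_vanishing_off_constant[OF _ radial0[OF that(2)] _ _ that(1), of "{b}"])
    fix e e' assume e: "e \<in> ?I - {b}" "e' \<in> ?I - {b}"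
    then have "map (swap e e') [e, e, b, b] = [e', e', b, b]"
      by (auto simp: Transposition.transpose_def)
    then show "frame_defect [e, e, b, b] = frame_defect [e', e', b, b]"
      using frame_defect_swap[of "[e, e, b, b]" e e'] e that by simp
  qed (use quart in auto)
  have aabc: "frame_defect [e, a, a, b] = 0" if "e \<in> ?I" "a \<in> ?I" "b \<in> ?I" for e a b
  proof (rule frame_defect_Cons_eq_0[OF _ _ that(1)])
    fix e assume "e \<in> set [a, a, b]"
    then have "mset [e, a, a, b] = mset (if e = a then [b, a, a, a] else [a, a, b, b])" by auto
    from frame_defect_mset[OF this] show "frame_defect [e, a, a, b] = 0"
      using abbb aabb that by (simp split: if_splits)
  qed (use that in auto)
  show ?thesis
  proof (rule frame_defect_Cons_eq_0[OF _ _ abcd(1)])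
    fix e assume "e \<in> set [b, c, d]"
    then have "mset [e, b, c, d] = mset (if e = b then [c, b, b, d] else if e = c then [b, c, c, d] else [b, d, d, c])"
      by auto
    from frame_defect_mset[OF this] show "frame_defect [e, b, c, d] = 0"
      using aabc abcd by (simp split: if_splits)
  qed (use abcd in auto)
qed

lemma defect_Poly_le_eq_0:
  assumes "\<And>as. set as \<subseteq> {1..Suc CARD('n)} \<Longrightarrow> length as \<le> t \<Longrightarrow> as \<noteq> [] \<Longrightarrow> frame_defect as = 0" "f \<in> Poly_le t"
  shows "D f = 0"
proof (rule defect_span[OF assms(2)[unfolded Poly_le_eq]])
  fix g :: "real ^ 'n::{finite,linorder} \<Rightarrow> real" assume "g \<in> {list_monomial is |is. length is \<le> t}"
  then obtain "is" where g: "g = list_monomial is" "length is \<le> t" by blast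
  have "D g = 0"
    unfolding g(1)
  proof (rule defect_span[OF list_monomial_in_span_frame_monomial[OF simplex_vector_frame]])
    fix h :: "(real, 'n) vec \<Rightarrow> real"
    assume "h \<in> {frame_monomial simplex_vector as |as. set as \<subseteq> {1..Suc CARD('n)} \<and> length as = length is}"
    then obtain as where h: "h = frame_monomial simplex_vector as" "set as \<subseteq> {1..Suc CARD('n)}" "length as = length is"
      by blast
    have "frame_defect as = 0"
    proof (cases "as = []")
      case True
      then show ?thesis
        using defect_norm[of "\<lambda>_. 1"] by (simp add: frame_defect_def frame_monomial_def)
    qed (use assms(1)[of as] h g in simp)
    then show "continuous_on UNIV h \<and> D h = 0"
      using h frame_monomial_continuous by (simp add: frame_defect_def)
  qed
  moreover have "g \<in> Poly_le t" unfolding Poly_le_eq using g by (intro funs.span_base) auto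
  ultimately show "continuous_on UNIV g \<and> D g = 0" using Poly_le_continuous by blast
qed

text \<open>The first power sum is zero and the second is radial, so degrees one and two impose
  nothing. The other two conditions are asked only when t reaches them, which lets one lemma serve t
  = 2, 3 and 4.\<close>

lemma design_le_4_sufficient:
  assumes "t \<le> 4" "f \<in> Poly_le t"
    and cubic: "3 \<le> t \<Longrightarrow> cubic_moment (Suc CARD('n)) J r w 3 = 0"
    and quartic: "4 \<le> t \<Longrightarrow> quartic_moment (Suc CARD('n)) J r w = 0"
  shows "D f = 0"
proof (rule defect_Poly_le_eq_0[OF _ assms(2)])
  fix as assume as: "set as \<subseteq> {1..Suc CARD('n)}" "length as \<le> t" "as \<noteq> []"
  have cube: "frame_defect [a, a, a] = 0" if "3 \<le> t" "a \<in> {1..Suc CARD('n)}" for a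
    using frame_defect_replicate_eq_0[of 3 a] defect_cubic[of 0] cubic that by (simp add: numeral_3_eq_3)
  have quart: "frame_defect [a, a, a, a] = 0" if "4 \<le> t" "a \<in> {1..Suc CARD('n)}" for a
    using frame_defect_replicate_eq_0[of 4 a] defect_quartic quartic that by (simp add: eval_nat_numeral)
  have "length as \<noteq> 0" "length as \<le> 4" using as \<open>t \<le> 4\<close> by auto
  then consider "length as = 1" | "length as = 2" | "length as = 3" | "length as = 4" by linarith
  then show "frame_defect as = 0"
  proof cases
    case 1
    then obtain a where "as = [a]" by (auto simp: length_Suc_conv)
    then show ?thesis using frame_defect_1 as by simp
  next
    case 2
    then obtain a b where "as = [a, b]" by (auto simp: length_Suc_conv numeral_2_eq_2)
    then show ?thesis using frame_defect_2 as by simp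
  next
    case 3
    then obtain a b c where "as = [a, b, c]" by (auto simp: length_Suc_conv numeral_3_eq_3)
    then show ?thesis using frame_defect_3 cube as by simp
  next
    case 4
    then obtain a b c d where "as = [a, b, c, d]" by (auto simp: length_Suc_conv eval_nat_numeral)
    then show ?thesis using frame_defect_4 quart as by simp
  qed
qed

text \<open>Products of odd length, five included, vanish by antipodality; even lengths are at most
  four, where the degree-four criterion applies.\<close>

lemma design_5_sufficient:
  assumes antipodal: "\<And>k. k \<in> J \<Longrightarrow> Suc CARD('n) - k \<in> J \<and> r (Suc CARD('n) - k) = r k \<and> w (Suc CARD('n) - k) = w k"
    and quartic: "quartic_moment (Suc CARD('n)) J r w = 0" and f: "f \<in> Poly_le 5"
  shows "D f = 0"
proof (rule defect_Poly_le_eq_0[OF _ f])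
  fix as assume as: "set as \<subseteq> {1..Suc CARD('n)}" "length as \<le> 5" "as \<noteq> []"
  show "frame_defect as = 0"
  proof (cases "odd (length as)")
    case True
    have "frame_monomial simplex_vector as (- x) = (- 1) ^ length as * frame_monomial simplex_vector as x" for x :: "real ^ 'n::{finite,linorder}"
      by (induction as) simp_all
    then show ?thesis
      unfolding frame_defect_def using True antipodal by (intro defect_odd frame_monomial_continuous) simp_all
  next
    case False
    then have le: "length as \<le> 4" using as(2) by presburger
    \<comment> \<open>The degree-four criterion also asks for the cubic moment, which antipodality
      supplies.\<close>
    have odd: "D (\<lambda>x. \<Sum>a\<in>{1..Suc CARD('n)}. (x \<bullet> simplex_vector a) ^ 3) = 0"
      using antipodal by (intro defect_odd) (auto intro!: continuous_intros simp: sum_negf simp del: sum.cl_ivl_Suc)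
    then have cubic: "cubic_moment (Suc CARD('n)) J r w 3 = 0"
      using defect_cubic[of 0] by (simp del: sum.cl_ivl_Suc of_nat_Suc)
    show ?thesis unfolding frame_defect_def
      using frame_monomial_Poly_le[THEN Poly_le_mono, OF le] cubic quartic by (intro design_le_4_sufficient[of 4]) auto
  qed
qed

text \<open>The test polynomial is norm x ^ (2 i) times the third power sum; i = 1 yields one of the
  two odd conditions of degree five.\<close>

lemma cubic_moment_necessary:
  assumes "\<forall>f\<in>Poly_le t. D f = 0" "2 * i + 3 \<le> t"
  shows "cubic_moment (Suc CARD('n)) J r w (2 * i + 3) = 0"
proof -
  let ?p = "\<lambda>x :: real ^ 'n::{finite,linorder}. \<Sum>a\<in>{1..Suc CARD('n)}. (x \<bullet> simplex_vector a) ^ 3"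
  have "(\<lambda>x. norm x ^ (2 * i) * ?p x) \<in> Poly_le (2 * i + 3)"
  proof (induction i)
    case 0
    show ?case by (simp only: mult_0_right power_0 mult_1 add_0) (intro Poly_le_sum Poly_le_inner_power)
  next
    case (Suc i)
    from Poly_le_norm_mult[OF this] show ?case by (simp add: power_add mult.assoc power2_eq_square)
  qed
  then have "D (\<lambda>x. norm x ^ (2 * i) * ?p x) = 0"
    using assms Poly_le_mono by blast
  then show ?thesis using defect_cubic[of i] by (simp del: sum.cl_ivl_Suc of_nat_Suc)
qed

lemma quintic_moment_necessary:
  assumes "\<forall>f\<in>Poly_le t. D f = 0" "5 \<le> t"
  shows "quintic_moment (Suc CARD('n)) J r w = 0"
proof -
  have "(\<lambda>x :: real ^ 'n::{finite,linorder}. \<Sum>a\<in>{1..Suc CARD('n)}. (x \<bullet> simplex_vector a) ^ 5) \<in> Poly_le 5"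
    by (intro Poly_le_sum Poly_le_inner_power)
  then have "D (\<lambda>x. \<Sum>a\<in>{1..Suc CARD('n)}. (x \<bullet> simplex_vector a) ^ 5) = 0"
    using assms Poly_le_mono by blast
  then show ?thesis
    using defect_quintic cubic_moment_necessary[OF assms(1), of 1] assms(2) by (simp del: sum.cl_ivl_Suc)
qed

text \<open>Every point of an orbit has only two distinct simplex coordinates, hence two equal ones
  among the first three.\<close>

lemma no_6_design:
  assumes n: "CARD('n) \<ge> 2" and J0: "J \<noteq> {}" and w: "\<And>k. k \<in> J \<Longrightarrow> w k > 0"
    and design: "\<forall>f\<in>Poly_le t. D f = 0" and t: "6 \<le> t"
  shows False
proof -
  let ?u = "simplex_vector :: nat \<Rightarrow> real ^ 'n::{finite,linorder}"
  define g where "g x = ((x \<bullet> (?u 1 - ?u 2)) * ((x \<bullet> (?u 2 - ?u 3)) * (x \<bullet> (?u 1 - ?u 3))))" for x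
  define f where "f x = (g x)\<^sup>2" for x
  let ?a = "\<lambda>x. x \<bullet> (?u 1 - ?u 2)" and ?b = "\<lambda>x. x \<bullet> (?u 2 - ?u 3)" and ?c = "\<lambda>x. x \<bullet> (?u 1 - ?u 3)"
  have "f = (\<lambda>x. ?a x * (?b x * (?c x * (?a x * (?b x * (?c x * 1))))))"
    by (simp add: fun_eq_iff f_def g_def power2_eq_square mult_ac)
  also have "\<dots> \<in> Poly_le (Suc (Suc (Suc (Suc (Suc (Suc 0))))))"
    by (intro Poly_le_inner_mult Poly_le_const)
  finally have "f \<in> Poly_le (Suc (Suc (Suc (Suc (Suc (Suc 0))))))" .
  then have "f \<in> Poly_le 6" by (simp add: eval_nat_numeral)
  then have "D f = 0" using design t Poly_le_mono by blast
  have cont: "continuous_on UNIV f" unfolding f_def g_def by (intro continuous_intros)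
  have van: "f (orbit_point (r k) T) = 0" if "k \<in> J" "T \<in> k_subsets (Suc CARD('n)) k" for k T
  proof -
    have "1 \<in> {1..Suc CARD('n)}" "2 \<in> {1..Suc CARD('n)}" "3 \<in> {1..Suc CARD('n)}" using n by auto
    then have "g (orbit_point (r k) T) = 0"
      unfolding g_def inner_diff_right
      by (simp only: orbit_point_inner[OF orbit_params(1)[OF that] _ refl refl]) auto
    then show ?thesis by (simp add: f_def)
  qed
  \<comment> \<open>A vector whose first three simplex coordinates differ, so that the product of
    differences is nonzero; its multiples meet every sphere.\<close>
  define y where "y = ?u 1 + 2 *\<^sub>R ?u 2"
  have y: "y \<bullet> ?u 1 - y \<bullet> ?u 2 = -1" "y \<bullet> ?u 2 - y \<bullet> ?u 3 = 2" "y \<bullet> ?u 1 - y \<bullet> ?u 3 = 1"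
    using n by (simp_all add: y_def inner_add_left simplex_vector_inner)
  have "y \<noteq> 0" using y(1) by auto
  have avg: "sphere_average (r k) f > 0" if "k \<in> J" for k
  proof (rule sphere_average_pos[OF r[OF that] cont])
    show "norm ((r k / norm y) *\<^sub>R y) = r k" using \<open>y \<noteq> 0\<close> r[OF that] by simp
    show "f ((r k / norm y) *\<^sub>R y) \<noteq> 0"
      using \<open>y \<noteq> 0\<close> r[OF that] y by (simp add: f_def g_def inner_diff_right right_diff_distrib[symmetric])
  qed (simp add: f_def)
  have "D f = (\<Sum>k\<in>J. w k * real (Suc CARD('n) choose k) * (sphere_average (r k) f - 0))"
    by (rule defect_invariant) (use van in auto)
  also have "\<dots> > 0"
    using J finite_subset[OF J] J0 w avg
    by (intro sum_pos) (auto simp: zero_less_binomial_iff intro!: mult_pos_pos)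
  finally show False using \<open>D f = 0\<close> by simp
qed

lemma quartic_moment_necessary:
  assumes "\<forall>f\<in>Poly_le t. D f = 0" "4 \<le> t"
  shows "quartic_moment (Suc CARD('n)) J r w = 0"
proof -
  have "(\<lambda>x :: real ^ 'n::{finite,linorder}. \<Sum>a\<in>{1..Suc CARD('n)}. (x \<bullet> simplex_vector a) ^ 4) \<in> Poly_le 4"
    by (intro Poly_le_sum Poly_le_inner_power)
  then have "D (\<lambda>x. \<Sum>a\<in>{1..Suc CARD('n)}. (x \<bullet> simplex_vector a) ^ 4) = 0"
    using assms Poly_le_mono by blast
  then show ?thesis using defect_quartic by (simp add: add_nonneg_eq_0_iff del: sum.cl_ivl_Suc)
qed

end

text \<open>In degree at most two the dimensions depend on the radii only through whether they all
  coincide.\<close>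

lemma design_bound_A_union:
  fixes X :: "(real ^ 'n::{finite,linorder}) set"
  assumes J: "J \<subseteq> {1..CARD('n)}" "J \<noteq> {}" and r: "\<And>k. k \<in> J \<Longrightarrow> r k > 0" and X: "X = A_union J r"
  shows "design_bound 1 X = 2"
    and "design_bound 2 X = CARD('n) + 1"
    and "design_bound 3 X = 2 * CARD('n)"
    and "design_bound 4 X = (if \<forall>k\<in>J. \<forall>l\<in>J. r k = r l then CARD('n) * (CARD('n) + 3) div 2
      else (CARD('n) + 1) * (CARD('n) + 2) div 2)" (is ?four)
    and "design_bound 5 X = (if \<forall>k\<in>J. \<forall>l\<in>J. r k = r l then CARD('n) * (CARD('n) + 1)
      else CARD('n) * (CARD('n) + 1) + 2)" (is ?five)
proof -
  have norms: "norm ` X = r ` J" unfolding X by (rule sum_A_union(4)[OF J(1) r])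
  \<comment> \<open>All radii are positive, so the special bound for designs containing the origin
    does not arise.\<close>
  have "0 \<notin> X"
  proof
    assume "0 \<in> X"
    then have "norm (0 :: (real, 'n) vec) \<in> r ` J" using norms by blast
    then show False using r by force
  qed
  obtain k where k: "k \<in> J" using J by blast
  have S: "supp_spheres X = (\<Union>k\<in>J. sphere 0 (r k))" by (simp add: supp_spheres_def norms)
  have sub: "sphere 0 (r l) \<subseteq> supp_spheres X" if "l \<in> J" for l using S that by auto
  show "design_bound 1 X = 2"
    using \<open>0 \<notin> X\<close> dim_P_star_space_0[OF r[OF k] sub[OF k]] by (simp add: design_bound_def)
  show "design_bound 2 X = CARD('n) + 1"
    using dim_P_space_1[OF r[OF k] sub[OF k]] by (simp add: design_bound_def)
  show "design_bound 3 X = 2 * CARD('n)"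
    using dim_P_star_space_1[OF r[OF k] sub[OF k]] \<open>0 \<notin> X\<close> by (simp add: design_bound_def Let_def)
  have even: "even (CARD('n) * (CARD('n) + 1))" by simp
  have "?four \<and> ?five"
  proof (cases "\<forall>k\<in>J. \<forall>l\<in>J. r k = r l")
    case True
    have rl: "r l = r k" if "l \<in> J" for l using True k that by blast
    have "supp_spheres X = sphere 0 (r k)" unfolding S using J(2) by (simp add: rl cong: SUP_cong)
    then show ?thesis
      unfolding if_P[OF True]
      using dim_P_space_2_sphere[OF r[OF k], where 'n = 'n] dim_P_star_space_2_sphere[OF r[OF k], where 'n = 'n] \<open>0 \<notin> X\<close> even
      by (simp add: design_bound_def Let_def)
  next
    case False
    then obtain i l where il: "i \<in> J" "l \<in> J" "r l \<noteq> r i" by metis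
    show ?thesis
      unfolding if_not_P[OF False]
      using dim_P_space_2_multiple[OF r[OF il(1)] sub[OF il(1)] r[OF il(2)] il(3) sub[OF il(2)]]
        dim_P_star_space_2_multiple[OF r[OF il(1)] sub[OF il(1)] r[OF il(2)] il(3) sub[OF il(2)]] \<open>0 \<notin> X\<close> even
      by (simp add: design_bound_def Let_def)
  qed
  then show ?four ?five by blast+
qed

section \<open>Classification\<close>

lemma choose_le_sum:
  fixes J :: "nat set"
  assumes "J \<subseteq> {1..<m}" "k \<in> J"
  shows "m choose k \<le> (\<Sum>k\<in>J. m choose k)"
  using assms finite_subset[OF assms(1)] by (intro member_le_sum) auto

lemma choose_le_choose:
  fixes k m :: nat
  assumes "a \<le> k" "k \<le> m - a"
  shows "m choose a \<le> m choose k"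
proof (cases "2 * k \<le> m")
  case True
  then show ?thesis using assms by (intro binomial_mono) auto
next
  case False
  have "m choose a \<le> m choose (m - k)"
    using assms False by (intro binomial_mono) auto
  then show ?thesis using binomial_symmetric[of k m] assms by simp
qed

lemma six_choose_3: "6 * (m choose 3) = m * ((m - 1) * (m - 2))"
proof -
  have "3 * (m choose 3) = m * ((m - 1) choose 2)" "2 * ((m - 1) choose 2) = (m - 1) * (m - 2)"
    using binomial_absorption[of 2 m] binomial_absorption[of 1 "m - 1"] by (simp_all add: eval_nat_numeral)
  then have "2 * (3 * (m choose 3)) = m * ((m - 1) * (m - 2))" by simp
  then show ?thesis by simp
qed

lemma two_choose_2: "2 * (m choose 2) = m * (m - 1)"
  using binomial_absorption[of 1 m] by (simp add: numeral_2_eq_2)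

section \<open>Sign and elimination arguments for the moments\<close>

context
  fixes m :: nat and J :: "nat set" and r w :: "nat \<Rightarrow> real"
  assumes J: "J \<subseteq> {1..<m}"
    and r: "\<And>k. k \<in> J \<Longrightarrow> r k > 0" and w: "\<And>k. k \<in> J \<Longrightarrow> w k > 0"
begin

lemma finite_J: "finite J" using J finite_subset by blast

lemma moment_weight_pos:
  assumes "k \<in> J"
  shows "w k * real (m choose k) * r k ^ p > 0" "sqrt (real m / (real k * (real m - real k))) > 0"
    "real k * (real m - real k) > 0"
  using J r[OF assms] w[OF assms] assms by (auto simp: zero_less_binomial_iff intro!: mult_pos_pos divide_pos_pos)

text \<open>The term of k has the sign of m - 2 k. Without terms of opposite sign, a zero sum forces
  each term to be zero.\<close>

lemma cubic_moment_same_sign: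
  assumes "cubic_moment m J r w p = 0" "(\<forall>k\<in>J. 2 * k \<le> m) \<or> (\<forall>k\<in>J. m \<le> 2 * k)" "k \<in> J"
  shows "2 * k = m"
proof -
  define c where "c k = w k * real (m choose k) * r k ^ p * sqrt (real m / (real k * (real m - real k)))" for k
  have c: "c k > 0" if "k \<in> J" for k
    unfolding c_def using moment_weight_pos[OF that] by simp
  have sum: "(\<Sum>k\<in>J. c k * (real m - 2 * real k)) = 0"
    using assms(1) by (simp add: cubic_moment_def c_def mult_ac)
  have "c k * (real m - 2 * real k) = 0"
    using assms(2)
  proof
    assume "\<forall>k\<in>J. 2 * k \<le> m"
    then have "\<forall>k\<in>J. real (2 * k) \<le> real m" by (simp only: of_nat_le_iff)
    then have "\<forall>k\<in>J. 0 \<le> c k * (real m - 2 * real k)" using c less_imp_le by (auto intro!: mult_nonneg_nonneg)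
    then show ?thesis by (intro sum_nonneg_0[OF finite_J _ sum assms(3)]) blast
  next
    assume "\<forall>k\<in>J. m \<le> 2 * k"
    then have "\<forall>k\<in>J. real m \<le> real (2 * k)" by (simp only: of_nat_le_iff)
    then have "\<forall>k\<in>J. 0 \<le> c k * (2 * real k - real m)" using c less_imp_le by (auto intro!: mult_nonneg_nonneg)
    moreover have "(\<Sum>k\<in>J. c k * (2 * real k - real m)) = - (\<Sum>k\<in>J. c k * (real m - 2 * real k))"
      unfolding sum_negf[symmetric] by (intro sum.cong) (auto simp: algebra_simps)
    ultimately have "c k * (2 * real k - real m) = 0"
      using sum_nonneg_eq_0_iff[OF finite_J, of "\<lambda>k. c k * (2 * real k - real m)"] sum assms(3) by auto
    then show ?thesis by auto
  qed
  then show ?thesis using c[OF assms(3)] by auto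
qed

text \<open>The sign argument again, with the comparison stated in the naturals, where concrete
  cases are decided by evaluation; \<open>k < m\<close> keeps the subtraction exact.\<close>

lemma quartic_moment_same_sign:
  assumes "quartic_moment m J r w = 0"
    "(\<forall>k\<in>J. 6 * (k * (m - k)) \<le> m * (m + 1)) \<or> (\<forall>k\<in>J. m * (m + 1) \<le> 6 * (k * (m - k)))" "k \<in> J"
  shows "6 * (k * (m - k)) = m * (m + 1)"
proof -
  define c where "c k = w k * real (m choose k) * r k ^ 4 / (real k * (real m - real k))" for k
  define g where "g k = real (m * (m + 1)) - real (6 * (k * (m - k)))" for k
  have c: "c k > 0" if "k \<in> J" for k
    unfolding c_def using moment_weight_pos[OF that] by (intro divide_pos_pos) auto
  have g: "g k = real m * (real m + 1) - 6 * (real k * (real m - real k))" if "k \<in> J" for k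
  proof -
    have "k \<le> m" using J that by auto
    then show ?thesis by (simp add: g_def of_nat_diff algebra_simps)
  qed
  have sum: "(\<Sum>k\<in>J. c k * g k) = 0"
    using assms(1) by (simp add: quartic_moment_def c_def g)
  have "c k * g k = 0"
    using assms(2)
  proof
    assume "\<forall>k\<in>J. 6 * (k * (m - k)) \<le> m * (m + 1)"
    then have "\<forall>k\<in>J. 0 \<le> g k" unfolding g_def by (metis diff_ge_0_iff_ge of_nat_le_iff)
    then have "\<forall>k\<in>J. 0 \<le> c k * g k" using c less_imp_le by (blast intro: mult_nonneg_nonneg)
    then show ?thesis by (intro sum_nonneg_0[OF finite_J _ sum assms(3)]) blast
  next
    assume "\<forall>k\<in>J. m * (m + 1) \<le> 6 * (k * (m - k))"
    then have "\<forall>k\<in>J. 0 \<le> - g k" unfolding g_def by (metis diff_le_0_iff_le neg_0_le_iff_le of_nat_le_iff)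
    then have "\<forall>k\<in>J. 0 \<le> c k * - g k" using c less_imp_le by (blast intro: mult_nonneg_nonneg)
    moreover have "(\<Sum>k\<in>J. c k * - g k) = 0" using sum by (simp add: sum_negf)
    ultimately have "c k * - g k = 0"
      using sum_nonneg_0[OF finite_J, of "\<lambda>k. c k * - g k"] assms(3) by blast
    then show ?thesis by simp
  qed
  then have "g k = 0" using c[OF assms(3)] by auto
  then show ?thesis unfolding g_def by (metis eq_iff_diff_eq_0 of_nat_eq_iff)
qed

text \<open>Subtracting q times the quintic moment from the cubic one with p = 5 cancels every orbit
  with l (m - l) = q. The term of k alone is left, and it vanishes only for m = 2 k.\<close>

lemma odd_moments_single:
  assumes "cubic_moment m J r w 5 = 0" "quintic_moment m J r w = 0"
    and k: "k \<in> J" "k * (m - k) \<noteq> q" and others: "\<And>l. l \<in> J \<Longrightarrow> l \<noteq> k \<Longrightarrow> l * (m - l) = q"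
  shows "2 * k = m"
proof -
  define c where "c k = w k * real (m choose k) * r k ^ 5 * sqrt (real m / (real k * (real m - real k))) * (real m - 2 * real k)" for k
  have q: "real l * (real m - real l) = real (l * (m - l))" if "l \<in> J" for l
    using J that by (auto simp: of_nat_diff)
  have "(\<Sum>l\<in>J. c l) = 0" "(\<Sum>l\<in>J. c l / (real l * (real m - real l))) = 0"
    using assms(1,2) by (simp_all add: cubic_moment_def quintic_moment_def c_def mult_ac)
  then have "(\<Sum>l\<in>J. c l - real q * (c l / (real l * (real m - real l)))) = 0"
    unfolding sum_subtractf sum_distrib_left[symmetric] by simp
  also have "(\<Sum>l\<in>J. c l - real q * (c l / (real l * (real m - real l)))) =
      (\<Sum>l\<in>J. if l = k then c k * (1 - real q / (real k * (real m - real k))) else 0)"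
  proof (intro sum.cong refl)
    fix l assume l: "l \<in> J"
    show "c l - real q * (c l / (real l * (real m - real l))) =
        (if l = k then c k * (1 - real q / (real k * (real m - real k))) else 0)"
    proof (cases "l = k")
      case True
      then show ?thesis by (simp add: right_diff_distrib)
    next
      case False
      then have "real l * (real m - real l) = real q" "real q > 0"
        using moment_weight_pos(3)[OF l] others[OF l] q[OF l] by simp_all
      then show ?thesis using False by simp
    qed
  qed
  also have "\<dots> = c k * (1 - real q / (real k * (real m - real k)))"
    using k finite_J by simp
  finally have "c k * (1 - real q / (real k * (real m - real k))) = 0" .
  moreover have "real q \<noteq> real k * (real m - real k)"
    using k q[OF k(1)] by (metis of_nat_eq_iff)
  then have "1 - real q / (real k * (real m - real k)) \<noteq> 0"
    using moment_weight_pos(3)[OF k(1)] by (metis divide_eq_1_iff eq_iff_diff_eq_0)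
  ultimately have "c k = 0" by (metis mult_eq_0_iff)
  then have "real m - 2 * real k = 0"
    unfolding c_def using moment_weight_pos(1)[OF k(1), of 5] moment_weight_pos(2)[OF k(1)]
    by (metis less_irrefl mult_eq_0_iff)
  then show ?thesis by linarith
qed

end

text \<open>X and Y solve the system for \<open>ri = wi = 1\<close>. The equations are homogeneous
  of degrees 3 and 4 in the radii, so their quotient determines \<open>rj / ri\<close>, and then the
  weight follows.\<close>

lemma two_term_moments_iff:
  fixes ri rj wi wj X Y :: real
  assumes pos: "ri > 0" "rj > 0" "wi > 0" "wj > 0" "X > 0" "Y > 0" and uv: "uj \<noteq> 0" "vj \<noteq> 0"
    and sol: "ui + uj * (Y * X ^ 3) = 0" "vi + vj * (Y * X ^ 4) = 0"
  shows "(wi * ri ^ 3 * ui + wj * rj ^ 3 * uj = 0 \<and> wi * ri ^ 4 * vi + wj * rj ^ 4 * vj = 0) \<longleftrightarrow>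
    rj = X * ri \<and> wj = Y * wi"
proof
  have u: "ui = - (uj * (Y * X ^ 3))" and v: "vi = - (vj * (Y * X ^ 4))" using sol by linarith+
  assume *: "wi * ri ^ 3 * ui + wj * rj ^ 3 * uj = 0 \<and> wi * ri ^ 4 * vi + wj * rj ^ 4 * vj = 0"
  then have "uj * (wj * rj ^ 3 - Y * wi * (X * ri) ^ 3) = 0" "vj * (wj * rj ^ 4 - Y * wi * (X * ri) ^ 4) = 0"
    unfolding u v by (simp_all add: power_mult_distrib algebra_simps)
  then have 3: "wj * rj ^ 3 = Y * wi * (X * ri) ^ 3" and 4: "wj * rj ^ 4 = Y * wi * (X * ri) ^ 4"
    using uv by auto
  have "(wj * rj ^ 3) * rj = (wj * rj ^ 3) * (X * ri)"
    using 4 unfolding 3 by (simp add: power4_eq_xxxx power3_eq_cube mult_ac) (use 3 4 in \<open>simp add: power4_eq_xxxx power3_eq_cube mult_ac\<close>)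
  then have "rj = X * ri" using pos by simp
  then show "rj = X * ri \<and> wj = Y * wi" using 3 pos by simp
next
  have u: "ui = - (uj * (Y * X ^ 3))" and v: "vi = - (vj * (Y * X ^ 4))" using sol by linarith+
  assume "rj = X * ri \<and> wj = Y * wi"
  then show "wi * ri ^ 3 * ui + wj * rj ^ 3 * uj = 0 \<and> wi * ri ^ 4 * vi + wj * rj ^ 4 * vj = 0"
    unfolding u v by (simp add: power_mult_distrib algebra_simps)
qed

text \<open>Later proofs select entries by position; all binomials with the same upper index form
  one block.\<close>

lemma small_choose:
  "3 choose 1 = (3::nat)" "3 choose 2 = (3::nat)"
  "4 choose 1 = (4::nat)" "4 choose 2 = (6::nat)" "4 choose 3 = (4::nat)"
  "5 choose 1 = (5::nat)" "5 choose 2 = (10::nat)" "5 choose 3 = (10::nat)" "5 choose 4 = (5::nat)"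
  "6 choose 1 = (6::nat)" "6 choose 2 = (15::nat)" "6 choose 3 = (20::nat)" "6 choose 4 = (15::nat)" "6 choose 5 = (6::nat)"
  "7 choose 1 = (7::nat)" "7 choose 2 = (21::nat)" "7 choose 3 = (35::nat)" "7 choose 4 = (35::nat)" "7 choose 5 = (21::nat)" "7 choose 6 = (7::nat)"
  "8 choose 1 = (8::nat)" "8 choose 2 = (28::nat)" "8 choose 3 = (56::nat)" "8 choose 4 = (70::nat)" "8 choose 5 = (56::nat)" "8 choose 6 = (28::nat)" "8 choose 7 = (8::nat)"
  by (simp_all add: eval_nat_numeral binomial_Suc_Suc)

text \<open>Summing conditionals over a known set lets case splitting on the memberships find the
  subsets J with a required sum.\<close>

lemma sum_subset_indicator:
  assumes "J \<subseteq> A" "finite A"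
  shows "(\<Sum>k\<in>J. f k) = (\<Sum>k\<in>A. if k \<in> J then f k else 0 :: nat)"
  using assms by (intro sum.mono_neutral_cong_left) auto

section \<open>Sets J satisfying the size condition\<close>

lemma atLeastAtMost_explicit:
  "{1..2::nat} = {1, 2}" "{1..3::nat} = {1, 2, 3}" "{1..4::nat} = {1, 2, 3, 4}"
  "{1..5::nat} = {1, 2, 3, 4, 5}" "{1..6::nat} = {1, 2, 3, 4, 5, 6}" "{1..7::nat} = {1, 2, 3, 4, 5, 6, 7}"
  by auto

text \<open>The name lists t and n. The two admissible sums are the bounds for one radius and for
  several radii. Passing to \<open>J \<inter> ?E\<close> expresses J through its memberships, so
  that splitting decides the claim.\<close>

lemma size_4_2:
  fixes J :: "nat set"
  assumes J: "J \<subseteq> {1..2}" and S: "(\<Sum>k\<in>J. 3 choose k) \<in> {5, 6}"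
  shows "J = {1, 2}" (is "?P J")
proof -
  let ?E = "{1, 2} :: nat set"
  have J': "J \<subseteq> ?E" using J by (simp only: atLeastAtMost_explicit)
  have "?P (J \<inter> ?E)"
    using S by (simp add: sum_subset_indicator[OF J'] small_choose cong: if_cong split: if_splits)
  then show ?thesis using J' by (simp add: Int_absorb2)
qed

lemma size_4_3:
  fixes J :: "nat set"
  assumes J: "J \<subseteq> {1..3}" and S: "(\<Sum>k\<in>J. 4 choose k) \<in> {9, 10}"
  shows "J = {1, 2} \<or> J = {2, 3}" (is "?P J")
proof -
  let ?E = "{1, 2, 3} :: nat set"
  have J': "J \<subseteq> ?E" using J by (simp only: atLeastAtMost_explicit)
  have "?P (J \<inter> ?E)"
    using S by (simp add: sum_subset_indicator[OF J'] small_choose cong: if_cong split: if_splits)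
  then show ?thesis using J' by (simp add: Int_absorb2)
qed

lemma size_4_4:
  fixes J :: "nat set"
  assumes J: "J \<subseteq> {1..4}" and S: "(\<Sum>k\<in>J. 5 choose k) \<in> {14, 15}"
  shows "J = {1, 2} \<or> J = {1, 3} \<or> J = {2, 4} \<or> J = {3, 4}" (is "?P J")
proof -
  let ?E = "{1, 2, 3, 4} :: nat set"
  have J': "J \<subseteq> ?E" using J by (simp only: atLeastAtMost_explicit)
  have "?P (J \<inter> ?E)"
    using S by (simp add: sum_subset_indicator[OF J'] small_choose cong: if_cong split: if_splits)
  then show ?thesis using J' by (simp add: Int_absorb2)
qed

lemma size_4_5:
  fixes J :: "nat set"
  assumes J: "J \<subseteq> {1..5}" and S: "(\<Sum>k\<in>J. 6 choose k) \<in> {20, 21}"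
  shows "J = {1, 2} \<or> J = {1, 4} \<or> J = {2, 5} \<or> J = {4, 5} \<or> J = {3}" (is "?P J")
proof -
  let ?E = "{1, 2, 3, 4, 5} :: nat set"
  have J': "J \<subseteq> ?E" using J by (simp only: atLeastAtMost_explicit)
  have "?P (J \<inter> ?E)"
    using S by (simp add: sum_subset_indicator[OF J'] small_choose cong: if_cong split: if_splits)
  then show ?thesis using J' by (simp add: Int_absorb2)
qed

lemma size_5_2:
  fixes J :: "nat set"
  assumes J: "J \<subseteq> {1..2}" and S: "(\<Sum>k\<in>J. 3 choose k) \<in> {6, 8}"
  shows "J = {1, 2}" (is "?P J")
proof -
  let ?E = "{1, 2} :: nat set"
  have J': "J \<subseteq> ?E" using J by (simp only: atLeastAtMost_explicit)
  have "?P (J \<inter> ?E)"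
    using S by (simp add: sum_subset_indicator[OF J'] small_choose cong: if_cong split: if_splits)
  then show ?thesis using J' by (simp add: Int_absorb2)
qed

lemma size_5_3:
  fixes J :: "nat set"
  assumes J: "J \<subseteq> {1..3}" and S: "(\<Sum>k\<in>J. 4 choose k) \<in> {12, 14}"
  shows "J = {1, 2, 3}" (is "?P J")
proof -
  let ?E = "{1, 2, 3} :: nat set"
  have J': "J \<subseteq> ?E" using J by (simp only: atLeastAtMost_explicit)
  have "?P (J \<inter> ?E)"
    using S by (simp add: sum_subset_indicator[OF J'] small_choose cong: if_cong split: if_splits)
  then show ?thesis using J' by (simp add: Int_absorb2)
qed

lemma size_5_4:
  fixes J :: "nat set"
  assumes J: "J \<subseteq> {1..4}" and S: "(\<Sum>k\<in>J. 5 choose k) \<in> {20, 22}"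
  shows "J = {2, 3} \<or> J = {1, 2, 4} \<or> J = {1, 3, 4}" (is "?P J")
proof -
  let ?E = "{1, 2, 3, 4} :: nat set"
  have J': "J \<subseteq> ?E" using J by (simp only: atLeastAtMost_explicit)
  have "?P (J \<inter> ?E)"
    using S by (simp add: sum_subset_indicator[OF J'] small_choose cong: if_cong split: if_splits)
  then show ?thesis using J' by (simp add: Int_absorb2)
qed

lemma size_5_5:
  fixes J :: "nat set"
  assumes J: "J \<subseteq> {1..5}" and S: "(\<Sum>k\<in>J. 6 choose k) \<in> {30, 32}"
  shows "J = {2, 4} \<or> J = {1, 3, 5}" (is "?P J")
proof -
  let ?E = "{1, 2, 3, 4, 5} :: nat set"
  have J': "J \<subseteq> ?E" using J by (simp only: atLeastAtMost_explicit)
  have "?P (J \<inter> ?E)"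
    using S by (simp add: sum_subset_indicator[OF J'] small_choose cong: if_cong split: if_splits)
  then show ?thesis using J' by (simp add: Int_absorb2)
qed

lemma size_5_6:
  fixes J :: "nat set"
  assumes J: "J \<subseteq> {1..6}" and S: "(\<Sum>k\<in>J. 7 choose k) \<in> {42, 44}"
  shows "J = {1, 3} \<or> J = {1, 4} \<or> J = {2, 5} \<or> J = {3, 6} \<or> J = {4, 6}" (is "?P J")
proof -
  let ?E = "{1, 2, 3, 4, 5, 6} :: nat set"
  have J': "J \<subseteq> ?E" using J by (simp only: atLeastAtMost_explicit)
  have "?P (J \<inter> ?E)"
    using S by (simp add: sum_subset_indicator[OF J'] small_choose cong: if_cong split: if_splits)
  then show ?thesis using J' by (simp add: Int_absorb2)
qed

lemma size_5_7:
  fixes J :: "nat set"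
  assumes J: "J \<subseteq> {1..7}" and S: "(\<Sum>k\<in>J. 8 choose k) \<in> {56, 58}"
  shows "J = {3} \<or> J = {5} \<or> J = {2, 6}" (is "?P J")
proof -
  let ?E = "{1, 2, 3, 4, 5, 6, 7} :: nat set"
  have J': "J \<subseteq> ?E" using J by (simp only: atLeastAtMost_explicit)
  have "?P (J \<inter> ?E)"
    using S by (simp add: sum_subset_indicator[OF J'] small_choose cong: if_cong split: if_splits)
  then show ?thesis using J' by (simp add: Int_absorb2)
qed

text \<open>An index from 3 to N - 2 alone contributes at least \<open>Suc N choose 3\<close>. The
  bound \<open>N \<ge> 4\<close> keeps the four outer indices distinct.\<close>

lemma sum_choose_outer:
  fixes J :: "nat set"
  assumes J: "J \<subseteq> {1..N}" and N: "N \<ge> 4" and S: "(\<Sum>k\<in>J. Suc N choose k) < Suc N choose 3"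
  shows "J \<subseteq> {1, 2, N - 1, N}"
    and "(\<Sum>k\<in>J. Suc N choose k) = (if 1 \<in> J then Suc N else 0) + ((if 2 \<in> J then Suc N choose 2 else 0) +
      ((if N - 1 \<in> J then Suc N choose 2 else 0) + (if N \<in> J then Suc N else 0)))"
proof -
  show sub: "J \<subseteq> {1, 2, N - 1, N}"
  proof
    fix k assume k: "k \<in> J"
    have "Suc N choose k \<le> (\<Sum>k\<in>J. Suc N choose k)"
      using J k by (intro choose_le_sum) (auto simp: atLeastLessThanSuc_atLeastAtMost)
    then have "\<not> (3 \<le> k \<and> k \<le> Suc N - 3)" using choose_le_choose[of 3 k "Suc N"] S by linarith
    then show "k \<in> {1, 2, N - 1, N}" using J k by auto
  qed
  have "Suc N choose (N - 1) = Suc N choose 2" "Suc N choose N = Suc N"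
    using binomial_symmetric[of 2 "Suc N"] binomial_symmetric[of 1 "Suc N"] N by simp_all
  then show "(\<Sum>k\<in>J. Suc N choose k) = (if 1 \<in> J then Suc N else 0) + ((if 2 \<in> J then Suc N choose 2 else 0) +
      ((if N - 1 \<in> J then Suc N choose 2 else 0) + (if N \<in> J then Suc N else 0)))"
    using N by (subst sum_subset_indicator[OF sub]) (auto)
qed

text \<open>M stands for N^2 and c for the binomial of 2, which makes the problem linear. P and Q
  count the orbits of size N + 1 and of size c; comparing the quadratic parts forces Q = 1, and then
  P = 1.\<close>

lemma size_4_arith:
  fixes S M N c :: nat
  assumes S: "2 * S = M + 3 * N \<or> 2 * S = M + 3 * N + 2"
    and sum: "S = (if p then Suc N else 0) + ((if q then c else 0) + ((if q' then c else 0) + (if p' then Suc N else 0)))"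
    and M: "6 * N \<le> M" "N \<ge> 6" and c: "2 * c = M + N"
  shows "p \<and> q \<and> \<not> q' \<and> \<not> p' \<or> p \<and> \<not> q \<and> q' \<and> \<not> p' \<or> \<not> p \<and> q \<and> \<not> q' \<and> p' \<or> \<not> p \<and> \<not> q \<and> q' \<and> p'"
proof -
  define P Q :: nat where "P = of_bool p + of_bool p'" and "Q = of_bool q + of_bool q'"
  have "S = P * Suc N + Q * c" using sum by (simp add: P_def Q_def distrib_right)
  moreover have "P = 0 \<or> P = 1 \<or> P = 2" "Q = 0 \<or> Q = 1 \<or> Q = 2" by (auto simp: P_def Q_def)
  ultimately have "P = 1 \<and> Q = 1" using S M c by (elim disjE) simp_all
  then show ?thesis by (auto simp: P_def Q_def of_bool_def split: if_splits)
qed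

text \<open>Compared with t = 4 the leading term N^2 is doubled relative to c, so both orbits of
  size c are required.\<close>

lemma size_5_arith:
  fixes S M N c :: nat
  assumes S: "S = M + N \<or> S = M + N + 2"
    and sum: "S = (if p then Suc N else 0) + ((if q then c else 0) + ((if q' then c else 0) + (if p' then Suc N else 0)))"
    and M: "8 * N \<le> M" "N \<ge> 8" and c: "2 * c = M + N"
  shows "\<not> p \<and> q \<and> q' \<and> \<not> p'"
proof -
  define P Q :: nat where "P = of_bool p + of_bool p'" and "Q = of_bool q + of_bool q'"
  have "S = P * Suc N + Q * c" using sum by (simp add: P_def Q_def distrib_right)
  moreover have "P = 0 \<or> P = 1 \<or> P = 2" "Q = 0 \<or> Q = 1 \<or> Q = 2" by (auto simp: P_def Q_def)
  ultimately have "P = 0 \<and> Q = 2" using S M c by (elim disjE) simp_all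
  then show ?thesis by (auto simp: P_def Q_def of_bool_def split: if_splits)
qed

lemma size_4_large:
  fixes J :: "nat set"
  assumes J: "J \<subseteq> {1..N}" and N: "N \<ge> 6"
    and S: "(\<Sum>k\<in>J. Suc N choose k) = N * (N + 3) div 2 \<or> (\<Sum>k\<in>J. Suc N choose k) = (N + 1) * (N + 2) div 2"
  shows "J = {1, 2} \<or> J = {1, N - 1} \<or> J = {2, N} \<or> J = {N - 1, N}"
proof -
  let ?S = "\<Sum>k\<in>J. Suc N choose k" and ?M = "N * N"
  have M: "6 * N \<le> ?M" and N4: "N \<ge> 4" using N by simp_all
  have S2: "2 * ?S = ?M + 3 * N \<or> 2 * ?S = ?M + 3 * N + 2"
  proof -
    have "even (N * (N + 3))" "even ((N + 1) * (N + 2))" by simp_all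
    then have "2 * (N * (N + 3) div 2) = N * (N + 3)" "2 * ((N + 1) * (N + 2) div 2) = (N + 1) * (N + 2)"
      by (metis dvd_mult_div_cancel)+
    then show ?thesis using S by (auto simp: algebra_simps)
  qed
  have "6 * (Suc N choose 3) = Suc N * (N * (N - 1))" using six_choose_3[of "Suc N"] by simp
  also have "\<dots> \<ge> Suc N * (N * 5)" using N by (intro mult_le_mono) auto
  \<comment> \<open>This exceeds six times the larger admissible sum, 3 N^2 + 9 N + 6, so indices
    from 3 to N - 2 are impossible.\<close>
  finally have "6 * (Suc N choose 3) \<ge> 5 * ?M + 5 * N" by (simp add: algebra_simps)
  then have "?S < Suc N choose 3" using S2 M N by linarith
  note outer = sum_choose_outer[OF J N4 this]
  define S c M where "S = ?S" and "c = Suc N choose 2" and "M = ?M"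
  have c2: "2 * (Suc N choose 2) = ?M + N" using two_choose_2[of "Suc N"] by simp
  have "1 \<in> J \<and> 2 \<in> J \<and> N - 1 \<notin> J \<and> N \<notin> J \<or> 1 \<in> J \<and> 2 \<notin> J \<and> N - 1 \<in> J \<and> N \<notin> J \<or>
      1 \<notin> J \<and> 2 \<in> J \<and> N - 1 \<notin> J \<and> N \<in> J \<or> 1 \<notin> J \<and> 2 \<notin> J \<and> N - 1 \<in> J \<and> N \<in> J"
    using S2 outer(2) M N c2
    unfolding S_def[symmetric] c_def[symmetric] M_def[symmetric] by (rule size_4_arith)
  then show ?thesis using outer(1) by (elim disjE) blast+
qed

lemma size_5_large:
  fixes J :: "nat set"
  assumes J: "J \<subseteq> {1..N}" and N: "N \<ge> 8"
    and S: "(\<Sum>k\<in>J. Suc N choose k) = N * (N + 1) \<or> (\<Sum>k\<in>J. Suc N choose k) = N * (N + 1) + 2"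
  shows "J = {2, N - 1}"
proof -
  let ?S = "\<Sum>k\<in>J. Suc N choose k" and ?M = "N * N"
  have M: "8 * N \<le> ?M" and N4: "N \<ge> 4" using N by simp_all
  have S2: "?S = ?M + N \<or> ?S = ?M + N + 2" using S by (simp add: algebra_simps)
  have "6 * (Suc N choose 3) = Suc N * (N * (N - 1))" using six_choose_3[of "Suc N"] by simp
  also have "\<dots> \<ge> Suc N * (N * 7)" using N by (intro mult_le_mono) auto
  finally have "6 * (Suc N choose 3) \<ge> 7 * ?M + 7 * N" by (simp add: algebra_simps)
  then have "?S < Suc N choose 3" using S2 M N by linarith
  note outer = sum_choose_outer[OF J N4 this]
  define S c M where "S = ?S" and "c = Suc N choose 2" and "M = ?M"
  have c2: "2 * (Suc N choose 2) = ?M + N" using two_choose_2[of "Suc N"] by simp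
  have "1 \<notin> J \<and> 2 \<in> J \<and> N - 1 \<in> J \<and> N \<notin> J"
    using S2 outer(2) M N c2
    unfolding S_def[symmetric] c_def[symmetric] M_def[symmetric] by (rule size_5_arith)
  then show ?thesis using outer(1) by blast
qed

text \<open>The set {3} appears because 6 choose 3 = 20 is the one-radius bound for N = 5; for N
  \<ge> 3 the other sets are uniform in N.\<close>

lemma size_4:
  fixes J :: "nat set"
  assumes J: "J \<subseteq> {1..N}" and N: "N \<ge> 2"
    and S: "(\<Sum>k\<in>J. Suc N choose k) = N * (N + 3) div 2 \<or> (\<Sum>k\<in>J. Suc N choose k) = (N + 1) * (N + 2) div 2"
  shows "N = 2 \<and> J = {1, 2} \<or> N \<ge> 3 \<and> (J = {1, 2} \<or> J = {1, N - 1} \<or> J = {2, N} \<or> J = {N - 1, N}) \<or> N = 5 \<and> J = {3}"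
proof -
  consider "N = 2" | "N = 3" | "N = 4" | "N = 5" | "N \<ge> 6" using N by linarith
  then show ?thesis
  proof cases
    case 1 then show ?thesis using size_4_2[of J] J S by simp
  next
    case 2 then show ?thesis using size_4_3[of J] J S by (simp, metis?)
  next
    case 3 then show ?thesis using size_4_4[of J] J S by (simp, metis?)
  next
    case 4 then show ?thesis using size_4_5[of J] J S by (simp, metis?)
  next
    case 5 then show ?thesis using size_4_large[OF J _ S] by simp
  qed
qed

text \<open>Coincidences of binomials create the sporadic sets, such as 7 + 35 = 42 for N = 6 and 8
  choose 3 = 56 for N = 7.\<close>

lemma size_5:
  fixes J :: "nat set"
  assumes J: "J \<subseteq> {1..N}" and N: "N \<ge> 2"
    and S: "(\<Sum>k\<in>J. Suc N choose k) = N * (N + 1) \<or> (\<Sum>k\<in>J. Suc N choose k) = N * (N + 1) + 2"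
  shows "N = 2 \<and> J = {1, 2} \<or> N = 3 \<and> J = {1, 2, 3} \<or> N = 4 \<and> (J = {2, 3} \<or> J = {1, 2, 4} \<or> J = {1, 3, 4}) \<or>
    N = 5 \<and> (J = {2, 4} \<or> J = {1, 3, 5}) \<or> N = 6 \<and> (J = {1, 3} \<or> J = {1, 4} \<or> J = {2, 5} \<or> J = {3, 6} \<or> J = {4, 6}) \<or>
    N = 7 \<and> (J = {3} \<or> J = {5} \<or> J = {2, 6}) \<or> N \<ge> 8 \<and> J = {2, N - 1}"
proof -
  consider "N = 2" | "N = 3" | "N = 4" | "N = 5" | "N = 6" | "N = 7" | "N \<ge> 8" using N by linarith
  then show ?thesis
  proof cases
    case 1 then show ?thesis using size_5_2[of J] J S by simp
  next
    case 2 then show ?thesis using size_5_3[of J] J S by simp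
  next
    case 3 then show ?thesis using size_5_4[of J] J S by (simp, metis?)
  next
    case 4 then show ?thesis using size_5_5[of J] J S by (simp, metis?)
  next
    case 5 then show ?thesis using size_5_6[of J] J S by (simp, metis?)
  next
    case 6 then show ?thesis using size_5_7[of J] J S by (simp, metis?)
  next
    case 7 then show ?thesis using size_5_large[OF J _ S] by simp
  qed
qed

text \<open>For two orbits, a proposed ratio X of radii and Y of weights is confirmed by two
  numerical identities. The conditions \<open>nz\<close> make both coefficients of j nonzero, which
  gives uniqueness.\<close>

lemma pair_moments_iff:
  fixes r w :: "nat \<Rightarrow> real"
  assumes ij: "i \<noteq> j" "i \<in> {1..<m}" "j \<in> {1..<m}"
    and pos: "r i > 0" "r j > 0" "w i > 0" "w j > 0" "X > 0" "Y > 0"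
    and nz: "2 * j \<noteq> m" "6 * (j * (m - j)) \<noteq> m * (m + 1)"
    and cubic: "real (m choose i) * (sqrt (real m / (real i * (real m - real i))) * (real m - 2 * real i)) +
      real (m choose j) * (sqrt (real m / (real j * (real m - real j))) * (real m - 2 * real j)) * (Y * X ^ 3) = 0"
    and quartic: "real (m choose i) * ((real m * (real m + 1) - 6 * (real i * (real m - real i))) / (real i * (real m - real i))) +
      real (m choose j) * ((real m * (real m + 1) - 6 * (real j * (real m - real j))) / (real j * (real m - real j))) * (Y * X ^ 4) = 0"
  shows "(cubic_moment m {i, j} r w 3 = 0 \<and> quartic_moment m {i, j} r w = 0) \<longleftrightarrow> r j = X * r i \<and> w j = Y * w i"
proof -
  have c: "m choose j \<noteq> 0" using ij by simp
  have j: "real j > 0" "real m - real j > 0" using ij by auto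
  have "real m - 2 * real j \<noteq> 0" using nz(1) by linarith
  then have u: "real (m choose j) * (sqrt (real m / (real j * (real m - real j))) * (real m - 2 * real j)) \<noteq> 0"
    using c j by auto
  have "real (m * (m + 1)) - real (6 * (j * (m - j))) \<noteq> 0" using nz(2) by (metis eq_iff_diff_eq_0 of_nat_eq_iff)
  moreover have "real (m - j) = real m - real j" using ij by (simp add: of_nat_diff)
  ultimately have "real m * (real m + 1) - 6 * (real j * (real m - real j)) \<noteq> 0"
    by (simp add: algebra_simps)
  then have v: "real (m choose j) * ((real m * (real m + 1) - 6 * (real j * (real m - real j))) / (real j * (real m - real j))) \<noteq> 0"
    using c j by auto
  show ?thesis
    unfolding two_term_moments_iff[OF pos u v cubic quartic, symmetric]
    using ij(1) by (simp add: cubic_moment_def quartic_moment_def mult_ac)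
qed

text \<open>Orbits i and m - i have cubic coefficients of equal size and opposite sign, and a middle
  orbit contributes zero.\<close>

lemma cubic_moment_antipodal_pair:
  fixes r w :: "nat \<Rightarrow> real"
  assumes "finite J" "i \<in> J" "m - i \<in> J" "2 * i \<noteq> m" "i \<in> {1..<m}" and others: "\<And>k. k \<in> J - {i, m - i} \<Longrightarrow> 2 * k = m"
  shows "cubic_moment m J r w p = 0 \<longleftrightarrow> w i * r i ^ p = w (m - i) * r (m - i) ^ p"
proof -
  let ?f = "\<lambda>k. w k * real (m choose k) * r k ^ p * (sqrt (real m / (real k * (real m - real k))) * (real m - 2 * real k))"
  define c where "c = real (m choose i) * (sqrt (real m / (real i * (real m - real i))) * (real m - 2 * real i))"
  have ne: "i \<noteq> m - i" using assms by auto
  have "real m - 2 * real k = 0" if "k \<in> J - {i, m - i}" for k using others[OF that] by linarith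
  then have "cubic_moment m J r w p = (\<Sum>k\<in>{i, m - i}. ?f k)"
    unfolding cubic_moment_def using assms(1-3) by (intro sum.mono_neutral_right) auto
  also have "\<dots> = ?f i + ?f (m - i)" using ne by simp
  also have "\<dots> = c * (w i * r i ^ p - w (m - i) * r (m - i) ^ p)"
  proof -
    have "m choose (m - i) = m choose i" using binomial_symmetric[of i m] assms by simp
    moreover have "real (m - i) = real m - real i" using assms by (simp add: of_nat_diff)
    ultimately show ?thesis by (simp add: c_def algebra_simps)
  qed
  finally have *: "cubic_moment m J r w p = c * (w i * r i ^ p - w (m - i) * r (m - i) ^ p)" .
  have "real m - 2 * real i \<noteq> 0" using assms(4) by linarith
  moreover have "real i > 0" "real m - real i > 0" "m choose i \<noteq> 0" using assms(5) by auto
  ultimately have "c \<noteq> 0" by (auto simp: c_def)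
  then show ?thesis using * by auto
qed

lemma card_mult_le_sum_choose:
  fixes J :: "nat set"
  assumes "J \<subseteq> {1..N}"
  shows "card J * Suc N \<le> (\<Sum>k\<in>J. Suc N choose k)"
proof -
  have "Suc N choose 1 \<le> Suc N choose k" if "k \<in> J" for k
    using assms that by (intro choose_le_choose) auto
  then show ?thesis
    using sum_bounded_below[of J "Suc N" "\<lambda>k. Suc N choose k"] by simp
qed

text \<open>Every orbit has at least N + 1 points, so fewer than 2 (N + 1) points allow one orbit
  only. The last alternative records its quadratic size if it is not an extreme orbit.\<close>

lemma sum_choose_lt_singleton:
  fixes J :: "nat set"
  assumes J: "J \<subseteq> {1..N}" "J \<noteq> {}" and S: "(\<Sum>k\<in>J. Suc N choose k) < 2 * Suc N"
  obtains k where "J = {k}" "k \<in> {1..N}"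
    "k = 1 \<or> k = N \<or> 2 \<le> k \<and> k \<le> N - 1 \<and> N * Suc N \<le> 2 * (\<Sum>k\<in>J. Suc N choose k)"
proof -
  have "card J * Suc N < 2 * Suc N" using card_mult_le_sum_choose[OF J(1)] S by (rule le_less_trans)
  then have "card J < 2" by (simp only: mult_less_cancel2)
  moreover have "card J \<noteq> 0" using J finite_subset by fastforce
  ultimately have "card J = 1" by linarith
  then obtain k where k: "J = {k}" using card_1_singletonE by blast
  have "k = 1 \<or> k = N \<or> 2 \<le> k \<and> k \<le> N - 1 \<and> N * Suc N \<le> 2 * (\<Sum>k\<in>J. Suc N choose k)"
  proof (cases "k = 1 \<or> k = N")
    case False
    then have *: "2 \<le> k" "k \<le> N - 1" using J k by auto
    then have "Suc N choose 2 \<le> Suc N choose k" by (intro choose_le_choose) auto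
    then show ?thesis using * two_choose_2[of "Suc N"] unfolding k by simp
  qed auto
  then show ?thesis using that k J by blast
qed

lemma size_2:
  fixes J :: "nat set"
  assumes J: "J \<subseteq> {1..N}" "J \<noteq> {}" and N: "N \<ge> 2"
  shows "(\<Sum>k\<in>J. Suc N choose k) = N + 1 \<longleftrightarrow> J = {1} \<or> J = {N}"
proof
  assume S: "(\<Sum>k\<in>J. Suc N choose k) = N + 1"
  then have "(\<Sum>k\<in>J. Suc N choose k) < 2 * Suc N" by simp
  then obtain k where k: "J = {k}" "k = 1 \<or> k = N \<or> 2 \<le> k \<and> k \<le> N - 1 \<and> N * Suc N \<le> 2 * (\<Sum>k\<in>J. Suc N choose k)"
    by (rule sum_choose_lt_singleton[OF J])
  moreover have "\<not> (2 \<le> k \<and> k \<le> N - 1 \<and> N * Suc N \<le> 2 * (N + 1))"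
  proof
    assume *: "2 \<le> k \<and> k \<le> N - 1 \<and> N * Suc N \<le> 2 * (N + 1)"
    then have "N * Suc N \<le> 2 * Suc N" by simp
    then have "N \<le> 2" by (simp only: mult_le_cancel2)
    with * show False by linarith
  qed
  ultimately show "J = {1} \<or> J = {N}" using S by auto
next
  assume "J = {1} \<or> J = {N}"
  then show "(\<Sum>k\<in>J. Suc N choose k) = N + 1"
    using binomial_symmetric[of 1 "Suc N"] by (auto)
qed

lemma size_3:
  fixes J :: "nat set"
  assumes J: "J \<subseteq> {1..N}" "J \<noteq> {}" and N: "N \<ge> 2"
  shows "(\<Sum>k\<in>J. Suc N choose k) = 2 * N \<longleftrightarrow> N = 3 \<and> J = {2}"
proof
  assume S: "(\<Sum>k\<in>J. Suc N choose k) = 2 * N"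
  then have "(\<Sum>k\<in>J. Suc N choose k) < 2 * Suc N" by simp
  then obtain k where k: "J = {k}" "k = 1 \<or> k = N \<or> 2 \<le> k \<and> k \<le> N - 1 \<and> N * Suc N \<le> 2 * (\<Sum>k\<in>J. Suc N choose k)"
    by (rule sum_choose_lt_singleton[OF J])
  have "\<not> (k = 1 \<or> k = N)"
  proof
    assume "k = 1 \<or> k = N"
    then have "(\<Sum>k\<in>J. Suc N choose k) = Suc N"
      using binomial_symmetric[of 1 "Suc N"] k(1) by (auto)
    with S N show False by simp
  qed
  then have *: "2 \<le> k" "k \<le> N - 1" "N * Suc N \<le> 2 * (2 * N)" using k S by auto
  then have "N * Suc N \<le> N * 4" by simp
  then have "N \<le> 3" using N by (simp only: mult_le_cancel1) simp
  with * k show "N = 3 \<and> J = {2}" by auto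
next
  assume "N = 3 \<and> J = {2}"
  then show "(\<Sum>k\<in>J. Suc N choose k) = 2 * N" using small_choose(4) by simp
qed

text \<open>The exceptional list with the free scales of radii and weights eliminated: relations
  invariant under rescaling, the form in which the moment equations are solved.\<close>

definition proportional_case ::
  "nat \<Rightarrow> nat \<Rightarrow> nat set \<Rightarrow> (nat \<Rightarrow> real) \<Rightarrow> (nat \<Rightarrow> real) \<Rightarrow> bool" where
  "proportional_case n t J r w \<longleftrightarrow>
     (t = 2 \<and> J = {1}) \<or> (t = 2 \<and> J = {n}) \<or> (t = 3 \<and> n = 3 \<and> J = {2}) \<or>
     (t = 5 \<and> n = 2 \<and> J = {1, 2} \<and> r 2 = r 1 \<and> w 2 = w 1) \<or>
     (t = 5 \<and> n = 7 \<and> J = {2, 6} \<and> r 6 = r 2 \<and> w 6 = w 2) \<or>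
     (t = 4 \<and> n = 2 \<and> J = {1, 2} \<and> r 2 \<noteq> r 1 \<and> w 1 * r 1 ^ 3 = w 2 * r 2 ^ 3) \<or>
     (t = 4 \<and> n = 4 \<and> J = {1, 3} \<and> r 3 = 1 / sqrt 6 * r 1 \<and> w 3 = 27 * w 1) \<or>
     (t = 4 \<and> n = 4 \<and> J = {2, 4} \<and> r 2 = 1 / sqrt 6 * r 4 \<and> w 2 = 27 * w 4) \<or>
     (t = 4 \<and> n = 5 \<and> J = {1, 4} \<and> r 4 = sqrt (8 / 5) * r 1 \<and> w 4 = 1 / 2 * w 1) \<or>
     (t = 4 \<and> n = 5 \<and> J = {2, 5} \<and> r 2 = sqrt (8 / 5) * r 5 \<and> w 2 = 1 / 2 * w 5) \<or>
     (t = 4 \<and> n = 6 \<and> J = {1, 5} \<and> r 5 = sqrt 15 * r 1 \<and> w 5 = 1 / 81 * w 1) \<or>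
     (t = 4 \<and> n = 6 \<and> J = {2, 6} \<and> r 2 = sqrt 15 * r 6 \<and> w 2 = 1 / 81 * w 6) \<or>
     (t = 5 \<and> n = 3 \<and> J = {1, 2, 3} \<and> r 3 = r 1 \<and> r 2 \<noteq> r 1 \<and> w 3 = w 1 \<and>
        9 * (w 2 * r 2 ^ 4) = 8 * (w 1 * r 1 ^ 4)) \<or>
     (t = 5 \<and> n = 5 \<and> J = {1, 3, 5} \<and> r 5 = r 1 \<and> r 3 \<noteq> r 1 \<and> w 5 = w 1 \<and>
        25 * (w 3 * r 3 ^ 4) = 27 * (w 1 * r 1 ^ 4))"

lemma exceptional_case_normalize:
  assumes "i \<in> J" "r i > 0" "w i > 0"
    and "one_sphere_case n t J (\<lambda>k. r k / r i) (\<lambda>k. w k / w i) \<or>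
      two_sphere_case n t J (\<lambda>k. r k / r i) (\<lambda>k. w k / w i)"
  shows "exceptional_case n t J r w"
  unfolding exceptional_case_def
  using assms by (intro exI[of _ "r i"] exI[of _ "w i"] exI[of _ "\<lambda>k. r k / r i"] exI[of _ "\<lambda>k. w k / w i"]) simp

lemma exceptional_case_iff:
  assumes r: "\<And>k. k \<in> J \<Longrightarrow> r k > 0" and w: "\<And>k. k \<in> J \<Longrightarrow> w k > 0"
  shows "exceptional_case n t J r w \<longleftrightarrow> proportional_case n t J r w"
proof
  assume "exceptional_case n t J r w"
  then obtain \<rho> \<omega> r' w' where pos: "\<rho> > 0" "\<omega> > 0" and rw: "\<And>k. k \<in> J \<Longrightarrow> r k = \<rho> * r' k" "\<And>k. k \<in> J \<Longrightarrow> w k = \<omega> * w' k"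
    and case': "one_sphere_case n t J r' w' \<or> two_sphere_case n t J r' w'"
    unfolding exceptional_case_def by blast
  have r': "r' k \<noteq> 0" if "k \<in> J" for k
    using r[OF that] rw(1)[OF that] by auto
  show "proportional_case n t J r w"
    using case' unfolding one_sphere_case_def two_sphere_case_def proportional_case_def
    using pos rw r' by (elim disjE conjE) (simp_all add: power_mult_distrib)
next
  assume "proportional_case n t J r w"
  note cases = one_sphere_case_def two_sphere_case_def divide_simps power_divide mult_ac less_imp_neq[THEN not_sym]
  \<comment> \<open>Normalization divides by the radius and weight of an orbit for which the list
    prescribes 1; each case names its index.\<close>
  note normalize = exceptional_case_normalize[of _ J r w]
  from \<open>proportional_case n t J r w\<close> show "exceptional_case n t J r w"
    unfolding proportional_case_def using r w
  proof (elim disjE conjE, goal_cases)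
    case 1 then show ?case by (intro normalize[of 1]) (simp_all add: cases)
  next
    case 2 then show ?case by (intro normalize[of n]) (simp_all add: cases)
  next
    case 3 then show ?case by (intro normalize[of 2]) (simp_all add: cases)
  next
    case 4 then show ?case by (intro normalize[of 1]) (simp_all add: cases)
  next
    case 5 then show ?case by (intro normalize[of 2]) (simp_all add: cases)
  next
    case 6 then show ?case by (intro normalize[of 1]) (simp_all add: cases)
  next
    case 7 then show ?case by (intro normalize[of 1]) (simp_all add: cases)
  next
    case 8 then show ?case by (intro normalize[of 4]) (simp_all add: cases)
  next
    case 9 then show ?case by (intro normalize[of 1]) (simp_all add: cases)
  next
    case 10 then show ?case by (intro normalize[of 5]) (simp_all add: cases)
  next
    case 11 then show ?case by (intro normalize[of 1]) (simp_all add: cases)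
  next
    case 12 then show ?case by (intro normalize[of 6]) (simp_all add: cases)
  next
    case 13 then show ?case by (intro normalize[of 1]) (simp_all add: cases)
  next
    case 14 then show ?case by (intro normalize[of 1]) (simp_all add: cases)
  qed
qed

lemma sqrt_cubes: "(1 / sqrt 6) ^ 3 = 1 / 6 * (1 / sqrt 6)" "sqrt (8 / 5) ^ 3 = 8 / 5 * sqrt (8 / 5)" "sqrt 15 ^ 3 = 15 * sqrt 15"
  by (simp_all add: power3_eq_cube)

lemma sqrt_fourths: "(1 / sqrt 6) ^ 4 = 1 / 36" "sqrt (8 / 5) ^ 4 = 64 / 25" "sqrt 15 ^ 4 = 225"
  by (simp_all add: power4_eq_xxxx)

text \<open>The cubic equations of the pairs {1, 3}, {1, 4}, {1, 5} for m = 5, 6, 7 with X and Y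
  inserted; both sides are nonnegative, so squaring decides them.\<close>

lemma sqrt_ratios:
  "sqrt (5 / 4) * 15 = sqrt (5 / 6) * 10 * (27 * (1 / 6 * (1 / sqrt 6)))"
  "sqrt (6 / 5) * 24 = sqrt (6 / 8) * 30 * (1 / 2 * (8 / 5 * sqrt (8 / 5)))"
  "sqrt (7 / 6) * 35 = sqrt (7 / 10) * 63 * (1 / 81 * (15 * sqrt 15))"
  by (rule power2_eq_imp_eq; simp add: power_mult_distrib power_divide)+

text \<open>The two index pairs are exchanged by k -> m - k, which negates the cubic coefficients
  and keeps the quartic ones, so both have the same solution.\<close>

lemma pair_moments_5:
  assumes "r i > 0" "w i > 0" "r j > 0" "w j > 0" "i = 1 \<and> j = 3 \<or> i = 4 \<and> j = 2"
  shows "(cubic_moment 5 {i, j} r w 3 = 0 \<and> quartic_moment 5 {i, j} r w = 0) \<longleftrightarrow> r j = 1 / sqrt 6 * r i \<and> w j = 27 * w i"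
  using assms(5) sqrt_ratios(1) assms(1-4)
  by (intro pair_moments_iff) (auto simp: sqrt_cubes sqrt_fourths small_choose[unfolded One_nat_def])

lemma pair_moments_6:
  assumes "r i > 0" "w i > 0" "r j > 0" "w j > 0" "i = 1 \<and> j = 4 \<or> i = 5 \<and> j = 2"
  shows "(cubic_moment 6 {i, j} r w 3 = 0 \<and> quartic_moment 6 {i, j} r w = 0) \<longleftrightarrow> r j = sqrt (8 / 5) * r i \<and> w j = 1 / 2 * w i"
  using assms(5) sqrt_ratios(2) assms(1-4)
  by (intro pair_moments_iff) (auto simp: sqrt_cubes sqrt_fourths small_choose[unfolded One_nat_def])

lemma pair_moments_7:
  assumes "r i > 0" "w i > 0" "r j > 0" "w j > 0" "i = 1 \<and> j = 5 \<or> i = 6 \<and> j = 2"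
  shows "(cubic_moment 7 {i, j} r w 3 = 0 \<and> quartic_moment 7 {i, j} r w = 0) \<longleftrightarrow> r j = sqrt 15 * r i \<and> w j = 1 / 81 * w i"
  using assms(5) sqrt_ratios(3) assms(1-4)
  by (intro pair_moments_iff) (auto simp: sqrt_cubes sqrt_fourths small_choose[unfolded One_nat_def])

section \<open>Classification for t = 4 and t = 5\<close>

lemma classification_4_necessary:
  fixes r w :: "nat \<Rightarrow> real"
  assumes N: "N \<ge> 2" and J: "J \<subseteq> {1..N}"
    and r: "\<And>k. k \<in> J \<Longrightarrow> r k > 0" and w: "\<And>k. k \<in> J \<Longrightarrow> w k > 0"
    and cubic: "cubic_moment (Suc N) J r w 3 = 0" and quartic: "quartic_moment (Suc N) J r w = 0"
    and S: "(\<Sum>k\<in>J. Suc N choose k) = (if \<forall>k\<in>J. \<forall>l\<in>J. r k = r l then N * (N + 3) div 2 else (N + 1) * (N + 2) div 2)"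
  shows "proportional_case N 4 J r w"
proof -
  have J': "J \<subseteq> {1..<Suc N}" using J by auto
  note sign3 = cubic_moment_same_sign[OF J' r w cubic] and sign4 = quartic_moment_same_sign[OF J' r w quartic]
  have S': "(\<Sum>k\<in>J. Suc N choose k) = N * (N + 3) div 2 \<or> (\<Sum>k\<in>J. Suc N choose k) = (N + 1) * (N + 2) div 2"
    using S by metis
  consider "N = 2" "J = {1, 2}" | "N \<ge> 3" "J = {1, 2} \<or> J = {N - 1, N}"
    | "N \<ge> 3" "J = {1, N - 1} \<or> J = {2, N}" | "N = 5" "J = {3}"
    using size_4[OF J N S'] by metis
  then show ?thesis
  proof cases
    case 1
    then have "w 1 * r 1 ^ 3 = w (3 - 1) * r (3 - 1) ^ 3"
      using cubic by (subst cubic_moment_antipodal_pair[symmetric, of J 1 3]) auto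
    \<comment> \<open>For m = 3 the quartic coefficients vanish, so equal radii are excluded by size
      alone: the one-radius bound is 5, but there are 6 points.\<close>
    moreover have "r 2 \<noteq> r 1"
    proof
      assume "r 2 = r 1"
      then have one: "\<forall>k\<in>J. \<forall>l\<in>J. r k = r l" using 1 by auto
      have "(\<Sum>k\<in>J. 3 choose k) = (5::nat)" using S[unfolded if_P[OF one]] 1(1) by simp
      then show False using 1 small_choose(1,2) by simp
    qed
    ultimately show ?thesis using 1 by (simp add: proportional_case_def)
  next
    case 2
    \<comment> \<open>Here J lies on one side of m / 2, so the cubic terms cannot cancel.\<close>
    have "Suc N \<le> 2 * (N - 1)" using 2(1) by linarith
    then have "2 * 1 = Suc N \<or> 2 * N = Suc N"
      using 2 sign3[of 1] sign3[of N] by auto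
    then show ?thesis using 2(1) by auto
  next
    case 3
    consider "N = 3" | "N = 4" | "N = 5" | "N = 6" | "N \<ge> 7" using 3(1) by linarith
    then show ?thesis
    proof cases
      case N3: 1
      then have "2 * 1 = Suc N \<or> 2 * N = Suc N"
        using sign3[of 1] sign3[of N] 3(2) by auto
      then show ?thesis using N3 by auto
    next
      case N4: 2
      have "Suc N = 5" using N4 by simp
      then show ?thesis
        using 3(2) cubic quartic r w pair_moments_5[of r 1 w 3] pair_moments_5[of r 4 w 2] N4
        by (auto simp: proportional_case_def insert_commute)
    next
      case N5: 3
      have "Suc N = 6" using N5 by simp
      then show ?thesis
        using 3(2) cubic quartic r w pair_moments_6[of r 1 w 4] pair_moments_6[of r 5 w 2] N5
        by (auto simp: proportional_case_def insert_commute)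
    next
      case N6: 4
      have "Suc N = 7" using N6 by simp
      then show ?thesis
        using 3(2) cubic quartic r w pair_moments_7[of r 1 w 5] pair_moments_7[of r 6 w 2] N6
        by (auto simp: proportional_case_def insert_commute)
    next
      case 5
      then obtain d where d: "N = 7 + d" using le_Suc_ex by blast
      \<comment> \<open>For k = 2 or N - 1 the difference is (m - 3) (m - 8), zero at N = 7; the
        contradiction therefore uses the index 1 or N, where the inequality is strict.\<close>
      have "\<forall>k\<in>J. 6 * (k * (Suc N - k)) \<le> Suc N * (Suc N + 1)"
        using 3(2) by (auto simp: d algebra_simps)
      then have "6 * (1 * (Suc N - 1)) = Suc N * (Suc N + 1) \<or> 6 * (N * (Suc N - N)) = Suc N * (Suc N + 1)"
        using sign4[of 1] sign4[of N] 3(2) by blast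
      then show ?thesis by (auto simp: d algebra_simps)
    qed
  next
    case 4
    then show ?thesis using sign4[of 3] by simp
  qed
qed

lemma classification_4_sufficient:
  fixes r w :: "nat \<Rightarrow> real"
  assumes r: "\<And>k. k \<in> J \<Longrightarrow> r k > 0" and w: "\<And>k. k \<in> J \<Longrightarrow> w k > 0"
    and "proportional_case N 4 J r w"
  shows "cubic_moment (Suc N) J r w 3 = 0" "quartic_moment (Suc N) J r w = 0"
    "(\<Sum>k\<in>J. Suc N choose k) = (if \<forall>k\<in>J. \<forall>l\<in>J. r k = r l then N * (N + 3) div 2 else (N + 1) * (N + 2) div 2)" (is ?size)
proof -
  \<comment> \<open>None of the ratios is 1, so the radii differ and the bound for several radii
    applies.\<close>
  have ne: "1 / sqrt 6 * x \<noteq> x" "sqrt (8 / 5) * x \<noteq> x" "sqrt 15 * x \<noteq> x" if "x > 0" for x :: real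
  proof -
    have "1 / sqrt 6 \<noteq> 1" "sqrt (8 / 5) \<noteq> 1" "sqrt 15 \<noteq> 1" by simp_all
    then show "1 / sqrt 6 * x \<noteq> x" "sqrt (8 / 5) * x \<noteq> x" "sqrt 15 * x \<noteq> x"
      using that by (simp_all only: mult_cancel_right2) simp_all
  qed
  have multiple: "\<not> (\<forall>k\<in>J. \<forall>l\<in>J. r k = r l)" if "i \<in> J" "j \<in> J" "r i \<noteq> r j" for i j
    using that by blast
  let ?goal = "cubic_moment (Suc N) J r w 3 = 0 \<and> quartic_moment (Suc N) J r w = 0 \<and>
    (\<Sum>k\<in>J. Suc N choose k) = (N + 1) * (N + 2) div 2 \<and> \<not> (\<forall>k\<in>J. \<forall>l\<in>J. r k = r l)"
  have pair_5: ?goal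
    if "N = 4" "J = {i, j}" "i = 1 \<and> j = 3 \<or> i = 4 \<and> j = 2" "r j = 1 / sqrt 6 * r i" "w j = 27 * w i" for i j
  proof -
    have "(\<Sum>k\<in>J. 5 choose k) = (15::nat)"
      using that(2,3) small_choose(6-9) by (auto)
    moreover have "r j \<noteq> r i" using that ne(1)[of "r i"] r by auto
    moreover have "Suc N = 5" using that by simp
    ultimately show ?thesis using that pair_moments_5[OF _ _ _ _ that(3), of r w] multiple[of j i] r w by auto
  qed
  have pair_6: ?goal
    if "N = 5" "J = {i, j}" "i = 1 \<and> j = 4 \<or> i = 5 \<and> j = 2" "r j = sqrt (8 / 5) * r i" "w j = 1 / 2 * w i" for i j
  proof -
    have "(\<Sum>k\<in>J. 6 choose k) = (21::nat)"
      using that(2,3) small_choose(10-14) by (auto)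
    moreover have "r j \<noteq> r i" using that ne(2)[of "r i"] r by auto
    moreover have "Suc N = 6" using that by simp
    ultimately show ?thesis using that pair_moments_6[OF _ _ _ _ that(3), of r w] multiple[of j i] r w by auto
  qed
  have pair_7: ?goal
    if "N = 6" "J = {i, j}" "i = 1 \<and> j = 5 \<or> i = 6 \<and> j = 2" "r j = sqrt 15 * r i" "w j = 1 / 81 * w i" for i j
  proof -
    have "(\<Sum>k\<in>J. 7 choose k) = (28::nat)"
      using that(2,3) small_choose(15-20) by (auto)
    moreover have "r j \<noteq> r i" using that ne(3)[of "r i"] r by auto
    moreover have "Suc N = 7" using that by simp
    ultimately show ?thesis using that pair_moments_7[OF _ _ _ _ that(3), of r w] multiple[of j i] r w by auto
  qed
  \<comment> \<open>The reference orbit is written first, as in {4, 2}, to match the pair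
    lemmas.\<close>
  have "N = 2 \<and> J = {1, 2} \<and> r 2 \<noteq> r 1 \<and> w 1 * r 1 ^ 3 = w 2 * r 2 ^ 3 \<or>
      N = 4 \<and> J = {1, 3} \<and> r 3 = 1 / sqrt 6 * r 1 \<and> w 3 = 27 * w 1 \<or>
      N = 4 \<and> J = {4, 2} \<and> r 2 = 1 / sqrt 6 * r 4 \<and> w 2 = 27 * w 4 \<or>
      N = 5 \<and> J = {1, 4} \<and> r 4 = sqrt (8 / 5) * r 1 \<and> w 4 = 1 / 2 * w 1 \<or>
      N = 5 \<and> J = {5, 2} \<and> r 2 = sqrt (8 / 5) * r 5 \<and> w 2 = 1 / 2 * w 5 \<or>
      N = 6 \<and> J = {1, 5} \<and> r 5 = sqrt 15 * r 1 \<and> w 5 = 1 / 81 * w 1 \<or>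
      N = 6 \<and> J = {6, 2} \<and> r 2 = sqrt 15 * r 6 \<and> w 2 = 1 / 81 * w 6"
    using assms(3) by (simp add: proportional_case_def insert_commute)
  then have ?goal
  proof (elim disjE conjE, goal_cases)
    case 1
    then have "cubic_moment 3 J r w 3 = 0"
      by (subst cubic_moment_antipodal_pair[of J 1 3]) auto
    moreover have "quartic_moment 3 J r w = 0"
      using 1 by (simp add: quartic_moment_def)
    moreover have "(\<Sum>k\<in>J. 3 choose k) = (6::nat)" using 1 small_choose(1,2) by simp
    ultimately show ?case using 1 multiple[of 2 1] by simp
  next
    case 2 then show ?case by (intro pair_5[of 1 3]) simp_all
  next
    case 3 then show ?case by (intro pair_5[of 4 2]) simp_all
  next
    case 4 then show ?case by (intro pair_6[of 1 4]) simp_all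
  next
    case 5 then show ?case by (intro pair_6[of 5 2]) simp_all
  next
    case 6 then show ?case by (intro pair_7[of 1 5]) simp_all
  next
    case 7 then show ?case by (intro pair_7[of 6 2]) simp_all
  qed
  then show "cubic_moment (Suc N) J r w 3 = 0" "quartic_moment (Suc N) J r w = 0"
    ?size
    by (blast, blast, metis)
qed

text \<open>Equality of \<open>w * r ^ 3\<close> and of \<open>w * r ^ 5\<close> on opposite orbits
  gives equal squares of the radii, and then equal weights.\<close>

lemma antipodal_triple_equal:
  fixes r w :: "nat \<Rightarrow> real"
  assumes "finite J" "i \<in> J" "m - i \<in> J" "2 * i \<noteq> m" "i \<in> {1..<m}" "\<And>k. k \<in> J - {i, m - i} \<Longrightarrow> 2 * k = m"
    and pos: "r i > 0" "r (m - i) > 0" "w i > 0" "w (m - i) > 0"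
    and cubic: "cubic_moment m J r w 3 = 0" "cubic_moment m J r w 5 = 0"
  shows "r (m - i) = r i" "w (m - i) = w i"
proof -
  have *: "w i * r i ^ 3 = w (m - i) * r (m - i) ^ 3" "w i * r i ^ 5 = w (m - i) * r (m - i) ^ 5"
    using cubic cubic_moment_antipodal_pair[OF assms(1-6)] by blast+
  have "x ^ 5 = x ^ 3 * x\<^sup>2" for x :: real by (simp add: power_add[symmetric])
  then have "(w i * r i ^ 3) * (r i)\<^sup>2 = (w i * r i ^ 3) * (r (m - i))\<^sup>2"
    using * by (metis mult.assoc)
  then have "(r i)\<^sup>2 = (r (m - i))\<^sup>2" using pos by simp
  then show "r (m - i) = r i" using pos by (simp add: power2_eq_iff_nonneg)
  then show "w (m - i) = w i" using * pos by simp
qed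

lemma classification_5_necessary:
  fixes r w :: "nat \<Rightarrow> real"
  assumes N: "N \<ge> 2" and J: "J \<subseteq> {1..N}"
    and r: "\<And>k. k \<in> J \<Longrightarrow> r k > 0" and w: "\<And>k. k \<in> J \<Longrightarrow> w k > 0"
    and cubic: "cubic_moment (Suc N) J r w 3 = 0" "cubic_moment (Suc N) J r w 5 = 0"
    and quartic: "quartic_moment (Suc N) J r w = 0" and quintic: "quintic_moment (Suc N) J r w = 0"
    and S: "(\<Sum>k\<in>J. Suc N choose k) = (if \<forall>k\<in>J. \<forall>l\<in>J. r k = r l then N * (N + 1) else N * (N + 1) + 2)"
  shows "proportional_case N 5 J r w"
proof -
  have J': "J \<subseteq> {1..<Suc N}" using J by auto
  note sign3 = cubic_moment_same_sign[OF J' r w cubic(1)] and sign4 = quartic_moment_same_sign[OF J' r w quartic]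
    and single = odd_moments_single[OF J' r w cubic(2) quintic]
  have S': "(\<Sum>k\<in>J. Suc N choose k) = N * (N + 1) \<or> (\<Sum>k\<in>J. Suc N choose k) = N * (N + 1) + 2"
    using S by metis
  from size_5[OF J N S'] show ?thesis
  \<comment> \<open>The cases follow \<open>size_5\<close>. Sets on one side of m / 2 fall to the
    cubic signs, sets of constant quartic sign to \<open>sign4\<close>, and those with one orbit of
    a different product k (m - k) to \<open>single\<close>; the remaining four are solved.\<close>
  proof (elim disjE conjE, goal_cases)
    case 1
    then have "r (3 - 1) = r 1" "w (3 - 1) = w 1"
      using antipodal_triple_equal[of J 1 3 r w] cubic r w by force+
    then show ?case using 1 by (simp add: proportional_case_def)
  next
    case 2
    then have eq: "r (4 - 1) = r 1" "w (4 - 1) = w 1"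
      using antipodal_triple_equal[of J 1 4 r w] cubic r w by force+
    have "r 2 \<noteq> r 1"
    proof
      assume "r 2 = r 1"
      then have one: "\<forall>k\<in>J. \<forall>l\<in>J. r k = r l" using 2 eq by auto
      have "(\<Sum>k\<in>J. 4 choose k) = (12::nat)" using S[unfolded if_P[OF one]] 2(1) by simp
      then show False using 2 small_choose(3-5) by simp
    qed
    \<comment> \<open>For m = 4 the quartic coefficients, binomials included, are 8/3, -6, 8/3,
      which gives the ratio 8/9.\<close>
    moreover have "9 * (w 2 * r 2 ^ 4) = 8 * (w 1 * r 1 ^ 4)"
      using quartic 2 eq small_choose(3-5) by (simp add: quartic_moment_def)
    ultimately show ?case using 2 eq by (simp add: proportional_case_def)
  next
    case 3 then show ?case using sign4[of 2] by simp
  next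
    case 4 then show ?case using single[of 2 4] by force
  next
    case 5 then show ?case using single[of 3 4] by force
  next
    case 6 then show ?case using sign4[of 2] by simp
  next
    case 7
    then have eq: "r (6 - 1) = r 1" "w (6 - 1) = w 1"
      using antipodal_triple_equal[of J 1 6 r w] cubic r w by force+
    have "r 3 \<noteq> r 1"
    proof
      assume "r 3 = r 1"
      then have one: "\<forall>k\<in>J. \<forall>l\<in>J. r k = r l" using 7 eq by auto
      have "(\<Sum>k\<in>J. 6 choose k) = (30::nat)" using S[unfolded if_P[OF one]] 7(1) by simp
      then show False using 7 small_choose(10-14) by simp
    qed
    \<comment> \<open>For m = 6 they are 72/5, -80/3, 72/5 on the orbits 1, 3, 5, which gives
      27/25.\<close>
    moreover have "25 * (w 3 * r 3 ^ 4) = 27 * (w 1 * r 1 ^ 4)"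
      using quartic 7 eq small_choose(10-14) by (simp add: quartic_moment_def)
    ultimately show ?case using 7 eq by (simp add: proportional_case_def)
  next
    case 8 then show ?case using sign3[of 1] by simp
  next
    case 9 then show ?case using single[of 4 6] by force
  next
    case 10 then show ?case using sign4[of 2] by simp
  next
    case 11 then show ?case using single[of 3 6] by force
  next
    case 12 then show ?case using sign3[of 4] by simp
  next
    case 13 then show ?case using sign3[of 3] by simp
  next
    case 14 then show ?case using sign3[of 5] by simp
  next
    case 15
    then have "r (8 - 2) = r 2" "w (8 - 2) = w 2"
      using antipodal_triple_equal[of J 2 8 r w] cubic r w by force+
    then show ?case using 15 by (simp add: proportional_case_def)
  next
    case 16
    then obtain d where d: "N = 8 + d" using le_Suc_ex by blast
    have "\<forall>k\<in>J. 6 * (k * (Suc N - k)) \<le> Suc N * (Suc N + 1)"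
      using 16 by (auto simp: d algebra_simps)
    then have "6 * (2 * (Suc N - 2)) = Suc N * (Suc N + 1)"
      using sign4[of 2] 16 by blast
    then show ?case by (simp add: d algebra_simps)
  qed
qed

text \<open>The quartic moment vanishes term by term for m = 3 and m = 8, and through the weight
  relation for m = 4 and m = 6. Antipodality takes the form that \<open>design_5_sufficient\<close>
  expects.\<close>

lemma classification_5_sufficient:
  fixes r w :: "nat \<Rightarrow> real"
  assumes r: "\<And>k. k \<in> J \<Longrightarrow> r k > 0" and w: "\<And>k. k \<in> J \<Longrightarrow> w k > 0"
    and "proportional_case N 5 J r w"
  shows "\<And>k. k \<in> J \<Longrightarrow> Suc N - k \<in> J \<and> r (Suc N - k) = r k \<and> w (Suc N - k) = w k"
    "quartic_moment (Suc N) J r w = 0"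
    "(\<Sum>k\<in>J. Suc N choose k) = (if \<forall>k\<in>J. \<forall>l\<in>J. r k = r l then N * (N + 1) else N * (N + 1) + 2)" (is ?size)
proof -
  consider "N = 2" "J = {1, 2}" "r 2 = r 1" "w 2 = w 1"
    | "N = 7" "J = {2, 6}" "r 6 = r 2" "w 6 = w 2"
    | "N = 3" "J = {1, 2, 3}" "r 3 = r 1" "r 2 \<noteq> r 1" "w 3 = w 1" "9 * (w 2 * r 2 ^ 4) = 8 * (w 1 * r 1 ^ 4)"
    | "N = 5" "J = {1, 3, 5}" "r 5 = r 1" "r 3 \<noteq> r 1" "w 5 = w 1" "25 * (w 3 * r 3 ^ 4) = 27 * (w 1 * r 1 ^ 4)"
    using assms(3) unfolding proportional_case_def by (elim disjE conjE) simp_all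
  then have "(\<forall>k\<in>J. Suc N - k \<in> J \<and> r (Suc N - k) = r k \<and> w (Suc N - k) = w k) \<and> quartic_moment (Suc N) J r w = 0 \<and> ?size"
  proof cases
    case 1
    then show ?thesis using small_choose(1,2) by (simp add: quartic_moment_def)
  next
    case 2
    then show ?thesis using small_choose(21-27) by (simp add: quartic_moment_def)
  next
    case 3
    then show ?thesis using small_choose(3-5) by (simp add: quartic_moment_def)
  next
    case 4
    then show ?thesis using small_choose(10-14) by (simp add: quartic_moment_def)
  qed
  then show "\<And>k. k \<in> J \<Longrightarrow> Suc N - k \<in> J \<and> r (Suc N - k) = r k \<and> w (Suc N - k) = w k"
    "quartic_moment (Suc N) J r w = 0"
    ?size
    by blast+
qed

theorem theorem4p6:
  fixes t :: nat and J :: "nat set" and r w :: "nat \<Rightarrow> real"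
    and W :: "real ^ 'n::{finite,linorder} \<Rightarrow> real"
  assumes "CARD('n) \<ge> 2" and "t \<ge> 1"
    and "J \<subseteq> {1..CARD('n)}" and "J \<noteq> {}"
    and "\<And>k. k \<in> J \<Longrightarrow> r k > 0"
    and "\<And>k. k \<in> J \<Longrightarrow> w k > 0"
    and "\<And>k x. k \<in> J \<Longrightarrow> x \<in> scaled_orbit k (r k) \<Longrightarrow> W x = w k"
  shows "tight_euclidean_design t (A_union J r :: (real ^ 'n::{finite,linorder}) set) W \<longleftrightarrow>
         exceptional_case CARD('n) t J r w"
proof -
  let ?D = "moment_defect J r w :: ((real, 'n) vec \<Rightarrow> real) \<Rightarrow> real"
  let ?m = "Suc CARD('n)"
  let ?X = "A_union J r :: ((real, 'n) vec) set"
  note bound = design_bound_A_union[OF assms(3-5) refl]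
  have tight: "tight_euclidean_design t ?X W \<longleftrightarrow>
      (\<forall>f\<in>Poly_le t. ?D f = 0) \<and> (\<Sum>k\<in>J. ?m choose k) = design_bound t ?X"
  proof -
    have "euclidean_design t ?X W \<longleftrightarrow> (\<forall>f\<in>Poly_le t. ?D f = 0)"
      by (rule euclidean_design_iff[OF assms(3,5) refl assms(6,7)])
    moreover have "card ?X = (\<Sum>k\<in>J. ?m choose k)" by (rule sum_A_union(3)[OF assms(3,5)])
    ultimately show ?thesis by (simp only: tight_euclidean_design_def)
  qed
  have sufficient: "\<forall>f\<in>Poly_le t. ?D f = 0"
    if "t \<le> 4" "3 \<le> t \<Longrightarrow> cubic_moment ?m J r w 3 = 0" "4 \<le> t \<Longrightarrow> quartic_moment ?m J r w = 0"
    using design_le_4_sufficient[OF assms(3,5) refl that(1) _ that(2,3)] by blast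
  have cubic: "cubic_moment ?m J r w (2 * i + 3) = 0" if "\<forall>f\<in>Poly_le t. ?D f = 0" "2 * i + 3 \<le> t" for i
    by (rule cubic_moment_necessary[OF assms(3,5) refl that])
  have quartic: "quartic_moment ?m J r w = 0" if "\<forall>f\<in>Poly_le t. ?D f = 0" "4 \<le> t"
    by (rule quartic_moment_necessary[OF assms(3,5) refl that])
  have quintic: "quintic_moment ?m J r w = 0" if "\<forall>f\<in>Poly_le t. ?D f = 0" "5 \<le> t"
    by (rule quintic_moment_necessary[OF assms(3,5) refl that])
  have "tight_euclidean_design t ?X W \<longleftrightarrow> proportional_case CARD('n) t J r w"
  proof -
    consider "t = 1" | "t = 2" | "t = 3" | "t = 4" | "t = 5" | "t \<ge> 6" using assms(2) by linarith
    then show ?thesis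
    proof cases
      case 1
      \<comment> \<open>The bound for t = 1 is 2, while a single orbit already has at least 3
        points.\<close>
      have "card J \<noteq> 0" using assms(3,4) finite_subset by fastforce
      then have "1 * ?m \<le> card J * ?m" by (intro mult_le_mono1) linarith
      also have "\<dots> \<le> (\<Sum>k\<in>J. ?m choose k)" by (rule card_mult_le_sum_choose[OF assms(3)])
      finally have "(\<Sum>k\<in>J. ?m choose k) \<ge> 3" using assms(1) by simp
      then show ?thesis unfolding tight using bound(1) 1 by (simp add: proportional_case_def)
    next
      case 2
      then show ?thesis
        unfolding tight using sufficient bound(2) size_2[OF assms(3,4,1)] by (auto simp: proportional_case_def)
    next
      case 3
      \<comment> \<open>For m = 4 and k = 2 the factor m - 2 k is zero.\<close>
      have "cubic_moment 4 {2} r w 3 = 0" by (simp add: cubic_moment_def)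
      then have "cubic_moment ?m J r w 3 = 0" if "CARD('n) = 3 \<and> J = {2}" using that by simp
      then show ?thesis
        unfolding tight using 3 sufficient bound(3) size_3[OF assms(3,4,1)] by (auto simp: proportional_case_def)
    next
      case 4
      show ?thesis
      proof
        assume "tight_euclidean_design t ?X W"
        then show "proportional_case CARD('n) t J r w"
          unfolding tight using 4 bound(4) cubic[of 0] quartic
            classification_4_necessary[OF assms(1,3,5,6)] by simp
      next
        assume "proportional_case CARD('n) t J r w"
        then show "tight_euclidean_design t ?X W"
          unfolding tight using 4 bound(4) sufficient classification_4_sufficient[OF assms(5,6)] by simp
      qed
    next
      case 5
      show ?thesis
      proof
        assume "tight_euclidean_design t ?X W"
        then show "proportional_case CARD('n) t J r w"
          unfolding tight using 5 bound(5) cubic[of 0] cubic[of 1] quartic quintic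
            classification_5_necessary[OF assms(1,3,5,6)] by simp
      next
        assume "proportional_case CARD('n) t J r w"
        then have pc: "proportional_case CARD('n) 5 J r w" using 5 by simp
        note suff = classification_5_sufficient[OF assms(5,6) pc]
        have "\<forall>f\<in>Poly_le 5. ?D f = 0"
          using design_5_sufficient[OF assms(3,5) refl suff(1,2)] by blast
        then show "tight_euclidean_design t ?X W"
          unfolding tight using 5 bound(5) suff(3) by simp
      qed
    next
      case 6
      have "\<not> tight_euclidean_design t ?X W"
      proof
        assume "tight_euclidean_design t ?X W"
        then have design: "\<forall>f\<in>Poly_le t. ?D f = 0" using tight by blast
        show False
          by (rule no_6_design[OF assms(3) _ refl assms(1,4) _ design 6]) (use assms in auto)
      qed
      then show ?thesis using 6 by (simp add: proportional_case_def)
    qed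
  qed
  then show ?thesis using exceptional_case_iff[of J r w, OF assms(5,6)] by simp
qed

end
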